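(* Let $n\ge 3$ be an integer and let $\phi : SL_n(\mathbb{C}) \to SL_n(\mathbb{C})$ be a map. The following assertions are equivalent. (1) $\phi$ is a local automorphism of the group $SL_n(\mathbb C)$. (2) There exist $T \in GL_n(\mathbb{C})$ and a nonzero field endomorphism $\sigma$ of $\mathbb C$ such that either $$\phi(A) = T A_\sigma T^{-1}\quad \text{for all } A \in SL_n(\mathbb{C}),$$ or $$\phi(A) = T (A_{\sigma}^{-1})^t T^{-1}\quad \text{for all } A \in SL_n(\mathbb{C}).$$
   Context: A map $\phi: G\to G$ on a group $G$ (no algebraic property or bijectivity assumed) is called a local automorphism of $G$ if for every pair $a,b\in G$ there exists a group automorphism $\phi_{a,b}:G\to G$ (depending on $a,b$) such that $\phi(a)=\phi_{a,b}(a)$ and $\phi(b)=\phi_{a,b}(b)$. Automorphisms are abstract group automorphisms (no continuity assumed). $GL_n(\mathbb C)$ is the group of invertible complex $n\times n$ matrices, $SL_n(\mathbb C)$ its subgroup of matrices with determinant $1$. A nonzero field endomorphism of $\mathbb C$ is a nonzero additive and multiplicative map $\sigma:\mathbb C\to\mathbb C$ (so it is injective with $\sigma(1)=1$, but not necessarily surjective). For a matrix $A=[a_{ij}]$, $A_\sigma=[\sigma(a_{ij})]$ is the matrix obtained by applying $\sigma$ entrywise, and $A^t$ is the transpose of $A$. *)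

theory Defs
  imports "Jordan_Normal_Form.Determinant" "HOL-Algebra.Group"
begin

definition GL :: "nat \<Rightarrow> complex mat monoid"
  where "GL n = units_of (ring_mat TYPE(complex) n ())"

definition SL :: "nat \<Rightarrow> complex mat monoid"
  where "SL n = (GL n)\<lparr>carrier := {A \<in> carrier (GL n). det A = 1}\<rparr>"

definition local_automorphism :: "('a, 'b) monoid_scheme \<Rightarrow> ('a \<Rightarrow> 'a) \<Rightarrow> bool"
  where "local_automorphism G \<phi> \<longleftrightarrow>
    \<phi> \<in> carrier G \<rightarrow> carrier G \<and>
    (\<forall>a \<in> carrier G. \<forall>b \<in> carrier G. \<exists>f \<in> iso G G. \<phi> a = f a \<and> \<phi> b = f b)"

definition nonzero_field_endomorphism :: "('a::field \<Rightarrow> 'a) \<Rightarrow> bool"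
  where "nonzero_field_endomorphism \<sigma> \<longleftrightarrow>
    (\<forall>x y. \<sigma> (x + y) = \<sigma> x + \<sigma> y) \<and>
    (\<forall>x y. \<sigma> (x * y) = \<sigma> x * \<sigma> y) \<and>
    (\<exists>x. \<sigma> x \<noteq> 0)"

lemma group_GL: "group (GL n)"
proof -
  interpret ring "ring_mat TYPE(complex) n ()"
    by (rule ring_mat)
  show ?thesis
    unfolding GL_def by (rule units_group)
qed

lemma carrier_GL_subset: "carrier (GL n) \<subseteq> carrier_mat n n"
  by (auto simp: GL_def units_of_def Units_def ring_mat_simps)

lemma mult_GL: "A \<otimes>\<^bsub>GL n\<^esub> B = A * B"
  by (simp add: GL_def units_of_def ring_mat_simps)

lemma one_GL: "\<one>\<^bsub>GL n\<^esub> = 1\<^sub>m n"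
  by (simp add: GL_def units_of_def ring_mat_simps)

lemma subgroup_SL: "subgroup (carrier (SL n)) (GL n)"
proof -
  interpret group "GL n" by (rule group_GL)
  have "det (inv\<^bsub>GL n\<^esub> A) = 1" if A: "A \<in> carrier (GL n)" and "det A = 1" for A
  proof -
    have "det (inv\<^bsub>GL n\<^esub> A * A) = det (1\<^sub>m n :: complex mat)"
      using l_inv[OF A] by (simp add: mult_GL one_GL)
    moreover have "det (inv\<^bsub>GL n\<^esub> A * A) = det (inv\<^bsub>GL n\<^esub> A) * det A"
      using A inv_closed[OF A] carrier_GL_subset by (intro det_mult) auto
    ultimately show ?thesis
      using that by simp
  qed
  moreover have "det (A * B) = 1"
    if "A \<in> carrier (GL n)" "B \<in> carrier (GL n)" "det A = 1" "det B = 1" for A B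
  proof -
    have "det (A * B) = det A * det B"
      using that carrier_GL_subset by (intro det_mult) auto
    then show ?thesis using that by simp
  qed
  ultimately show ?thesis
    using m_closed one_closed
    by (intro subgroup.intro) (auto simp: SL_def mult_GL one_GL)
qed

lemma group_SL: "group (SL n)"
proof -
  have "SL n = (GL n)\<lparr>carrier := carrier (SL n)\<rparr>"
    by (simp add: SL_def)
  then show ?thesis
    using subgroup.subgroup_is_group[OF subgroup_SL group_GL] by metis
qed

end

theory Submission
  imports Defs
    "HOL-Computational_Algebra.Fundamental_Theorem_Algebra"
    "HOL-Analysis.Continuum_Not_Denumerable"
    "Jordan_Normal_Form.Schur_Decomposition"
begin

text \<open>An endomorphism \<open>\<sigma>\<close> of the complex field agrees on finitely many elements with an automorphism,
  which can be constructed one element at a time; hence maps of the second kind are local automorphisms.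

  Conversely, consider elements \<open>A\<close> that are noncentral with central square. Such an \<open>A\<close> is \<open>s (1 - 2 P)\<close>
  with \<open>P\<close> idempotent, and \<open>P\<close> or \<open>1 - P\<close> has rank one exactly when all products of \<open>A\<close> with another
  commuting conjugate of \<open>A\<close> are conjugate. So every automorphism permutes the rank one idempotents
  and preserves their orthogonality in both directions, and a local automorphism does so locally. Orthogonality
  detects when two rank one idempotents share a range or a kernel, and when one of their products
  vanishes. This suffices to find coordinates in which a local automorphism acts on rank one
  idempotents entrywise by an endomorphism \<open>\<sigma>\<close>, possibly after transposition. For a single automorphism,
  conjugation of idempotents then determines the automorphism up to a character with values in the centre, which
  is trivial. Knowing all automorphisms, one recovers the image of an arbitrary matrix \<open>A\<close> under a local
  automorphism from pairs consisting of \<open>A\<close> and a diagonalizable element with two eigenspaces.\<close>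

section \<open>Endomorphisms and automorphisms of the complex field\<close>

text \<open>Two obstacles shape the proof. An endomorphism \<sigma> may fail to be surjective, so an
  automorphism agreeing with it has to be built with control over its range: partial isomorphisms
  are extended to the whole field only when domain and range coincide, and agreement is maintained
  on countable subrings, which leaves room for a generic translation constant. Moreover, the
  automorphism that represents a local automorphism depends on the pair, and so does the field
  automorphism \<tau> inside it. Only data that every \<tau> respects can be compared between pairs:
  vanishing of products, the scalars 0 and 1, rational eigenvalues. This is why coordinates are
  recovered from zero tests, why compressions are exploited only for the values 0 and 1, and why the
  test elements \<open>asym P\<close> have the eigenvalues 2 and \<open>1 / 2 ^ (n - 1)\<close>, the
  second of which is dictated by determinant one. Dimension three enters through nonzero vectors
  killed by two functionals and through triples of distinct indices.\<close>

definition partial_iso :: "('a::field \<times> 'a) set \<Rightarrow> bool" where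
  "partial_iso r \<longleftrightarrow> (1, 1) \<in> r \<and>
    (\<forall>a b c d. (a, b) \<in> r \<longrightarrow> (c, d) \<in> r \<longrightarrow> (a - c, b - d) \<in> r \<and> (a * c, b * d) \<in> r) \<and>
    (\<forall>a b. (a, b) \<in> r \<longrightarrow> (a = 0 \<longleftrightarrow> b = 0))"

text \<open>Viewing \<open>r\<close> as an isomorphism of subrings, \<open>q\<close> arises from
  \<open>p\<close> by applying it to the coefficients.\<close>

definition poly_rel :: "('a::field \<times> 'a) set \<Rightarrow> 'a poly \<Rightarrow> 'a poly \<Rightarrow> bool" where
  "poly_rel r p q \<longleftrightarrow> (\<forall>i. (coeff p i, coeff q i) \<in> r)"

text \<open>The candidate extension of \<open>r\<close> that sends \<open>x\<close> to
  \<open>y\<close>. As a relation it always exists; whether it is an isomorphism is the zero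
  condition of \<open>partial_iso\<close>.\<close>

definition adjoin :: "('a::field \<times> 'a) set \<Rightarrow> 'a \<Rightarrow> 'a \<Rightarrow> ('a \<times> 'a) set" where
  "adjoin r x y = {(poly p x, poly q y) | p q. poly_rel r p q}"

lemma partial_isoD:
  assumes "partial_iso r"
  shows "(1, 1) \<in> r" "(0, 0) \<in> r"
    and "(a, b) \<in> r \<Longrightarrow> (c, d) \<in> r \<Longrightarrow> (a - c, b - d) \<in> r"
    and "(a, b) \<in> r \<Longrightarrow> (c, d) \<in> r \<Longrightarrow> (a + c, b + d) \<in> r"
    and "(a, b) \<in> r \<Longrightarrow> (c, d) \<in> r \<Longrightarrow> (a * c, b * d) \<in> r"
    and "(a, b) \<in> r \<Longrightarrow> (- a, - b) \<in> r"
    and "(a, b) \<in> r \<Longrightarrow> a = 0 \<longleftrightarrow> b = 0"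
proof -
  have diff: "(a - c, b - d) \<in> r" if "(a, b) \<in> r" "(c, d) \<in> r" for a b c d
    using assms that by (auto simp: partial_iso_def)
  show one: "(1, 1) \<in> r" using assms by (auto simp: partial_iso_def)
  show zero: "(0, 0) \<in> r" using diff[OF one one] by simp
  show "(a, b) \<in> r \<Longrightarrow> (c, d) \<in> r \<Longrightarrow> (a - c, b - d) \<in> r" by (rule diff)
  show neg: "(a, b) \<in> r \<Longrightarrow> (- a, - b) \<in> r" for a b using diff[OF zero, of a b] by simp
  show "(a, b) \<in> r \<Longrightarrow> (c, d) \<in> r \<Longrightarrow> (a + c, b + d) \<in> r"
    using diff[OF _ neg, of a b c d] by simp
  show "(a, b) \<in> r \<Longrightarrow> (c, d) \<in> r \<Longrightarrow> (a * c, b * d) \<in> r"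
    "(a, b) \<in> r \<Longrightarrow> a = 0 \<longleftrightarrow> b = 0"
    using assms by (auto simp: partial_iso_def)
qed

lemma partial_iso_sum:
  assumes "partial_iso r" "\<And>i. i \<in> A \<Longrightarrow> (f i, g i) \<in> r"
  shows "(sum f A, sum g A) \<in> r"
  using assms(2)
  by (induction A rule: infinite_finite_induct) (auto intro: partial_isoD[OF assms(1)])

text \<open>Relations rather than functions make domain and range interchangeable: a totality
  result, applied to the converse, becomes a surjectivity result.\<close>

lemma partial_iso_converse: "partial_iso r \<Longrightarrow> partial_iso (r\<inverse>)"
  unfolding partial_iso_def by blast

text \<open>The zero clause of \<open>partial_iso\<close>, applied to a difference, yields
  single-valuedness and injectivity at once.\<close>

lemma partial_iso_functional:
  assumes "partial_iso r" "(a, b) \<in> r" "(c, d) \<in> r"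
  shows "a = c \<longleftrightarrow> b = d"
  using partial_isoD(7)[OF assms(1) partial_isoD(3)[OF assms]] by simp

lemma poly_rel_converse: "poly_rel (r\<inverse>) p q \<longleftrightarrow> poly_rel r q p"
  by (simp add: poly_rel_def)

lemma poly_rel_mono: "poly_rel r p q \<Longrightarrow> r \<subseteq> s \<Longrightarrow> poly_rel s p q"
  by (auto simp: poly_rel_def)

lemma poly_rel_degree:
  assumes "partial_iso r" "poly_rel r p q"
  shows "degree p = degree q" "p = 0 \<longleftrightarrow> q = 0"
proof -
  have "coeff p i = 0 \<longleftrightarrow> coeff q i = 0" for i
    using partial_isoD(7)[OF assms(1)] assms(2) by (auto simp: poly_rel_def)
  then show "degree p = degree q" "p = 0 \<longleftrightarrow> q = 0"
    by (auto simp: degree_def poly_eq_iff)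
qed

lemma poly_rel_intros:
  assumes "partial_iso r"
  shows poly_rel_const: "(a, b) \<in> r \<Longrightarrow> poly_rel r [:a:] [:b:]"
    and poly_rel_pCons: "(a, b) \<in> r \<Longrightarrow> poly_rel r p q \<Longrightarrow> poly_rel r (pCons a p) (pCons b q)"
    and poly_rel_monom: "(a, b) \<in> r \<Longrightarrow> poly_rel r (monom a k) (monom b k)"
    and poly_rel_0: "poly_rel r 0 0"
    and poly_rel_diff: "poly_rel r p q \<Longrightarrow> poly_rel r p' q' \<Longrightarrow> poly_rel r (p - p') (q - q')"
    and poly_rel_add: "poly_rel r p q \<Longrightarrow> poly_rel r p' q' \<Longrightarrow> poly_rel r (p + p') (q + q')"
    and poly_rel_mult: "poly_rel r p q \<Longrightarrow> poly_rel r p' q' \<Longrightarrow> poly_rel r (p * p') (q * q')"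
  by (auto simp: poly_rel_def coeff_pCons coeff_mult
      intro!: partial_iso_sum[OF assms] partial_isoD[OF assms] split: nat.split)

lemma adjoin_supset:
  assumes "partial_iso r"
  shows "r \<subseteq> adjoin r x y" "(x, y) \<in> adjoin r x y"
proof -
  show "r \<subseteq> adjoin r x y"
  proof (clarify)
    fix a b assume "(a, b) \<in> r"
    from poly_rel_const[OF assms this] show "(a, b) \<in> adjoin r x y"
      by (force simp: adjoin_def)
  qed
  have "poly_rel r [:0, 1:] [:0, 1:]"
    by (intro poly_rel_intros partial_isoD assms)
  then show "(x, y) \<in> adjoin r x y" by (force simp: adjoin_def)
qed

lemma partial_iso_adjoin:
  assumes "partial_iso r" "\<And>p q. poly_rel r p q \<Longrightarrow> poly p x = 0 \<longleftrightarrow> poly q y = 0"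
  shows "partial_iso (adjoin r x y)"
  unfolding partial_iso_def
proof (intro conjI allI impI)
  show "(1, 1) \<in> adjoin r x y"
    using adjoin_supset(1)[OF assms(1)] partial_isoD(1)[OF assms(1)] by blast
next
  fix a b c d assume "(a, b) \<in> adjoin r x y" "(c, d) \<in> adjoin r x y"
  then obtain p q p' q' where "poly_rel r p q" "poly_rel r p' q'" and
    eq: "a = poly p x" "b = poly q y" "c = poly p' x" "d = poly q' y"
    by (auto simp: adjoin_def)
  then have "poly_rel r (p - p') (q - q')" "poly_rel r (p * p') (q * q')"
    by (auto intro: poly_rel_intros assms)
  then show "(a - c, b - d) \<in> adjoin r x y" "(a * c, b * d) \<in> adjoin r x y"
    unfolding adjoin_def eq by (force, force)
next
  fix a b assume "(a, b) \<in> adjoin r x y"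
  then show "a = 0 \<longleftrightarrow> b = 0" using assms(2) by (auto simp: adjoin_def)
qed

text \<open>Passage to fractions on both sides. Compared with a maximal \<open>r\<close>, it shows
  that domain and range of \<open>r\<close> are closed under inverses. Independence of the chosen
  representation is contained in the zero clause for differences.\<close>

lemma partial_iso_fractions:
  assumes r: "partial_iso r"
  defines "s \<equiv> {(a / c, b / d) | a b c d. (a, b) \<in> r \<and> (c, d) \<in> r \<and> c \<noteq> 0}"
  shows "partial_iso s" "r \<subseteq> s" "(a, b) \<in> r \<Longrightarrow> (inverse a, inverse b) \<in> s"
proof -
  note D = partial_isoD[OF r]
  show "r \<subseteq> s"
    using D(1) unfolding s_def by (force intro: exI[of _ 1])
  show "(inverse a, inverse b) \<in> s" if "(a, b) \<in> r"
  proof (cases "a = 0")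
    case True
    then have "b = 0" using D(7)[OF that] by simp
    then show ?thesis using True \<open>r \<subseteq> s\<close> D(2) by auto
  next
    case False
    then show ?thesis using that D(1) unfolding s_def by (force simp: inverse_eq_divide)
  qed
  show "partial_iso s"
    unfolding partial_iso_def
  proof (intro conjI allI impI)
    show "(1, 1) \<in> s" using D(1) \<open>r \<subseteq> s\<close> by auto
  next
    fix a b c d assume "(a, b) \<in> s" "(c, d) \<in> s"
    then obtain a1 b1 a2 b2 c1 d1 c2 d2 where
      *: "(a1, b1) \<in> r" "(a2, b2) \<in> r" "(c1, d1) \<in> r" "(c2, d2) \<in> r" "a2 \<noteq> 0" "c2 \<noteq> 0" and
      eq: "a = a1 / a2" "b = b1 / b2" "c = c1 / c2" "d = d1 / d2"
      by (auto simp: s_def)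
    have nz: "b2 \<noteq> 0" "d2 \<noteq> 0" using D(7)[OF *(2)] D(7)[OF *(4)] * by auto
    have "(a1 * c2 - c1 * a2, b1 * d2 - d1 * b2) \<in> r" "(a1 * c1, b1 * d1) \<in> r" "(a2 * c2, b2 * d2) \<in> r"
      using * by (auto intro!: D)
    moreover have "a - c = (a1 * c2 - c1 * a2) / (a2 * c2)" "b - d = (b1 * d2 - d1 * b2) / (b2 * d2)"
      "a * c = (a1 * c1) / (a2 * c2)" "b * d = (b1 * d1) / (b2 * d2)"
      using * nz unfolding eq by (auto simp: field_simps)
    moreover have "a2 * c2 \<noteq> 0" using * by simp
    ultimately show "(a - c, b - d) \<in> s" "(a * c, b * d) \<in> s"
      unfolding s_def by blast+
  next
    fix a b assume "(a, b) \<in> s"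
    then show "a = 0 \<longleftrightarrow> b = 0" using D(7) by (auto simp: s_def)
  qed
qed

text \<open>Euclidean division runs in parallel on both sides: each step removes the leading terms
  with factors \<open>u\<close> and \<open>v\<close> that correspond under \<open>r\<close>, because
  \<open>r\<close> respects inverses. Hence quotients and remainders correspond as well.\<close>

lemma poly_rel_division:
  assumes r: "partial_iso r" and inv: "\<And>a b. (a, b) \<in> r \<Longrightarrow> (inverse a, inverse b) \<in> r"
    and pq: "poly_rel r p q" "p \<noteq> 0" and "poly_rel r p' q'"
  shows "\<exists>a b c d. poly_rel r a b \<and> poly_rel r c d \<and> p' = a * p + c \<and> q' = b * q + d \<and>
    (c = 0 \<or> degree c < degree p)"
  using assms(5)
proof (induction "degree p'" arbitrary: p' q' rule: less_induct)
  case less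
  note D = partial_isoD[OF r] and I = poly_rel_intros[OF r]
  show ?case
  proof (cases "p' = 0 \<or> degree p' < degree p")
    case True
    have "p' = 0 * p + p'" "q' = 0 * q + q'" by auto
    then show ?thesis using less.prems True I(4) by blast
  next
    case False
    define k where "k = degree p' - degree p"
    define u where "u = lead_coeff p' * inverse (lead_coeff p)"
    define v where "v = lead_coeff q' * inverse (lead_coeff q)"
    have deg: "degree q = degree p" "degree q' = degree p'" 
      using poly_rel_degree[OF r pq(1)] poly_rel_degree[OF r less.prems] by auto
    have uv: "(u, v) \<in> r" unfolding u_def v_def
      using pq(1) less.prems deg by (intro D inv) (metis poly_rel_def)+
    define p2 where "p2 = p' - monom u k * p"
    define q2 where "q2 = q' - monom v k * q"
    have pq2: "poly_rel r p2 q2" unfolding p2_def q2_def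
      using uv pq less.prems by (intro I)
    have "u \<noteq> 0" using False pq(2) by (simp add: u_def)
    have degm: "degree (monom u k * p) = degree p'"
      using \<open>u \<noteq> 0\<close> pq(2) False by (simp add: degree_mult_eq degree_monom_eq k_def monom_eq_0_iff)
    have lead: "coeff (monom u k * p) (degree p') = lead_coeff p'"
      using False pq(2) by (simp add: coeff_monom_mult k_def u_def)
    have "p2 = 0 \<or> degree p2 < degree p'"
    proof (cases "degree p' = 0")
      \<comment> \<open>In degree zero the cancellation must produce the zero polynomial, since the
        degree cannot drop further.\<close>
      case True
      then have "degree p2 = 0" using degm unfolding p2_def
        by (metis degree_diff_le le_zero_eq)
      moreover have "coeff p2 0 = 0" using lead True by (simp add: p2_def)
      ultimately show ?thesis by (metis leading_coeff_0_iff)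
    next
      case False
      have "degree p2 \<le> degree p'" unfolding p2_def by (rule degree_diff_le) (simp_all add: degm)
      moreover have "coeff p2 (degree p') = 0" using lead by (simp add: p2_def)
      ultimately show ?thesis
        by (metis le_neq_implies_less leading_coeff_0_iff)
    qed
    then show ?thesis
    proof
      assume "p2 = 0"
      moreover from this have "q2 = 0" using poly_rel_degree[OF r pq2] by simp
      ultimately have "p' = monom u k * p + 0" "q' = monom v k * q + 0"
        by (auto simp: p2_def q2_def)
      then show ?thesis using I(3)[OF uv] I(4) by blast
    next
      assume "degree p2 < degree p'"
      from less.hyps[OF this pq2] obtain a b c d where
        *: "poly_rel r a b" "poly_rel r c d" "p2 = a * p + c" "q2 = b * q + d" "c = 0 \<or> degree c < degree p"
        by blast
      have "p' = (monom u k + a) * p + c" "q' = (monom v k + b) * q + d"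
        using *(3,4) by (auto simp: p2_def q2_def algebra_simps)
      then show ?thesis using *(1,2,5) I(6)[OF I(3)[OF uv] *(1)] by blast
    qed
  qed
qed

text \<open>A polynomial of least degree over the domain annihilating \<open>x\<close> is irreducible there, so any root
  \<open>y\<close> of the corresponding polynomial over the range is conjugate to \<open>x\<close>.\<close>

lemma algebraic_conjugate_exists:
  fixes r :: "(complex \<times> complex) set"
  assumes r: "partial_iso r" and inv: "\<And>a b. (a, b) \<in> r \<Longrightarrow> (inverse a, inverse b) \<in> r"
    and ex: "poly_rel r m m'" "m \<noteq> 0" "poly m x = 0"
  shows "\<exists>y. \<forall>p q. poly_rel r p q \<longrightarrow> (poly p x = 0 \<longleftrightarrow> poly q y = 0)"
proof -
  note I = poly_rel_intros[OF r]
  define S where "S = {(p, q). poly_rel r p q \<and> p \<noteq> 0 \<and> poly p x = 0}"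
  have "(m, m') \<in> S" using ex by (simp add: S_def)
  then obtain p q where pqS: "(p, q) \<in> S" and min: "\<And>p' q'. (p', q') \<in> S \<Longrightarrow> degree p \<le> degree p'"
    using exists_least_iff[of "\<lambda>d. \<exists>p q. (p, q) \<in> S \<and> degree p = d"]
    by (metis not_le_imp_less)
  have pq: "poly_rel r p q" "p \<noteq> 0" "poly p x = 0" using pqS by (auto simp: S_def)
  have least: "c = 0" if "poly_rel r c d" "poly c x = 0" "degree c < degree p \<or> c = 0" for c d
    using min[of c d] that by (force simp: S_def)
  have deg: "degree q = degree p" "q \<noteq> 0" using poly_rel_degree[OF r pq(1)] pq by auto
  have "degree p \<noteq> 0"
  proof
    assume "degree p = 0"
    then obtain a where "p = [:a:]" by (metis degree_eq_zeroE)
    then show False using pq by simp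
  qed
  then obtain y where y: "poly q y = 0"
    using fundamental_theorem_of_algebra_alt[of q] deg by (metis degree_pCons_0)
  \<comment> \<open>Minimality has to be transported to \<open>y\<close>. A related pair of least
    degree whose second member vanishes at \<open>y\<close> divides \<open>p\<close> and
    \<open>q\<close> by the division lemma; then \<open>p\<close> splits into two factors of smaller
    degree, one of which vanishes at \<open>x\<close>, against the choice of
    \<open>p\<close>.\<close>
  have least': "d = 0" if cd: "poly_rel r c d" "poly d y = 0" "degree c < degree p \<or> c = 0" for c d
  proof (rule ccontr)
    assume "d \<noteq> 0"
    define S' where "S' = {(c, d). poly_rel r c d \<and> d \<noteq> 0 \<and> poly d y = 0 \<and> degree c < degree p}"
    have "c \<noteq> 0" using poly_rel_degree[OF r cd(1)] \<open>d \<noteq> 0\<close> by simp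
    then have "(c, d) \<in> S'" using cd \<open>d \<noteq> 0\<close> by (simp add: S'_def)
    then obtain c d where cdS: "(c, d) \<in> S'" and min: "\<And>c' d'. (c', d') \<in> S' \<Longrightarrow> degree c \<le> degree c'"
      using exists_least_iff[of "\<lambda>k. \<exists>p q. (p, q) \<in> S' \<and> degree p = k"]
      by (metis not_le_imp_less)
    have cd: "poly_rel r c d" "d \<noteq> 0" "poly d y = 0" "degree c < degree p" using cdS by (auto simp: S'_def)
    have c0: "c \<noteq> 0" and degcd: "degree c = degree d" using poly_rel_degree[OF r cd(1)] cd by auto
    have "degree c \<noteq> 0"
    proof
      assume "degree c = 0"
      then obtain a where "d = [:a:]" using degcd by (metis degree_eq_zeroE)
      then show False using cd by simp
    qed
    obtain a b e f where *: "poly_rel r a b" "poly_rel r e f" "p = a * c + e" "q = b * d + f"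
      "e = 0 \<or> degree e < degree c"
      using poly_rel_division[OF r inv cd(1) c0 pq(1)] by blast
    have "poly f y = 0" using *(4) y cd by simp
    then have "e = 0"
      using *(2,5) min[of e f] cd(4) poly_rel_degree[OF r *(2)] by (force simp: S'_def)
    then have "p = a * c" using * by simp
    then have "a \<noteq> 0" "poly a x = 0 \<or> poly c x = 0" "degree p = degree a + degree c"
      using pq c0 by (auto simp: degree_mult_eq)
    then show False
      using least[OF *(1)] least[OF cd(1)] cd(4) c0 \<open>degree c \<noteq> 0\<close> by auto
  qed
  have "poly p' x = 0 \<longleftrightarrow> poly q' y = 0" if pq': "poly_rel r p' q'" for p' q'
  proof -
    obtain a b c d where *: "poly_rel r a b" "poly_rel r c d" "p' = a * p + c" "q' = b * q + d"
      "c = 0 \<or> degree c < degree p"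
      using poly_rel_division[OF r inv pq(1,2) pq'] by blast
    have "poly p' x = poly c x" "poly q' y = poly d y" using * pq y by simp_all
    moreover have "c = 0 \<longleftrightarrow> d = 0" using poly_rel_degree[OF r *(2)] by simp
    ultimately show ?thesis using least[OF *(2)] least'[OF *(2)] *(5) by force
  qed
  then show ?thesis by blast
qed

section \<open>Maximal partial isomorphisms and their extension to the whole field\<close>

lemma partial_iso_Union_chain:
  assumes "C \<noteq> {}" "subset.chain A C" "\<And>r. r \<in> C \<Longrightarrow> partial_iso r"
  shows "partial_iso (\<Union>C)"
  unfolding partial_iso_def
proof (intro conjI allI impI)
  show "(1, 1) \<in> \<Union>C" using assms(1,3) partial_isoD(1) by blast
next
  fix a b c d assume "(a, b) \<in> \<Union>C" "(c, d) \<in> \<Union>C"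
  then obtain r s where "r \<in> C" "s \<in> C" "(a, b) \<in> r" "(c, d) \<in> s" by blast
  moreover from this have "r \<subseteq> s \<or> s \<subseteq> r" using assms(2) by (auto simp: subset_chain_def)
  ultimately obtain t where "t \<in> C" "(a, b) \<in> t" "(c, d) \<in> t" by blast
  then show "(a - c, b - d) \<in> \<Union>C" "(a * c, b * d) \<in> \<Union>C"
    using assms(3) partial_isoD(3,5) by blast+
next
  fix a b assume "(a, b) \<in> \<Union>C"
  then show "a = 0 \<longleftrightarrow> b = 0" using assms(3) partial_isoD(7) by blast
qed

text \<open>The side condition \<open>P\<close> lets one application of Zorn's lemma serve three
  purposes: equal domain and range, domain and range inside a fixed field, and no
  constraint.\<close>

lemma maximal_partial_iso:
  assumes r0: "partial_iso r0" "P r0"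
    and P: "\<And>C. C \<noteq> {} \<Longrightarrow> (\<And>r. r \<in> C \<Longrightarrow> P r) \<Longrightarrow> P (\<Union>C)"
  obtains r where "partial_iso r" "r0 \<subseteq> r" "P r"
    "\<And>s. partial_iso s \<Longrightarrow> P s \<Longrightarrow> r \<subseteq> s \<Longrightarrow> s = r"
proof -
  define A where "A = {r. partial_iso r \<and> r0 \<subseteq> r \<and> P r}"
  have "r0 \<in> A" using r0 by (simp add: A_def)
  moreover have "\<Union>C \<in> A" if C: "C \<noteq> {}" "subset.chain A C" for C
  proof -
    have "C \<subseteq> A" using C by (simp add: subset_chain_def)
    then have *: "partial_iso r" "r0 \<subseteq> r" "P r" if "r \<in> C" for r using that by (auto simp: A_def)
    show ?thesis
      using partial_iso_Union_chain[OF C *(1)] P[OF C(1) *(3)] *(2) C(1) by (auto simp: A_def)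
  qed
  ultimately obtain r where "r \<in> A" "\<forall>s\<in>A. r \<subseteq> s \<longrightarrow> s = r"
    using subset_Zorn_nonempty[of A] by auto
  then show ?thesis using that[of r] by (auto simp: A_def)
qed

text \<open>A maximal \<open>r\<close> coincides with its own relation of fractions.\<close>

lemma maximal_partial_iso_inverse:
  assumes "partial_iso r" and max: "\<And>s. partial_iso s \<Longrightarrow> r \<subseteq> s \<Longrightarrow> s = r" and "(a, b) \<in> r"
  shows "(inverse a, inverse b) \<in> r"
  by (rule partial_iso_fractions(3)[OF assms(1,3), unfolded max[OF partial_iso_fractions(1,2)[OF assms(1)]]])

definition field_automorphism :: "('a::field \<Rightarrow> 'a) \<Rightarrow> bool" where
  "field_automorphism \<tau> \<longleftrightarrow> bij \<tau> \<and> (\<forall>x y. \<tau> (x + y) = \<tau> x + \<tau> y) \<and> (\<forall>x y. \<tau> (x * y) = \<tau> x * \<tau> y)"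

text \<open>An algebraic \<open>z\<close> has a conjugate over the range, so \<open>r\<close> can be
  extended to \<open>z\<close>; by maximality \<open>z\<close> is already in the domain.\<close>

lemma partial_iso_algebraic_total:
  fixes r :: "(complex \<times> complex) set"
  assumes r: "partial_iso r" and max: "\<And>s. partial_iso s \<Longrightarrow> r \<subseteq> s \<Longrightarrow> s = r"
    and alg: "\<And>z. \<exists>p q. poly_rel r p q \<and> p \<noteq> 0 \<and> poly p z = 0"
  shows "z \<in> Domain r"
proof -
  obtain p q where pq: "poly_rel r p q" "p \<noteq> 0" "poly p z = 0" using alg by blast
  have "(inverse a, inverse b) \<in> r" if "(a, b) \<in> r" for a b
    using maximal_partial_iso_inverse[OF r max that] by blast
  from algebraic_conjugate_exists[OF r this pq] obtain y where
    "\<And>p q. poly_rel r p q \<Longrightarrow> poly p z = 0 \<longleftrightarrow> poly q y = 0" by auto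
  from max[OF partial_iso_adjoin[OF r this] adjoin_supset(1)[OF r]] adjoin_supset(2)[OF r, of z y]
  show ?thesis by (auto intro!: DomainI)
qed

lemma maximal_converse:
  assumes max: "\<And>s. partial_iso s \<Longrightarrow> r \<subseteq> s \<Longrightarrow> s = r" and "partial_iso s" "r\<inverse> \<subseteq> s"
  shows "s = r\<inverse>"
proof -
  have "s\<inverse> = r" using assms partial_iso_converse[OF assms(2)] by (intro max) auto
  then show ?thesis by auto
qed

lemma poly_rel_from_Domain:
  assumes "partial_iso r" "\<And>i. coeff p i \<in> Domain r"
  obtains q where "poly_rel r p q"
proof -
  have "\<forall>i. \<exists>b. (coeff p i, b) \<in> r" using assms(2) by auto
  then obtain f where f: "\<And>i. (coeff p i, f i) \<in> r" by metis
  have "f i = 0" if "i > degree p" for i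
    using partial_isoD(7)[OF assms(1) f[of i]] coeff_eq_0[OF that] by simp
  then have "coeff (Abs_poly f) = f"
    by (intro coeff_Abs_poly[of "degree p"]) auto
  then show ?thesis using f that[of "Abs_poly f"] by (simp add: poly_rel_def)
qed

text \<open>Since the domain and the range agree, transcendental elements can be added as fixed points. So
  \<open>r0\<close> extends to an automorphism of a subring over which everything is algebraic, and this extends to
  all of the field.\<close>

lemma partial_automorphism_extends:
  fixes r0 :: "(complex \<times> complex) set"
  assumes "partial_iso r0" "Domain r0 = Range r0"
  obtains \<tau> where "field_automorphism \<tau>" "\<And>a b. (a, b) \<in> r0 \<Longrightarrow> \<tau> a = b"
proof -
  obtain r where r: "partial_iso r" "r0 \<subseteq> r" "Domain r = Range r"
    and maxr: "\<And>s. partial_iso s \<Longrightarrow> Domain s = Range s \<Longrightarrow> r \<subseteq> s \<Longrightarrow> s = r"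
    by (rule maximal_partial_iso[of r0 "\<lambda>r. Domain r = Range r"]) 
      (use assms in \<open>auto simp: Domain_Union Range_Union\<close>)
  have alg: "\<exists>p q. poly_rel r p q \<and> p \<noteq> 0 \<and> poly p z = 0" for z
  proof (rule ccontr)
    assume *: "\<not> ?thesis"
    \<comment> \<open>As domain and range agree, a \<open>z\<close> that is transcendental over the
      one is transcendental over the other, so sending \<open>z\<close> to itself is
      consistent.\<close>
    have **: "q = 0" if "poly_rel r p q" "poly q z = 0" for p q
    proof -
      have "coeff q i \<in> Domain r" for i using that(1) r(3) by (auto simp: poly_rel_def)
      then obtain q' where "poly_rel r q q'" by (rule poly_rel_from_Domain[OF r(1)])
      then show ?thesis using * that(2) by blast
    qed
    have iso: "partial_iso (adjoin r z z)"
      using * ** poly_rel_degree(2)[OF r(1)]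
      by (intro partial_iso_adjoin[OF r(1)]) (metis poly_0)
    have "Domain (adjoin r z z) = Range (adjoin r z z)"
    proof (intro equalityI subsetI)
      fix a assume "a \<in> Domain (adjoin r z z)"
      then obtain p q where pq: "a = poly p z" "poly_rel r p q" by (auto simp: adjoin_def)
      then have "coeff p i \<in> Domain (r\<inverse>)" for i using r(3) by (auto simp: poly_rel_def)
      then obtain q' where "poly_rel r q' p"
        using poly_rel_from_Domain[OF partial_iso_converse[OF r(1)]] poly_rel_converse by metis
      then show "a \<in> Range (adjoin r z z)" using pq by (auto simp: adjoin_def)
    next
      fix a assume "a \<in> Range (adjoin r z z)"
      then obtain p q where pq: "a = poly q z" "poly_rel r p q" by (auto simp: adjoin_def)
      then have "coeff q i \<in> Domain r" for i using r(3) by (auto simp: poly_rel_def)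
      then obtain q' where "poly_rel r q q'"
        using poly_rel_from_Domain[OF r(1)] by metis
      then show "a \<in> Domain (adjoin r z z)" using pq by (auto simp: adjoin_def)
    qed
    from maxr[OF iso this adjoin_supset(1)[OF r(1)]] have "(z, z) \<in> r"
      using adjoin_supset(2)[OF r(1), of z z] by simp
    then have "poly_rel r [:- z, 1:] [:- z, 1:]"
      by (intro poly_rel_intros partial_isoD r(1))
    moreover have "poly [:- z, 1:] z = 0" "[:- z, 1:] \<noteq> 0" by simp_all
    ultimately show False using * by blast
  qed
  \<comment> \<open>The second extension drops the condition on domain and range. Every number is
    algebraic over \<open>Domain r\<close>, which equals \<open>Range r\<close>, so a maximal
    \<open>s\<close> is total, and so is its converse.\<close>
  obtain s where s: "partial_iso s" "r \<subseteq> s" and maxs: "\<And>t. partial_iso t \<Longrightarrow> s \<subseteq> t \<Longrightarrow> t = s"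
    using maximal_partial_iso[of r "\<lambda>_. True"] r(1) by metis
  have dom: "z \<in> Domain s" for z
    using alg poly_rel_mono[OF _ s(2)] by (intro partial_iso_algebraic_total[OF s(1) maxs]) blast+
  have "z \<in> Domain (s\<inverse>)" for z
  proof (rule partial_iso_algebraic_total[OF partial_iso_converse[OF s(1)]])
    show "t = s\<inverse>" if "partial_iso t" "s\<inverse> \<subseteq> t" for t
      using maximal_converse[OF maxs that] by blast
    fix z
    obtain p q where pq: "poly_rel r p q" "p \<noteq> 0" "poly p z = 0" using alg by blast
    then have "coeff p i \<in> Domain (r\<inverse>)" for i using r(3) by (auto simp: poly_rel_def)
    then obtain q' where "poly_rel (r\<inverse>) p q'"
      using poly_rel_from_Domain[OF partial_iso_converse[OF r(1)]] by metis
    moreover have "r\<inverse> \<subseteq> s\<inverse>" using s(2) by auto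
    ultimately show "\<exists>p q. poly_rel (s\<inverse>) p q \<and> p \<noteq> 0 \<and> poly p z = 0"
      using pq poly_rel_mono by blast
  qed
  then have ran: "z \<in> Range s" for z by auto
  define \<tau> where "\<tau> a = (THE b. (a, b) \<in> s)" for a
  have \<tau>: "\<tau> a = b" if "(a, b) \<in> s" for a b
    unfolding \<tau>_def using that partial_iso_functional[OF s(1)] by blast
  have \<tau>s: "(a, \<tau> a) \<in> s" for a using dom[of a] \<tau> by auto
  have "field_automorphism \<tau>"
    unfolding field_automorphism_def
  proof (intro conjI allI)
    show "bij \<tau>"
    proof (rule bijI)
      show "inj \<tau>" using \<tau>s partial_iso_functional[OF s(1)] by (metis injI)
      have "\<exists>a. z = \<tau> a" for z using ran[of z] \<tau> by auto
      then show "surj \<tau>" unfolding surj_def by blast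
    qed
    show "\<tau> (x + y) = \<tau> x + \<tau> y" "\<tau> (x * y) = \<tau> x * \<tau> y" for x y
      by (intro \<tau> partial_isoD(4,5)[OF s(1)] \<tau>s)+
  qed
  then show ?thesis using that[of \<tau>] \<tau> s(2) r(2) by blast
qed

section \<open>Conjugate elements over a subring: the algebraic case\<close>

definition subring_set :: "'a::ring_1 set \<Rightarrow> bool" where
  "subring_set F \<longleftrightarrow> 1 \<in> F \<and> (\<forall>a\<in>F. \<forall>b\<in>F. a - b \<in> F \<and> a * b \<in> F)"

lemma partial_iso_Id_on: "subring_set F \<Longrightarrow> partial_iso (Id_on F)"
  by (auto simp: subring_set_def partial_iso_def)

lemma subring_set_Domain: "partial_iso r \<Longrightarrow> subring_set (Domain r)"
  unfolding subring_set_def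
  by (metis Domain.simps partial_isoD(1,3,5))

lemma subring_set_poly:
  fixes p :: "'a::field poly"
  assumes "subring_set F" "\<And>i. coeff p i \<in> F" "x \<in> F"
  shows "poly p x \<in> F"
proof -
  have "partial_iso (Id_on F)" by (rule partial_iso_Id_on[OF assms(1)])
  note D = partial_isoD[OF this]
  have "(poly p x, poly p x) \<in> Id_on F"
    using assms(2)
  proof (induction p)
    case (pCons a p)
    have "a \<in> F" "coeff p i \<in> F" for i
      using pCons.prems[of 0] pCons.prems[of "Suc i"] by simp_all
    then show ?case using pCons.IH assms(3) unfolding poly_pCons
      using assms(3) by (intro D(4,5) pCons.IH Id_onI)
  qed (simp add: D(2))
  then show ?thesis by auto
qed

lemma poly_rel_Id_on: "poly_rel (Id_on F) p q \<longleftrightarrow> p = q \<and> (\<forall>i. coeff p i \<in> F)"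
  by (auto simp: poly_rel_def poly_eq_iff Id_on_iff)

lemma adjoin_Id_on: "adjoin (Id_on F) x y = {(poly p x, poly p y) | p. \<forall>i. coeff p i \<in> F}"
  by (auto simp: adjoin_def poly_rel_Id_on)

lemma coeff_pcompose_in:
  fixes p q :: "'a::field poly"
  assumes "subring_set F" "\<And>i. coeff p i \<in> F" "\<And>i. coeff q i \<in> F"
  shows "coeff (pcompose p q) i \<in> F"
proof -
  note I = poly_rel_intros[OF partial_iso_Id_on[OF assms(1)]]
  have q: "poly_rel (Id_on F) q q" using assms(3) by (simp add: poly_rel_Id_on)
  have "poly_rel (Id_on F) (pcompose p q) (pcompose p q)"
    using assms(2)
  proof (induction p)
    case (pCons a p)
    have "a \<in> F" "coeff p i \<in> F" for i
      using pCons.prems[of 0] pCons.prems[of "Suc i"] by simp_all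
    then have "(a, a) \<in> Id_on F" "poly_rel (Id_on F) (pcompose p q) (pcompose p q)" using pCons.IH by auto
    then show ?case unfolding pcompose_pCons by (intro I q)
  qed (simp add: I(4))
  then show ?thesis by (simp add: poly_rel_Id_on)
qed

text \<open>The constraint to \<open>N\<close> does not obstruct the extension: \<open>m\<close> is
  fixed coefficientwise by \<open>r\<close>, so a conjugate of one of its roots is again one of its
  roots and lies in \<open>N\<close>.\<close>

lemma maximal_partial_iso_contains_roots:
  fixes r :: "(complex \<times> complex) set"
  assumes r: "partial_iso r" "Domain r \<subseteq> N" "Range r \<subseteq> N"
    and max: "\<And>s. partial_iso s \<Longrightarrow> Domain s \<subseteq> N \<Longrightarrow> Range s \<subseteq> N \<Longrightarrow> r \<subseteq> s \<Longrightarrow> s = r"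
    and N: "subring_set N" "\<And>a. a \<in> N \<Longrightarrow> inverse a \<in> N"
    and m: "poly_rel r m m" "m \<noteq> 0" "\<And>x. poly m x = 0 \<Longrightarrow> x \<in> N" and x: "poly m x = 0"
  shows "x \<in> Domain r" "\<And>a b. (a, b) \<in> r \<Longrightarrow> (inverse a, inverse b) \<in> r"
proof -
  note Nm = N(1)[unfolded subring_set_def]
  show inv: "(inverse a, inverse b) \<in> r" if ab: "(a, b) \<in> r" for a b
  proof -
    define s where "s = {(a / c, b / d) | a b c d. (a, b) \<in> r \<and> (c, d) \<in> r \<and> c \<noteq> 0}"
    have "x / y \<in> N" if "x \<in> N" "y \<in> N" for x y
      using Nm N(2) that by (simp add: divide_inverse)
    then have "Domain s \<subseteq> N" "Range s \<subseteq> N" using r(2,3) unfolding s_def by blast+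
    then have "s = r" using partial_iso_fractions(1,2)[OF r(1)] unfolding s_def by (intro max) auto
    then show ?thesis using partial_iso_fractions(3)[OF r(1) ab] unfolding s_def by simp
  qed
  obtain y where y: "\<And>p q. poly_rel r p q \<Longrightarrow> poly p x = 0 \<longleftrightarrow> poly q y = 0"
    using algebraic_conjugate_exists[OF r(1) inv m(1,2) x] by auto
  have "y \<in> N" "x \<in> N" using y[OF m(1)] m(3) x by auto
  have "Domain (adjoin r x y) \<subseteq> N"
  proof
    fix a assume "a \<in> Domain (adjoin r x y)"
    then obtain p q where "a = poly p x" "poly_rel r p q" by (auto simp: adjoin_def)
    moreover from this have "coeff p i \<in> N" for i using r(2) by (auto simp: poly_rel_def)
    ultimately show "a \<in> N" using subring_set_poly[OF N(1)] \<open>x \<in> N\<close> by blast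
  qed
  moreover have "Range (adjoin r x y) \<subseteq> N"
  proof
    fix a assume "a \<in> Range (adjoin r x y)"
    then obtain p q where "a = poly q y" "poly_rel r p q" by (auto simp: adjoin_def)
    moreover from this have "coeff q i \<in> N" for i using r(3) by (auto simp: poly_rel_def)
    ultimately show "a \<in> N" using subring_set_poly[OF N(1)] \<open>y \<in> N\<close> by blast
  qed
  ultimately have "adjoin r x y = r"
    using adjoin_supset(1)[OF r(1)] by (intro max partial_iso_adjoin[OF r(1) y])
  then show "x \<in> Domain r" using adjoin_supset(2)[OF r(1), of x y] by (auto intro!: DomainI)
qed

text \<open>The partial isomorphism \<open>s \<mapsto> t\<close> is extended to an automorphism of the splitting field \<open>N\<close>.\<close>

lemma algebraic_conjugation_automorphism:
  fixes s t :: complex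
  assumes F: "subring_set F"
    and conj: "\<And>p. (\<And>i. coeff p i \<in> F) \<Longrightarrow> poly p s = 0 \<longleftrightarrow> poly p t = 0"
    and m: "\<And>i. coeff m i \<in> F" "m \<noteq> 0" "poly m s = 0"
  obtains \<tau> where "field_automorphism \<tau>" "\<And>a. a \<in> F \<Longrightarrow> \<tau> a = a" "\<tau> s = t"
proof -
  define closed where "closed K \<longleftrightarrow> subring_set K \<and> (\<forall>a\<in>K. inverse a \<in> K) \<and> F \<union> {x. poly m x = 0} \<subseteq> K" for K
  \<comment> \<open>Sending \<open>s\<close> to \<open>t\<close> over \<open>F\<close> alone gives
    the domain \<open>F[s]\<close> and the range \<open>F[t]\<close>, which may differ. Inside the
    field generated by \<open>F\<close> and all roots of \<open>m\<close> they can be made equal, as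
    \<open>partial_automorphism_extends\<close> demands.\<close>
  define N where "N = \<Inter>{K. closed K}"
  have N: "subring_set N" "\<And>a. a \<in> N \<Longrightarrow> inverse a \<in> N" "F \<subseteq> N" "\<And>x. poly m x = 0 \<Longrightarrow> x \<in> N"
    unfolding N_def closed_def subring_set_def by auto
  have min: "N \<subseteq> K" if "closed K" for K using that by (auto simp: N_def)
  define r0 where "r0 = adjoin (Id_on F) s t"
  note Id = partial_iso_Id_on[OF F]
  have r0: "partial_iso r0" unfolding r0_def
    using conj by (intro partial_iso_adjoin[OF Id]) (auto simp: poly_rel_Id_on)
  have "poly p s \<in> N" "poly p t \<in> N" if "\<And>i. coeff p i \<in> F" for p
    using that N(3,4) m(3) conj[OF m(1)] by (auto intro!: subring_set_poly[OF N(1)])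
  then have r0N: "Domain r0 \<subseteq> N \<and> Range r0 \<subseteq> N" by (auto simp: r0_def adjoin_Id_on)
  have U: "Domain (\<Union>C) \<subseteq> N \<and> Range (\<Union>C) \<subseteq> N" if "\<And>r. r \<in> C \<Longrightarrow> Domain r \<subseteq> N \<and> Range r \<subseteq> N" for C
    using that by (simp add: Domain_Union Range_Union UN_least)
  obtain r where r: "partial_iso r" "r0 \<subseteq> r" "Domain r \<subseteq> N \<and> Range r \<subseteq> N"
    and max: "\<And>s. partial_iso s \<Longrightarrow> Domain s \<subseteq> N \<and> Range s \<subseteq> N \<Longrightarrow> r \<subseteq> s \<Longrightarrow> s = r"
  proof (rule maximal_partial_iso[of r0 "\<lambda>r. Domain r \<subseteq> N \<and> Range r \<subseteq> N", OF r0 r0N])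
    show "Domain (\<Union>C) \<subseteq> N \<and> Range (\<Union>C) \<subseteq> N" if "\<And>r. r \<in> C \<Longrightarrow> Domain r \<subseteq> N \<and> Range r \<subseteq> N" for C
      by (rule U[OF that])
  qed (rule that)
  have Fr: "(a, a) \<in> r" if "a \<in> F" for a
    using adjoin_supset(1)[OF Id, of s t] r(2) that by (auto simp: r0_def)
  have mr: "poly_rel r m m" "poly_rel (r\<inverse>) m m" using Fr m(1) by (auto simp: poly_rel_def)
  have rN: "Domain r \<subseteq> N" "Range r \<subseteq> N" using r(3) by auto
  have max': "s = r" if "partial_iso s" "Domain s \<subseteq> N" "Range s \<subseteq> N" "r \<subseteq> s" for s
    using max that by simp
  have 1: "x \<in> Domain r" if x: "poly m x = 0" for x
    by (rule maximal_partial_iso_contains_roots(1)[OF r(1) rN _ N(1) _ mr(1) m(2) _ x])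
      (rule max' N(2,4); assumption)+
  have inv1: "(inverse a, inverse b) \<in> r" if ab: "(a, b) \<in> r" for a b
    by (rule maximal_partial_iso_contains_roots(2)[OF r(1) rN _ N(1) _ mr(1) m(2) _ m(3) ab])
      (rule max' N(2,4); assumption)+
  have max2: "s = r\<inverse>" if s: "partial_iso s" "Domain s \<subseteq> N" "Range s \<subseteq> N" "r\<inverse> \<subseteq> s" for s
  proof -
    have "s\<inverse> = r"
      by (rule max'[OF partial_iso_converse[OF s(1)]]) (use s in auto)
    then show ?thesis by auto
  qed
  have rN': "Domain (r\<inverse>) \<subseteq> N" "Range (r\<inverse>) \<subseteq> N" using rN by auto
  have 2: "x \<in> Domain (r\<inverse>)" if x: "poly m x = 0" for x
    by (rule maximal_partial_iso_contains_roots(1)[OF partial_iso_converse[OF r(1)] rN' _ N(1) _ mr(2) m(2) _ x])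
      (rule max2 N(2,4); assumption)+
  have inv: "inverse a \<in> Domain r" if "a \<in> Domain r" for a
    using inv1 that by auto
  have inv': "inverse a \<in> Domain (r\<inverse>)" if "a \<in> Domain (r\<inverse>)" for a
    using inv1 that by auto
  have "F \<union> {x. poly m x = 0} \<subseteq> Domain r" using 1 Fr by auto
  then have "closed (Domain r)"
    unfolding closed_def using subring_set_Domain[OF r(1)] inv by blast
  have "F \<union> {x. poly m x = 0} \<subseteq> Domain (r\<inverse>)" using 2 Fr by auto
  then have "closed (Domain (r\<inverse>))"
    unfolding closed_def using subring_set_Domain[OF partial_iso_converse[OF r(1)]] inv' by blast
  \<comment> \<open>Domain and range are both closed under inverses and contain \<open>F\<close> and
    the roots, so each contains \<open>N\<close>, the smallest such field; they also lie in
    \<open>N\<close>.\<close>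
  have "Domain r = Range r"
    using min[OF \<open>closed (Domain r)\<close>] min[OF \<open>closed (Domain (r\<inverse>))\<close>] rN by auto
  from partial_automorphism_extends[OF r(1) this] obtain \<tau> where
    \<tau>: "field_automorphism \<tau>" "\<And>a b. (a, b) \<in> r \<Longrightarrow> \<tau> a = b" by blast
  moreover have "(s, t) \<in> r" using adjoin_supset(2)[OF Id] r(2) by (auto simp: r0_def)
  ultimately show ?thesis using that[OF \<tau>(1)] Fr by blast
qed

text \<open>Since \<open>A[s] = A[s + c]\<close>, the substitution of \<open>s + c\<close> for the
  transcendental \<open>s\<close> has equal domain and range, and the extension theorem
  applies.\<close>

lemma translation_automorphism:
  fixes s c :: complex
  assumes A: "subring_set A" "c \<in> A"
    and tr: "\<And>p. (\<And>i. coeff p i \<in> A) \<Longrightarrow> poly p s = 0 \<Longrightarrow> p = 0"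
  obtains \<tau> where "field_automorphism \<tau>" "\<And>a. a \<in> A \<Longrightarrow> \<tau> a = a" "\<tau> s = s + c"
proof -
  note Id = partial_iso_Id_on[OF A(1)]
  define r where "r = adjoin (Id_on A) s (s + c)"
  have shift: "coeff (pcompose p [:d, 1:]) i \<in> A" if "\<And>i. coeff p i \<in> A" "d \<in> A" for p d i
  proof (rule coeff_pcompose_in[OF A(1) that(1)])
    show "coeff [:d, 1:] i \<in> A" for i
      using that(2) partial_isoD(1,2)[OF Id] by (auto simp: coeff_pCons split: nat.split)
  qed
  have "partial_iso r"
    unfolding r_def
  proof (rule partial_iso_adjoin[OF Id])
    fix p q assume "poly_rel (Id_on A) p q"
    then have p: "p = q" "\<And>i. coeff p i \<in> A" by (auto simp: poly_rel_Id_on)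
    have "q = 0" if "poly q (s + c) = 0"
    proof -
      have "pcompose q [:c, 1:] = 0"
        using shift p A(2) that by (intro tr) (auto simp: poly_pcompose add.commute)
      then show ?thesis by (simp add: pcompose_eq_0_iff)
    qed
    then show "poly p s = 0 \<longleftrightarrow> poly q (s + c) = 0" using tr[OF p(2)] p(1) by auto
  qed
  moreover have "Domain r = Range r"
  proof -
    have "- c \<in> A" using partial_isoD(6)[OF Id] A(2) by auto
    have "poly p s = poly (pcompose p [:- c, 1:]) (s + c)"
      "poly p (s + c) = poly (pcompose p [:c, 1:]) s" for p
      by (auto simp: poly_pcompose add.commute)
    then show ?thesis
      using shift[OF _ \<open>- c \<in> A\<close>] shift[OF _ A(2)] unfolding r_def adjoin_Id_on by (auto; blast)
  qed
  ultimately obtain \<tau> where "field_automorphism \<tau>" "\<And>a b. (a, b) \<in> r \<Longrightarrow> \<tau> a = b"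
    by (rule partial_automorphism_extends) blast
  then show ?thesis using that[of \<tau>] adjoin_supset[OF Id, of s "s + c"] by (auto simp: r_def)
qed

section \<open>Independence outside a countable set: the transcendental case\<close>

definition adjoin_element :: "'a::field set \<Rightarrow> 'a \<Rightarrow> 'a set" where
  "adjoin_element F c = {poly a c | a. \<forall>i. coeff a i \<in> F}"

lemma adjoin_element:
  assumes "subring_set F"
  shows "subring_set (adjoin_element F c)" "F \<subseteq> adjoin_element F c" "c \<in> adjoin_element F c"
proof -
  note Id = partial_iso_Id_on[OF assms]
  have *: "adjoin_element F c = Domain (adjoin (Id_on F) c c)"
    by (auto simp: adjoin_Id_on adjoin_element_def)
  show "subring_set (adjoin_element F c)" unfolding *
    by (intro subring_set_Domain partial_iso_adjoin Id) (simp add: poly_rel_Id_on)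
  show "F \<subseteq> adjoin_element F c" "c \<in> adjoin_element F c"
    unfolding * using adjoin_supset[OF Id, of c c] by auto
qed

lemma countable_polys:
  assumes "countable F"
  shows "countable {p. \<forall>i. coeff p i \<in> F}"
proof (rule countable_subset)
  show "{p. \<forall>i. coeff p i \<in> F} \<subseteq> Poly ` lists F"
  proof
    fix p assume "p \<in> {p. \<forall>i. coeff p i \<in> F}"
    then have "coeffs p \<in> lists F" by (auto simp: coeffs_def)
    then show "p \<in> Poly ` lists F" by (metis Poly_coeffs imageI)
  qed
  show "countable (Poly ` lists F)" using assms by (intro countable_image countable_lists)
qed

lemma countable_adjoin_element: "countable F \<Longrightarrow> countable (adjoin_element F c)"
proof -
  assume "countable F"
  moreover have "adjoin_element F c = (\<lambda>a. poly a c) ` {p. \<forall>i. coeff p i \<in> F}"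
    by (auto simp: adjoin_element_def)
  ultimately show ?thesis using countable_polys by auto
qed

lemma poly_altdef_le: "degree p \<le> k \<Longrightarrow> poly p (x :: 'a::comm_ring_1) = (\<Sum>i\<le>k. coeff p i * x ^ i)"
  unfolding poly_altdef by (intro sum.mono_neutral_left) (auto simp: coeff_eq_0)

text \<open>An algebraic relation of \<open>s\<close> over \<open>F[c]\<close> is a polynomial in two variables; read as a polynomial
  in \<open>c\<close> it has coefficients in \<open>F[s]\<close>.\<close>

lemma countable_dependent:
  fixes s :: "'a::{field, ring_char_0}"
  assumes F: "subring_set F" "countable F"
    and tr: "\<And>p. (\<And>i. coeff p i \<in> F) \<Longrightarrow> poly p s = 0 \<Longrightarrow> p = 0"
  shows "countable {c. \<exists>p. (\<forall>i. coeff p i \<in> adjoin_element F c) \<and> p \<noteq> 0 \<and> poly p s = 0}"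
proof (rule countable_subset)
  define \<G> where "\<G> = {G :: 'a poly poly. \<forall>i. coeff G i \<in> {a. \<forall>j. coeff a j \<in> F}}"
  define U where "U = (\<Union>G\<in>{G\<in>\<G>. poly G [:s:] \<noteq> 0}. {c. poly (poly G [:s:]) c = 0})"
  have "countable \<G>" unfolding \<G>_def by (intro countable_polys F(2))
  then show "countable U"
    unfolding U_def by (intro countable_UN countable_subset[OF _ \<open>countable \<G>\<close>])
      (auto intro: countable_finite poly_roots_finite)
  show "{c. \<exists>p. (\<forall>i. coeff p i \<in> adjoin_element F c) \<and> p \<noteq> 0 \<and> poly p s = 0} \<subseteq> U"
  proof clarify
    fix c p assume p: "\<forall>i. coeff p i \<in> adjoin_element F c" "p \<noteq> 0" "poly p s = 0"
    have "\<exists>a. coeff p i = poly a c \<and> (\<forall>j. coeff a j \<in> F)" for i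
      using p(1) by (auto simp: adjoin_element_def)
    then obtain a where a: "\<And>i. coeff p i = poly (a i) c" "\<And>i j. coeff (a i) j \<in> F" by metis
    define k where "k = degree p"
    \<comment> \<open>Beyond the degree of \<open>p\<close> the chosen \<open>a i\<close> are only
      known to vanish at \<open>c\<close>, so they are cut off.\<close>
    define G where "G = Abs_poly (\<lambda>i. if i > k then 0 else a i)"
    have G: "coeff G i = (if i > k then 0 else a i)" for i
      unfolding G_def by (subst coeff_Abs_poly[of k]) auto
    have "degree G \<le> k" using G by (intro degree_le) auto
    then have ev: "poly G [:s:] = (\<Sum>i\<le>k. coeff G i * [:s ^ i:])"
      by (simp add: poly_altdef_le poly_const_pow)
    have "0 \<in> F" using partial_isoD(2)[OF partial_iso_Id_on[OF F(1)]] by auto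
    then have "G \<in> \<G>" using a by (auto simp: \<G>_def G)
    moreover have "poly (poly G [:s:]) c = poly p s"
      by (simp add: ev poly_sum poly_altdef_le[of p k] k_def) (auto simp: G a(1) k_def intro!: sum.cong)
    \<comment> \<open>If this polynomial in the inner variable were zero, each of its coefficients
      would be an algebraic relation of \<open>s\<close> over \<open>F\<close>. The relation
      \<open>q\<close> for an index \<open>j\<close> with \<open>coeff (a k) j\<close> nonzero is
      nontrivial.\<close>
    moreover have "poly G [:s:] \<noteq> 0"
    proof
      assume 0: "poly G [:s:] = 0"
      have "coeff p k \<noteq> 0" using p(2) by (simp add: k_def)
      then have "a k \<noteq> 0" using a(1)[of k] by auto
      then obtain j where j: "coeff (a k) j \<noteq> 0" by (metis leading_coeff_0_iff)
      define q where "q = Abs_poly (\<lambda>i. if i > k then 0 else coeff (a i) j)"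
      have q: "coeff q i = (if i > k then 0 else coeff (a i) j)" for i
        unfolding q_def by (subst coeff_Abs_poly[of k]) auto
      have "degree q \<le> k" using q by (intro degree_le) auto
      then have "poly q s = (\<Sum>i\<le>k. coeff (a i) j * s ^ i)"
        by (simp add: poly_altdef_le) (auto simp: q intro!: sum.cong)
      also have "\<dots> = coeff (poly G [:s:]) j"
        by (simp add: ev coeff_sum) (auto simp: G intro!: sum.cong)
      finally have "poly q s = 0" using 0 by simp
      then have "q = 0" using a(2) \<open>0 \<in> F\<close> by (intro tr) (auto simp: q)
      then show False using j q[of k] by simp
    qed
    ultimately show "c \<in> U" using p(3) by (auto simp: U_def)
  qed
qed

lemma field_automorphism_comp:
  "field_automorphism \<sigma> \<Longrightarrow> field_automorphism \<tau> \<Longrightarrow> field_automorphism (\<sigma> \<circ> \<tau>)"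
  by (auto simp: field_automorphism_def bij_comp)

lemma field_automorphism_inv:
  assumes "field_automorphism \<tau>"
  shows "field_automorphism (inv_into UNIV \<tau>)"
proof -
  have b: "bij \<tau>" using assms by (simp add: field_automorphism_def)
  then have "\<tau> (inv_into UNIV \<tau> x) = x" for x by (simp add: bij_is_surj surj_f_inv_f)
  then show ?thesis
    using assms b unfolding field_automorphism_def
    by (auto simp: bij_imp_bij_inv intro!: inv_f_eq[OF bij_is_inj[OF b]])
qed

text \<open>If \<open>s\<close> and \<open>t\<close> are transcendental over \<open>F\<close>, then
  \<open>F[s]\<close> and \<open>F[t]\<close> may be different, and \<open>s\<close>,
  \<open>t\<close> may depend on each other. Two translations lead around this: \<open>s\<close>
  goes to \<open>s + c\<close>, and \<open>t\<close> goes to the same point, by an amount differing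
  from \<open>c\<close> by \<open>s - t\<close>. For all but countably many \<open>c\<close> both
  translations exist, and the first followed by the inverse of the second sends \<open>s\<close> to
  \<open>t\<close>.\<close>

lemma conjugation_automorphism:
  fixes s t :: complex
  assumes F: "subring_set F" "countable F"
    and conj: "\<And>p. (\<And>i. coeff p i \<in> F) \<Longrightarrow> poly p s = 0 \<longleftrightarrow> poly p t = 0"
  obtains \<tau> where "field_automorphism \<tau>" "\<And>a. a \<in> F \<Longrightarrow> \<tau> a = a" "\<tau> s = t"
proof (cases "\<exists>m. (\<forall>i. coeff m i \<in> F) \<and> m \<noteq> 0 \<and> poly m s = 0")
  case True
  then show ?thesis using algebraic_conjugation_automorphism[OF F(1) conj] that by metis
next
  case False
  then have s: "p = 0" if "\<And>i. coeff p i \<in> F" "poly p s = 0" for p using that by blast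
  then have t: "p = 0" if "\<And>i. coeff p i \<in> F" "poly p t = 0" for p using that conj by blast
  \<comment> \<open>The constants over which \<open>x\<close> becomes algebraic. The set for
    \<open>t\<close> is shifted below because \<open>t\<close> is translated by
    \<open>c + (s - t)\<close>.\<close>
  define bad where "bad x = {c. \<exists>p. (\<forall>i. coeff p i \<in> adjoin_element F c) \<and> p \<noteq> 0 \<and> poly p x = 0}" for x
  have "countable (bad s)" "countable (bad t)"
    unfolding bad_def by (intro countable_dependent F s t; blast)+
  then have "countable (bad s \<union> (\<lambda>c. c - (s - t)) ` bad t)" by simp
  moreover have "uncountable (UNIV :: complex set)"
  proof
    assume "countable (UNIV :: complex set)"
    then have "countable (range complex_of_real)" by (rule countable_subset[rotated]) simp
    then have "countable (UNIV :: real set)"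
      by (rule countable_image_inj_on) (simp add: inj_of_real)
    then show False using uncountable_UNIV_real by simp
  qed
  ultimately obtain c where c: "c \<notin> bad s" "c \<notin> (\<lambda>c. c - (s - t)) ` bad t"
    by (metis UNIV_eq_I UnCI)
  have c': "c + (s - t) \<notin> bad t"
  proof
    assume "c + (s - t) \<in> bad t"
    then have "c \<in> (\<lambda>c. c - (s - t)) ` bad t" by (intro image_eqI[of _ _ "c + (s - t)"]) auto
    then show False using c by simp
  qed
  have tr: "p = 0" if "\<And>i. coeff p i \<in> adjoin_element F c" "poly p s = 0" for p
    using c(1) that by (auto simp: bad_def)
  have tr': "p = 0" if "\<And>i. coeff p i \<in> adjoin_element F (c + (s - t))" "poly p t = 0" for p
    using c' that by (auto simp: bad_def)
  obtain \<tau>1 where 1: "field_automorphism \<tau>1" "\<And>a. a \<in> adjoin_element F c \<Longrightarrow> \<tau>1 a = a" "\<tau>1 s = s + c"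
    using translation_automorphism[OF adjoin_element(1,3)[OF F(1)] tr] by blast
  obtain \<tau>2 where 2: "field_automorphism \<tau>2" "\<And>a. a \<in> adjoin_element F (c + (s - t)) \<Longrightarrow> \<tau>2 a = a"
    "\<tau>2 t = t + (c + (s - t))"
    using translation_automorphism[OF adjoin_element(1,3)[OF F(1)] tr'] by blast
  have inj: "inj \<tau>2" using 2(1) by (auto simp: field_automorphism_def bij_is_inj)
  show ?thesis
  proof (rule that[of "inv_into UNIV \<tau>2 \<circ> \<tau>1"])
    show "field_automorphism (inv_into UNIV \<tau>2 \<circ> \<tau>1)"
      using 1 2 by (intro field_automorphism_comp field_automorphism_inv)
    show "(inv_into UNIV \<tau>2 \<circ> \<tau>1) a = a" if "a \<in> F" for a
    proof -
      have "a \<in> adjoin_element F c" "a \<in> adjoin_element F (c + (s - t))"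
        using that adjoin_element(2)[OF F(1)] by blast+
      then show ?thesis using 1(2) 2(2) by (auto intro!: inv_f_eq[OF inj])
    qed
    show "(inv_into UNIV \<tau>2 \<circ> \<tau>1) s = t"
      using 1(3) 2(3) by (auto intro!: inv_f_eq[OF inj] simp: algebra_simps)
  qed
qed

lemma field_hom_endomorphism:
  assumes "nonzero_field_endomorphism \<sigma>"
  shows "field_hom \<sigma>"
proof -
  from assms have add: "\<And>x y. \<sigma> (x + y) = \<sigma> x + \<sigma> y" and mult: "\<And>x y. \<sigma> (x * y) = \<sigma> x * \<sigma> y"
    and "\<exists>x. \<sigma> x \<noteq> 0" by (auto simp: nonzero_field_endomorphism_def)
  then obtain x where "\<sigma> x \<noteq> 0" by blast
  have "\<sigma> 0 + \<sigma> 0 = \<sigma> 0 + 0" using add[of 0 0] by (simp only: add_0_right)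
  then have "\<sigma> 0 = 0" by (simp only: add_left_cancel)
  moreover have "\<sigma> 1 = 1" using mult[of x 1] \<open>\<sigma> x \<noteq> 0\<close> by simp
  ultimately show ?thesis by unfold_locales (auto simp: add mult)
qed

lemma field_automorphism_endomorphism:
  assumes "field_automorphism \<tau>"
  shows "nonzero_field_endomorphism \<tau>"
proof -
  have "surj \<tau>" using assms by (simp add: field_automorphism_def bij_is_surj)
  then obtain x where "\<tau> x = 1" by (metis surjD)
  then have "\<exists>x. \<tau> x \<noteq> 0" by (metis zero_neq_one)
  then show ?thesis using assms by (simp add: nonzero_field_endomorphism_def field_automorphism_def)
qed

lemma field_hom_poly_fixed:
  assumes "field_hom \<rho>" "\<And>i. \<rho> (coeff p i) = coeff p i"
  shows "\<rho> (poly p x) = poly p (\<rho> x)"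
proof -
  interpret field_hom \<rho> by (rule assms)
  show ?thesis by (simp add: poly_altdef hom_distribs assms(2))
qed

text \<open>Induction over \<open>S\<close> with a countable subring on which \<tau> and \<sigma>
  agree. To absorb a new \<open>s\<close>, observe that the inverse of \<tau> composed with \<sigma>
  is an endomorphism fixing \<open>F\<close>, so it sends \<open>s\<close> to a conjugate over
  \<open>F\<close>. An automorphism \<alpha> over \<open>F\<close> with the same value at
  \<open>s\<close> exists, and \<tau> after \<alpha> agrees with \<sigma> on all of
  \<open>F[s]\<close>.\<close>

theorem endomorphism_agrees_with_automorphism:
  fixes \<sigma> :: "complex \<Rightarrow> complex"
  assumes \<sigma>: "nonzero_field_endomorphism \<sigma>" and "finite S"
  obtains \<tau> where "field_automorphism \<tau>" "\<And>a. a \<in> S \<Longrightarrow> \<tau> a = \<sigma> a"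
proof -
  have "\<exists>F \<tau>. subring_set F \<and> countable F \<and> S \<subseteq> F \<and> field_automorphism \<tau> \<and> (\<forall>a\<in>F. \<tau> a = \<sigma> a)"
    using assms(2)
  proof induction
    case empty
    interpret field_hom \<sigma> by (rule field_hom_endomorphism[OF \<sigma>])
    have "subring_set (\<int> :: complex set)" by (auto simp: subring_set_def)
    moreover have "countable (\<int> :: complex set)" by (simp add: Ints_def)
    moreover have "field_automorphism (id :: complex \<Rightarrow> complex)" by (simp add: field_automorphism_def)
    moreover have "\<forall>a\<in>\<int>. id a = \<sigma> a" by (auto simp: Ints_def hom_of_int)
    ultimately show ?case by blast
  next
    case (insert s S)
    then obtain F \<tau> where F: "subring_set F" "countable F" "S \<subseteq> F" "field_automorphism \<tau>" "\<forall>a\<in>F. \<tau> a = \<sigma> a"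
      by blast
    define \<rho> where "\<rho> = inv_into UNIV \<tau> \<circ> \<sigma>"
    have bij: "bij \<tau>" using F(4) by (simp add: field_automorphism_def)
    interpret \<sigma>: field_hom \<sigma> by (rule field_hom_endomorphism[OF \<sigma>])
    interpret i\<tau>: field_hom "inv_into UNIV \<tau>"
      by (intro field_hom_endomorphism field_automorphism_endomorphism field_automorphism_inv F)
    interpret \<rho>: field_hom \<rho> unfolding \<rho>_def
      by unfold_locales (simp_all add: hom_distribs)
    have fixed: "\<rho> a = a" if "a \<in> F" for a
      using F(5) that by (auto simp: \<rho>_def intro!: inv_f_eq[OF bij_is_inj[OF bij]])
    have "poly p s = 0 \<longleftrightarrow> poly p (\<rho> s) = 0" if "\<And>i. coeff p i \<in> F" for p
    proof -
      have "poly p (\<rho> s) = \<rho> (poly p s)"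
        using that fixed by (intro field_hom_poly_fixed[symmetric] \<rho>.field_hom_axioms) auto
      then show ?thesis by simp
    qed
    then obtain \<alpha> where \<alpha>: "field_automorphism \<alpha>" "\<And>a. a \<in> F \<Longrightarrow> \<alpha> a = a" "\<alpha> s = \<rho> s"
      using conjugation_automorphism[OF F(1,2)] by metis
    interpret \<alpha>: field_hom \<alpha>
      by (intro field_hom_endomorphism field_automorphism_endomorphism \<alpha>)
    interpret \<tau>: field_hom \<tau>
      by (intro field_hom_endomorphism field_automorphism_endomorphism F)
    have "\<tau> (\<alpha> a) = \<sigma> a" if a: "a \<in> adjoin_element F s" for a
    proof -
      obtain p where p: "a = poly p s" "\<And>i. coeff p i \<in> F"
        using a unfolding adjoin_element_def by blast
      have "\<alpha> a = poly p (\<rho> s)"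
        using p \<alpha>(2,3) field_hom_poly_fixed[OF \<alpha>.field_hom_axioms, of p s] by simp
      also have "\<dots> = \<rho> a"
        using p fixed field_hom_poly_fixed[OF \<rho>.field_hom_axioms, of p s] by simp
      finally show ?thesis using bij by (simp add: \<rho>_def bij_is_surj surj_f_inv_f)
    qed
    moreover have "insert s S \<subseteq> adjoin_element F s" using adjoin_element(2,3)[OF F(1)] F(3) by auto
    ultimately show ?case
      using adjoin_element(1)[OF F(1)] countable_adjoin_element[OF F(2)]
        field_automorphism_comp[OF F(4) \<alpha>(1), unfolded comp_def]
      by (intro exI[of _ "adjoin_element F s"] exI[of _ "\<tau> \<circ> \<alpha>"]) (simp add: comp_def)
  qed
  then show ?thesis using that by blast
qed

section \<open>Rank one idempotents and orthogonality\<close>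

locale dim3 =
  fixes n :: nat
  assumes n3: "3 \<le> n"
begin

section \<open>Vectors, functionals and operators of rank one\<close>

definition dot :: "(nat \<Rightarrow> complex) \<Rightarrow> (nat \<Rightarrow> complex) \<Rightarrow> complex" where
  "dot f x = (\<Sum>i<n. f i * x i)"

text \<open>The operator that sends \<open>z\<close> to \<open>dot f z\<close> times
  \<open>x\<close>. Vectors and functionals are functions on all naturals of which only the values
  below \<open>n\<close> count, hence the congruence rules in place of equalities.\<close>

definition outer :: "(nat \<Rightarrow> complex) \<Rightarrow> (nat \<Rightarrow> complex) \<Rightarrow> complex mat" where
  "outer x f = mat n n (\<lambda>(i, j). x i * f j)"

definition unit :: "nat \<Rightarrow> nat \<Rightarrow> complex" where
  "unit i = (\<lambda>k. of_bool (k = i))"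

definition apply_mat :: "complex mat \<Rightarrow> (nat \<Rightarrow> complex) \<Rightarrow> nat \<Rightarrow> complex" where
  "apply_mat A x = (\<lambda>i. \<Sum>j<n. A $$ (i, j) * x j)"

definition rank_one :: "complex mat set" where
  "rank_one = {outer x f | x f. dot f x = 1}"

definition orth :: "complex mat \<Rightarrow> complex mat \<Rightarrow> bool" where
  "orth P Q \<longleftrightarrow> P * Q = 0\<^sub>m n n \<and> Q * P = 0\<^sub>m n n"

lemma dot_simps:
  "dot (\<lambda>i. f i + g i) x = dot f x + dot g x"
  "dot (\<lambda>i. f i - g i) x = dot f x - dot g x"
  "dot (\<lambda>i. c * f i) x = c * dot f x"
  "dot (\<lambda>i. f i * c) x = dot f x * c"
  "dot (\<lambda>i. f i / c) x = dot f x / c"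
  "dot f (\<lambda>i. x i + y i) = dot f x + dot f y"
  "dot f (\<lambda>i. x i - y i) = dot f x - dot f y"
  "dot f (\<lambda>i. c * x i) = c * dot f x"
  "dot f (\<lambda>i. x i * c) = dot f x * c"
  "dot f (\<lambda>i. x i / c) = dot f x / c"
  unfolding dot_def
  by (simp_all add: algebra_simps sum.distrib sum_subtractf sum_distrib_left sum_divide_distrib)

lemma dot_commute: "dot f x = dot x f"
  by (simp add: dot_def mult.commute)

lemma dot_cong: "(\<And>i. i < n \<Longrightarrow> f i = f' i) \<Longrightarrow> (\<And>i. i < n \<Longrightarrow> x i = x' i) \<Longrightarrow> dot f x = dot f' x'"
  by (simp add: dot_def)

lemma dot_unit:
  assumes "i < n"
  shows "dot f (unit i) = f i" "dot (unit i) x = x i"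
proof -
  show "dot f (unit i) = f i" for f
    using assms by (simp add: dot_def unit_def of_bool_def if_distrib[of "\<lambda>c. _ * c"] cong: if_cong)
  then show "dot (unit i) x = x i" by (simp add: dot_commute[of "unit i"])
qed

lemma outer_carrier [simp]: "outer x f \<in> carrier_mat n n" "dim_row (outer x f) = n" "dim_col (outer x f) = n"
  by (simp_all add: outer_def)

lemma index_outer [simp]: "i < n \<Longrightarrow> j < n \<Longrightarrow> outer x f $$ (i, j) = x i * f j"
  by (simp add: outer_def)

lemma outer_cong: "(\<And>i. i < n \<Longrightarrow> x i = x' i) \<Longrightarrow> (\<And>i. i < n \<Longrightarrow> f i = f' i) \<Longrightarrow> outer x f = outer x' f'"
  by (intro eq_matI) auto

lemma transpose_outer: "transpose_mat (outer x f) = outer f x"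
  by (intro eq_matI) auto

lemma outer_eq_0: "outer x f = 0\<^sub>m n n \<longleftrightarrow> (\<forall>i<n. x i = 0) \<or> (\<forall>i<n. f i = 0)"
  by (auto simp: mat_eq_iff)

lemma mult_mat_index:
  assumes "A \<in> carrier_mat n n" "B \<in> carrier_mat n n" "i < n" "j < n"
  shows "(A * B) $$ (i, j) = (\<Sum>k<n. A $$ (i, k) * B $$ (k, j))"
  using assms by (auto simp: scalar_prod_def atLeast0LessThan)

lemma outer_mult: "outer x f * outer y g = dot f y \<cdot>\<^sub>m outer x g"
  by (intro eq_matI) (auto simp: mult_mat_index dot_def sum_distrib_left sum_distrib_right intro!: sum.cong
      simp del: index_mult_mat(1))

lemma mult_outer:
  assumes "A \<in> carrier_mat n n"
  shows "A * outer x f = outer (apply_mat A x) f"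
  using assms by (intro eq_matI) (auto simp: mult_mat_index apply_mat_def sum_distrib_right mult.assoc
      simp del: index_mult_mat(1))

lemma outer_mult_mat:
  assumes "A \<in> carrier_mat n n"
  shows "outer x f * A = outer x (apply_mat (transpose_mat A) f)"
  using assms by (intro eq_matI) (auto simp: mult_mat_index apply_mat_def sum_distrib_left ac_simps
      simp del: index_mult_mat(1) intro!: sum.cong)

lemma apply_mat_simps:
  "apply_mat A (\<lambda>i. x i + y i) = (\<lambda>i. apply_mat A x i + apply_mat A y i)"
  "apply_mat A (\<lambda>i. x i - y i) = (\<lambda>i. apply_mat A x i - apply_mat A y i)"
  "apply_mat A (\<lambda>i. c * x i) = (\<lambda>i. c * apply_mat A x i)"
  by (simp_all add: fun_eq_iff apply_mat_def algebra_simps sum.distrib sum_subtractf sum_distrib_left)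

lemma apply_mat_mult:
  assumes "A \<in> carrier_mat n n" "B \<in> carrier_mat n n" "i < n"
  shows "apply_mat (A * B) x i = apply_mat A (apply_mat B x) i"
  using assms unfolding apply_mat_def
  by (simp add: mult_mat_index sum_distrib_right sum_distrib_left mult.assoc del: index_mult_mat(1))
    (rule sum.swap)

lemma apply_mat_one: "i < n \<Longrightarrow> apply_mat (1\<^sub>m n) x i = x i"
  by (simp add: apply_mat_def if_distrib[of "\<lambda>c. c * _"] cong: if_cong)

lemma dot_apply_transpose:
  assumes "A \<in> carrier_mat n n"
  shows "dot (apply_mat (transpose_mat A) f) x = dot f (apply_mat A x)"
  using assms unfolding dot_def apply_mat_def
  by (simp add: sum_distrib_left sum_distrib_right) (subst sum.swap, auto intro!: sum.cong)

lemma rank_oneI: "dot f x = 1 \<Longrightarrow> outer x f \<in> rank_one"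
  by (auto simp: rank_one_def)

lemma rank_oneE:
  assumes "P \<in> rank_one" obtains x f where "P = outer x f" "dot f x = 1"
  using assms by (auto simp: rank_one_def)

lemma rank_one_carrier: "P \<in> rank_one \<Longrightarrow> P \<in> carrier_mat n n"
  by (auto simp: rank_one_def)

lemma rank_one_idem: "P \<in> rank_one \<Longrightarrow> P * P = P"
  by (auto simp: rank_one_def outer_mult)

lemma dot_nonzero: "dot f x \<noteq> 0 \<Longrightarrow> (\<exists>i<n. f i \<noteq> 0) \<and> (\<exists>i<n. x i \<noteq> 0)"
  by (auto simp: dot_def intro: ccontr)

lemma outer_eq_iff:
  assumes "dot f x = 1" "dot g y = 1"
  shows "outer x f = outer y g \<longleftrightarrow> (\<exists>c. c \<noteq> 0 \<and> (\<forall>i<n. y i = c * x i) \<and> (\<forall>i<n. f i = c * g i))"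
proof
  assume eq: "outer x f = outer y g"
  have entry: "x i * f j = y i * g j" if "i < n" "j < n" for i j
    using that arg_cong[OF eq, of "\<lambda>M. M $$ (i, j)"] by simp
  have *: "x i * dot f z = y i * dot g z" if "i < n" for i z
  proof -
    have "(\<Sum>j<n. (x i * f j) * z j) = (\<Sum>j<n. (y i * g j) * z j)"
      using entry that by (intro sum.cong) auto
    then show ?thesis by (simp add: dot_def sum_distrib_left mult.assoc)
  qed
  have **: "dot w x * f i = dot w y * g i" if "i < n" for i w
  proof -
    have "(\<Sum>j<n. w j * (x j * f i)) = (\<Sum>j<n. w j * (y j * g i))"
      using entry that by (intro sum.cong) auto
    then show ?thesis by (simp add: dot_def sum_distrib_right mult.assoc)
  qed
  \<comment> \<open>Evaluating the equation of matrices at \<open>y\<close> on one side and at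
    \<open>f\<close> on the other produces the same scalar in both relations.\<close>
  define c where "c = dot f y"
  have 1: "y i = c * x i" "f i = c * g i" if "i < n" for i
    using *[OF that, of y] **[OF that, of f] assms by (simp_all add: c_def mult.commute)
  then have "dot g y = c * dot g x" using dot_cong[of g g y "\<lambda>i. c * x i"] by (simp add: dot_simps)
  then have "c \<noteq> 0" using assms by auto
  then show "\<exists>c. c \<noteq> 0 \<and> (\<forall>i<n. y i = c * x i) \<and> (\<forall>i<n. f i = c * g i)" using 1 by blast
qed (auto intro!: eq_matI)

lemma orth_outer:
  assumes "dot f x = 1" "dot g y = 1"
  shows "orth (outer x f) (outer y g) \<longleftrightarrow> dot f y = 0 \<and> dot g x = 0"
proof -
  have "outer x g \<noteq> 0\<^sub>m n n" "outer y f \<noteq> 0\<^sub>m n n"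
    using dot_nonzero[of f x] dot_nonzero[of g y] assms by (auto simp: outer_eq_0)
  moreover have "c \<cdot>\<^sub>m outer u v = 0\<^sub>m n n \<longleftrightarrow> c = 0 \<or> outer u v = 0\<^sub>m n n" for c u v
    by (auto simp: mat_eq_iff)
  ultimately show ?thesis by (simp add: orth_def outer_mult)
qed

lemma mult_outer_eq_0:
  assumes "dot f x = 1" "dot g y = 1"
  shows "outer x f * outer y g = 0\<^sub>m n n \<longleftrightarrow> dot f y = 0"
proof -
  have "outer x g \<noteq> 0\<^sub>m n n"
    using dot_nonzero[of f x] dot_nonzero[of g y] assms by (auto simp: outer_eq_0)
  moreover have "c \<cdot>\<^sub>m outer u v = 0\<^sub>m n n \<longleftrightarrow> c = 0 \<or> outer u v = 0\<^sub>m n n" for c u v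
    by (auto simp: mat_eq_iff)
  ultimately show ?thesis by (simp add: outer_mult)
qed

lemma orth_ne:
  assumes "P \<in> rank_one" "orth P Q" shows "P \<noteq> Q"
proof
  assume "P = Q"
  then have "P = 0\<^sub>m n n" using assms rank_one_idem[OF assms(1)] by (simp add: orth_def)
  moreover obtain x f where "P = outer x f" "dot f x = 1" using rank_oneE[OF assms(1)] .
  ultimately show False using dot_nonzero[of f x] by (auto simp: outer_eq_0)
qed

text \<open>A product \<open>P * Q = Q\<close> says that the range of \<open>Q\<close> lies in that
  of \<open>P\<close>; as both are lines, they are equal. Thus shared ranges, and dually shared
  kernels, become equations between products.\<close>

lemma same_range_iff:
  assumes "dot f x = 1" "dot g y = 1"
  shows "outer x f * outer y g = outer y g \<longleftrightarrow> (\<exists>c. \<forall>i<n. y i = c * x i)"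
proof
  assume eq: "outer x f * outer y g = outer y g"
  obtain j where j: "j < n" "g j \<noteq> 0" using dot_nonzero[of g y] assms by auto
  have "dot f y * (x i * g j) = y i * g j" if "i < n" for i
    using that j(1) arg_cong[OF eq, of "\<lambda>M. M $$ (i, j)"] by (simp add: outer_mult)
  then have "y i = dot f y * x i" if "i < n" for i
    using that j(2) by (metis mult.assoc mult_cancel_right)
  then show "\<exists>c. \<forall>i<n. y i = c * x i" by blast
next
  assume "\<exists>c. \<forall>i<n. y i = c * x i"
  then obtain c where c: "\<And>i. i < n \<Longrightarrow> y i = c * x i" by blast
  then have "dot f y = c" using dot_cong[of f f y "\<lambda>i. c * x i"] assms by (simp add: dot_simps)
  then show "outer x f * outer y g = outer y g" using c by (auto simp: outer_mult intro!: eq_matI)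
qed

lemma same_kernel_iff:
  assumes "dot f x = 1" "dot g y = 1"
  shows "outer x f * outer y g = outer x f \<longleftrightarrow> (\<exists>c. \<forall>i<n. f i = c * g i)"
proof -
  have "outer x f * outer y g = outer x f \<longleftrightarrow> transpose_mat (outer x f * outer y g) = transpose_mat (outer x f)"
    by (simp add: transpose_mat_eq)
  also have "transpose_mat (outer x f * outer y g) = outer g y * outer f x"
    using transpose_mult[of "outer x f" n n "outer y g" n] by (simp add: transpose_outer)
  finally show ?thesis using same_range_iff[of y g x f] assms
    by (simp add: transpose_outer dot_commute)
qed

section \<open>Biorthogonal systems and changes of basis\<close>

definition biorth :: "nat \<Rightarrow> (nat \<Rightarrow> nat \<Rightarrow> complex) \<Rightarrow> (nat \<Rightarrow> nat \<Rightarrow> complex) \<Rightarrow> bool" where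
  "biorth m x f \<longleftrightarrow> (\<forall>i<m. \<forall>j<m. dot (f i) (x j) = of_bool (i = j))"

text \<open>The complementary idempotent \<open>M\<close> has trace \<open>n - m\<close>; a column and a row of \<open>M\<close> through a nonzero
  diagonal entry continue the system.\<close>

lemma biorth_extend_one:
  assumes "biorth m x f" "m < n"
  obtains y g where "dot g y = 1" "\<And>i. i < m \<Longrightarrow> dot g (x i) = 0" "\<And>i. i < m \<Longrightarrow> dot (f i) y = 0"
proof -
  define M where "M k l = of_bool (k = l) - (\<Sum>i<m. x i k * f i l)" for k l
  have b: "dot (f i) (x j) = of_bool (i = j)" if "i < m" "j < m" for i j
    using assms(1) that by (simp add: biorth_def)
  have col: "dot g (\<lambda>k. M k l) = g l - (\<Sum>i<m. dot g (x i) * f i l)" if "l < n" for g l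
  proof -
    have "dot g (\<lambda>k. M k l) = dot g (unit l) - dot g (\<lambda>k. \<Sum>i<m. x i k * f i l)"
      unfolding dot_simps(7)[symmetric] by (rule dot_cong) (simp_all add: M_def unit_def)
    also have "dot g (\<lambda>k. \<Sum>i<m. x i k * f i l) = (\<Sum>i<m. dot g (x i) * f i l)"
      unfolding dot_def by (simp add: sum_distrib_left sum_distrib_right mult.assoc) (rule sum.swap)
    finally show ?thesis using that by (simp add: dot_unit)
  qed
  have row: "dot (M k) y = y k - (\<Sum>i<m. x i k * dot (f i) y)" if "k < n" for y k
  proof -
    have "dot (M k) y = dot (unit k) y - dot (\<lambda>l. \<Sum>i<m. x i k * f i l) y"
      unfolding dot_simps(2)[symmetric] by (rule dot_cong) (auto simp: M_def unit_def of_bool_def)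
    also have "dot (\<lambda>l. \<Sum>i<m. x i k * f i l) y = (\<Sum>i<m. x i k * dot (f i) y)"
      unfolding dot_def by (simp add: sum_distrib_left sum_distrib_right mult.assoc) (rule sum.swap)
    finally show ?thesis using that by (simp add: dot_unit)
  qed
  have fM: "dot (f i) (\<lambda>k. M k l) = 0" if "i < m" "l < n" for i l
    using that by (simp add: col b of_bool_def if_distrib[of "\<lambda>c. c * _"] cong: if_cong)
  have Mx: "dot (M k) (x i) = 0" if "i < m" "k < n" for i k
    using that by (simp add: row b of_bool_def if_distrib[of "\<lambda>c. _ * c"] cong: if_cong)
  have MM: "dot (M k) (\<lambda>r. M r l) = M k l" if "k < n" "l < n" for k l
    using that by (simp add: col Mx)
  have "(\<Sum>k<n. M k k) = of_nat n - (\<Sum>i<m. dot (f i) (x i))"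
    unfolding M_def dot_def by (simp add: sum_subtractf mult.commute) (rule sum.swap)
  also have "(\<Sum>i<m. dot (f i) (x i)) = of_nat m" by (simp add: b)
  finally have "(\<Sum>k<n. M k k) \<noteq> 0" using assms(2) by simp
  then obtain k where k: "k < n" "M k k \<noteq> 0" by (auto elim: sum.not_neutral_contains_not_neutral)
  show ?thesis
  proof (rule that[of "\<lambda>l. M k l / M k k" "\<lambda>r. M r k"])
  qed (use k in \<open>simp_all add: dot_simps fM Mx MM\<close>)
qed

lemma biorth_extend:
  assumes "biorth m x f" "m \<le> n"
  obtains x' f' where "biorth n x' f'" "\<And>i. i < m \<Longrightarrow> x' i = x i" "\<And>i. i < m \<Longrightarrow> f' i = f i"
proof -
  have "\<exists>x' f'. biorth n x' f' \<and> (\<forall>i<m. x' i = x i \<and> f' i = f i)"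
    using assms
  proof (induction "n - m" arbitrary: m x f)
    case 0
    then have "m = n" by simp
    then show ?case using 0 by blast
  next
    case (Suc d)
    then have "m < n" by simp
    then obtain y g where
      yg: "dot g y = 1" "\<And>i. i < m \<Longrightarrow> dot g (x i) = 0" "\<And>i. i < m \<Longrightarrow> dot (f i) y = 0"
      using biorth_extend_one[OF Suc.prems(1)] by metis
    have "biorth (Suc m) (x(m := y)) (f(m := g))"
      using Suc.prems(1) yg by (auto simp: biorth_def less_Suc_eq)
    moreover have "d = n - Suc m" "Suc m \<le> n" using Suc.hyps(2) by auto
    ultimately obtain x' f' where *: "biorth n x' f'"
      "\<forall>i<Suc m. x' i = (x(m := y)) i \<and> f' i = (f(m := g)) i" using Suc.hyps(1) by blast
    then have "\<forall>i<m. x' i = x i \<and> f' i = f i" by (auto simp: less_Suc_eq)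
    then show ?case using *(1) by blast
  qed
  then show ?thesis using that by blast
qed

lemmas mat_assoc = assoc_mult_mat[of _ n n _ n _ n] mult_carrier_mat[of _ n n _ n]

definition inverse_pair :: "complex mat \<Rightarrow> complex mat \<Rightarrow> bool" where
  "inverse_pair S S' \<longleftrightarrow> S \<in> carrier_mat n n \<and> S' \<in> carrier_mat n n \<and> S * S' = 1\<^sub>m n \<and> S' * S = 1\<^sub>m n"

lemma inverse_pair_sym: "inverse_pair S S' \<Longrightarrow> inverse_pair S' S"
  by (auto simp: inverse_pair_def)

lemma biorth_matrices:
  assumes "biorth n x f"
  obtains S S' where "inverse_pair S S'" "\<And>i j. i < n \<Longrightarrow> j < n \<Longrightarrow> S $$ (i, j) = x j i"
    "\<And>i j. i < n \<Longrightarrow> j < n \<Longrightarrow> S' $$ (i, j) = f i j"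
    "\<And>i. i < n \<Longrightarrow> S * outer (unit i) (unit i) * S' = outer (x i) (f i)"
proof -
  define S where "S = mat n n (\<lambda>(i, j). x j i)"
  define S' where "S' = mat n n (\<lambda>(i, j). f i j)"
  have c: "S \<in> carrier_mat n n" "S' \<in> carrier_mat n n" by (simp_all add: S_def S'_def)
  have "S' * S = 1\<^sub>m n"
    using assms c by (intro eq_matI) (auto simp: mult_mat_index S_def S'_def biorth_def dot_def
        simp del: index_mult_mat(1))
  then have "inverse_pair S S'" using mat_mult_left_right_inverse[OF c(2,1)] c by (simp add: inverse_pair_def)
  moreover have "S * outer (unit i) (unit i) * S' = outer (x i) (f i)" if "i < n" for i
  proof -
    have "apply_mat S (unit i) k = x i k" "apply_mat (transpose_mat S') (unit i) k = f i k" if "k < n" for k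
      using \<open>i < n\<close> that by (auto simp: apply_mat_def S_def S'_def unit_def of_bool_def
          if_distrib[of "\<lambda>c. _ * c"] cong: if_cong)
    then show ?thesis using c by (auto simp: mult_outer outer_mult_mat intro!: outer_cong)
  qed
  ultimately show ?thesis using that[of S S'] by (simp add: S_def S'_def)
qed

lemma inverse_pair_cancel:
  assumes "inverse_pair S S'" "X \<in> carrier_mat n n"
  shows "S * (S' * X) = X" "S' * (S * X) = X"
proof -
  note c = assms(1)[unfolded inverse_pair_def]
  have "S * (S' * X) = (S * S') * X" "S' * (S * X) = (S' * S) * X"
    using c assms(2) assoc_mult_mat[of _ n n _ n X n] by metis+
  then show "S * (S' * X) = X" "S' * (S * X) = X" using c assms(2) by simp_all
qed

lemma conj_mult:
  assumes "inverse_pair S S'" "A \<in> carrier_mat n n" "B \<in> carrier_mat n n"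
  shows "(S * A * S') * (S * B * S') = S * (A * B) * S'"
  using assms(1)[unfolded inverse_pair_def] assms(2,3)
  by (simp add: mat_assoc inverse_pair_cancel[OF assms(1)])

lemma conj_conj:
  assumes "inverse_pair S S'" "A \<in> carrier_mat n n"
  shows "S' * (S * A * S') * S = A"
  using assms(1)[unfolded inverse_pair_def] assms(2)
  by (simp add: mat_assoc inverse_pair_cancel[OF assms(1)])

lemma conj_carrier: "inverse_pair S S' \<Longrightarrow> A \<in> carrier_mat n n \<Longrightarrow> S * A * S' \<in> carrier_mat n n"
  by (auto simp: inverse_pair_def)

lemma conj_outer:
  assumes "inverse_pair S S'"
  shows "S * outer x f * S' = outer (apply_mat S x) (apply_mat (transpose_mat S') f)"
  using assms by (simp add: inverse_pair_def mult_outer outer_mult_mat)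

lemma dot_conj:
  assumes "inverse_pair S S'"
  shows "dot (apply_mat (transpose_mat S') f) (apply_mat S x) = dot f x"
proof -
  have "dot (apply_mat (transpose_mat S') f) (apply_mat S x) = dot f (apply_mat (S' * S) x)"
    using assms by (auto simp: dot_apply_transpose inverse_pair_def apply_mat_mult simp flip: apply_mat_mult intro!: dot_cong)
  then show ?thesis using assms by (auto simp: inverse_pair_def apply_mat_one intro!: dot_cong)
qed

lemma conj_rank_one: "inverse_pair S S' \<Longrightarrow> P \<in> rank_one \<Longrightarrow> S * P * S' \<in> rank_one"
  by (auto elim!: rank_oneE simp: conj_outer dot_conj intro!: rank_oneI)

lemma conj_inject:
  assumes "inverse_pair S S'" "A \<in> carrier_mat n n" "B \<in> carrier_mat n n"
  shows "S * A * S' = S * B * S' \<longleftrightarrow> A = B"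
  using conj_conj[OF assms(1)] assms(2,3) by metis

lemma conj_zero: "inverse_pair S S' \<Longrightarrow> S * 0\<^sub>m n n * S' = 0\<^sub>m n n"
  by (auto simp: inverse_pair_def)

lemma conj_orth:
  assumes "inverse_pair S S'" "P \<in> carrier_mat n n" "Q \<in> carrier_mat n n"
  shows "orth (S * P * S') (S * Q * S') \<longleftrightarrow> orth P Q"
  using conj_inject[OF assms(1), of _ "0\<^sub>m n n"] assms
  by (simp add: orth_def conj_mult conj_zero)

text \<open>Orthogonality of rank one idempotents determines when they share a range or a kernel.\<close>

definition perp2 :: "complex mat \<Rightarrow> complex mat \<Rightarrow> complex mat set" where
  "perp2 P Q = {C \<in> rank_one. orth C P \<and> orth C Q}"

text \<open>Call the set of idempotents orthogonal to all of \<open>perp2 P Q\<close> the hull of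
  \<open>P\<close> and \<open>Q\<close>. The condition says that any two distinct members of the
  hull already determine it, as two points determine a line. It is phrased through
  \<open>orth\<close> alone so that orthogonality preserving bijections respect it.\<close>

definition adj :: "complex mat \<Rightarrow> complex mat \<Rightarrow> bool" where
  "adj P Q \<longleftrightarrow> (\<forall>A\<in>rank_one. \<forall>B\<in>rank_one. (\<forall>C\<in>perp2 P Q. orth A C \<and> orth B C) \<longrightarrow> A \<noteq> B \<longrightarrow>
    perp2 A B \<subseteq> perp2 P Q)"

section \<open>Bijections preserving orthogonality, and when two idempotents share a range or a
  kernel\<close>

definition orth_auto :: "(complex mat \<Rightarrow> complex mat) \<Rightarrow> bool" where
  "orth_auto g \<longleftrightarrow> bij_betw g rank_one rank_one \<and> (\<forall>P\<in>rank_one. \<forall>Q\<in>rank_one. orth (g P) (g Q) \<longleftrightarrow> orth P Q)"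

lemma orth_auto_comp:
  assumes "orth_auto g" "orth_auto h" shows "orth_auto (g \<circ> h)"
  using assms bij_betw_trans[of h rank_one rank_one g rank_one] bij_betwE[of h rank_one rank_one]
  by (auto simp: orth_auto_def)

lemma orth_auto_conj: "inverse_pair S S' \<Longrightarrow> orth_auto (\<lambda>P. S * P * S')"
  unfolding orth_auto_def
proof
  assume S: "inverse_pair S S'"
  show "bij_betw (\<lambda>P. S * P * S') rank_one rank_one"
    by (rule bij_betwI[where g = "\<lambda>P. S' * P * S"])
      (auto simp: conj_rank_one conj_conj inverse_pair_sym S rank_one_carrier)
qed (simp add: conj_orth rank_one_carrier)

lemma orth_auto_transpose: "orth_auto transpose_mat"
  unfolding orth_auto_def
proof
  have "transpose_mat P \<in> rank_one" if "P \<in> rank_one" for P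
    using that by (auto elim!: rank_oneE simp: transpose_outer dot_commute intro!: rank_oneI)
  then show "bij_betw transpose_mat rank_one rank_one"
    by (intro bij_betwI[where g = transpose_mat]) auto
  show "\<forall>P\<in>rank_one. \<forall>Q\<in>rank_one. orth (transpose_mat P) (transpose_mat Q) \<longleftrightarrow> orth P Q"
    by (auto elim!: rank_oneE simp: transpose_outer orth_outer dot_commute)
qed

lemma orth_auto_perp2:
  assumes "orth_auto g" "P \<in> rank_one" "Q \<in> rank_one"
  shows "perp2 (g P) (g Q) = g ` perp2 P Q"
proof -
  have im: "g ` rank_one = rank_one" using assms(1) unfolding orth_auto_def by (blast dest: bij_betw_imp_surj_on)
  have iff: "orth (g A) (g B) \<longleftrightarrow> orth A B" if "A \<in> rank_one" "B \<in> rank_one" for A B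
    using assms(1) that by (simp add: orth_auto_def)
  have "perp2 (g P) (g Q) = {C \<in> g ` rank_one. orth C (g P) \<and> orth C (g Q)}"
    unfolding perp2_def using im by simp
  also have "\<dots> = g ` {C \<in> rank_one. orth (g C) (g P) \<and> orth (g C) (g Q)}" by blast
  also have "{C \<in> rank_one. orth (g C) (g P) \<and> orth (g C) (g Q)} = perp2 P Q"
    unfolding perp2_def using iff assms(2,3) by blast
  finally show ?thesis .
qed

lemma orth_auto_adj:
  assumes g: "orth_auto g" and "P \<in> rank_one" "Q \<in> rank_one"
  shows "adj (g P) (g Q) \<longleftrightarrow> adj P Q"
proof -
  have b: "bij_betw g rank_one rank_one" using g by (simp add: orth_auto_def)
  have im: "rank_one = g ` rank_one" using b by (simp add: bij_betw_imp_surj_on)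
  have sub: "perp2 A B \<subseteq> rank_one" for A B by (auto simp: perp2_def)
  have inj: "inj_on g rank_one" using b by (simp add: bij_betw_def)
  have im_sub: "g ` X \<subseteq> g ` Y \<longleftrightarrow> X \<subseteq> Y" if "X \<subseteq> rank_one" "Y \<subseteq> rank_one" for X Y
    using inj_on_image_mem_iff[OF inj _ that(2)] that(1) by blast
  have "adj (g P) (g Q) \<longleftrightarrow> (\<forall>A\<in>rank_one. \<forall>B\<in>rank_one.
      (\<forall>C\<in>perp2 P Q. orth (g A) (g C) \<and> orth (g B) (g C)) \<longrightarrow> g A \<noteq> g B \<longrightarrow> perp2 (g A) (g B) \<subseteq> perp2 (g P) (g Q))"
    unfolding adj_def by (subst (1 2) im) (simp add: orth_auto_perp2 assms)
  also have "\<dots> \<longleftrightarrow> adj P Q"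
    unfolding adj_def
  proof (intro ball_cong refl)
    fix A B assume AB: "A \<in> rank_one" "B \<in> rank_one"
    have "orth (g A) (g C) \<longleftrightarrow> orth A C" "orth (g B) (g C) \<longleftrightarrow> orth B C" if "C \<in> perp2 P Q" for C
      using g AB sub[of P Q] that by (auto simp: orth_auto_def)
    moreover have "g A \<noteq> g B \<longleftrightarrow> A \<noteq> B" using inj_on_eq_iff[OF inj AB] by simp
    moreover have "perp2 (g A) (g B) \<subseteq> perp2 (g P) (g Q) \<longleftrightarrow> perp2 A B \<subseteq> perp2 P Q"
      by (simp add: orth_auto_perp2 assms AB im_sub sub)
    ultimately show "((\<forall>C\<in>perp2 P Q. orth (g A) (g C) \<and> orth (g B) (g C)) \<longrightarrow> g A \<noteq> g B \<longrightarrow>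
        perp2 (g A) (g B) \<subseteq> perp2 (g P) (g Q)) \<longleftrightarrow>
      ((\<forall>C\<in>perp2 P Q. orth A C \<and> orth B C) \<longrightarrow> A \<noteq> B \<longrightarrow> perp2 A B \<subseteq> perp2 P Q)"
      by (metis (no_types, lifting))
  qed
  finally show ?thesis .
qed

definition parallel :: "(nat \<Rightarrow> complex) \<Rightarrow> (nat \<Rightarrow> complex) \<Rightarrow> bool" where
  "parallel z x \<longleftrightarrow> (\<exists>c. \<forall>i<n. z i = c * x i)"

lemma functional_separating:
  assumes "\<exists>i<n. x i \<noteq> 0" "\<not> parallel z x"
  obtains h where "dot h x = 0" "dot h z \<noteq> 0"
proof -
  obtain i where i: "i < n" "x i \<noteq> 0" using assms(1) by blast
  obtain j where j: "j < n" "z j \<noteq> z i / x i * x j"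
    using assms(2) unfolding parallel_def by blast
  \<comment> \<open>On a vector \<open>v\<close> this functional is the minor of \<open>x\<close>
    and \<open>v\<close> in the coordinates \<open>i\<close>, \<open>j\<close>; it vanishes at
    \<open>x\<close>, and \<open>j\<close> is chosen so that it does not vanish at
    \<open>z\<close>.\<close>
  define h where "h k = x i * unit j k - x j * unit i k" for k
  have h: "dot h v = x i * v j - x j * v i" for v
    unfolding h_def dot_simps using i j by (simp add: dot_unit)
  have "dot h x = 0" "dot h z \<noteq> 0" using h[of x] h[of z] i(2) j(2) by (auto simp: field_simps)
  then show ?thesis using that by blast
qed

text \<open>A space is not the union of two proper subspaces: one of \<open>h0\<close>,
  \<open>h1\<close> and their sum is nonzero at both vectors.\<close>

lemma functional_separating2:
  assumes x: "\<exists>i<n. x i \<noteq> 0" and z: "\<not> parallel z x" and w: "\<not> parallel w x"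
  obtains h where "dot h x = 0" "dot h z = 1" "dot h w \<noteq> 0"
proof -
  obtain h0 where h0: "dot h0 x = 0" "dot h0 z \<noteq> 0" using functional_separating[OF x z] .
  obtain h1 where h1: "dot h1 x = 0" "dot h1 w \<noteq> 0" using functional_separating[OF x w] .
  have "\<exists>h. dot h x = 0 \<and> dot h z \<noteq> 0 \<and> dot h w \<noteq> 0"
  proof (cases "dot h0 w = 0")
    case True
    then show ?thesis
      using h0 h1 dot_simps(1)[of h0 h1]
      by (cases "dot h1 z = 0") (intro exI[of _ "\<lambda>i. h0 i + h1 i"], simp, blast)
  qed (use h0 in blast)
  then obtain h where h: "dot h x = 0" "dot h z \<noteq> 0" "dot h w \<noteq> 0" by blast
  show ?thesis by (rule that[of "\<lambda>i. h i / dot h z"]) (use h in \<open>simp_all add: dot_simps\<close>)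
qed

text \<open>Here dimension three is used: the kernel of \<open>f\<close> contains two independent
  vectors, and some nonzero combination of them is killed by \<open>g\<close>.\<close>

lemma common_kernel:
  assumes "dot f x = 1"
  obtains z where "\<exists>i<n. z i \<noteq> 0" "dot f z = 0" "dot g z = 0"
proof -
  have "biorth 1 (\<lambda>_. x) (\<lambda>_. f)" using assms by (simp add: biorth_def)
  then obtain x' f' where b: "biorth n x' f'" "\<And>i. i < 1 \<Longrightarrow> x' i = x" "\<And>i. i < 1 \<Longrightarrow> f' i = f"
    using biorth_extend[of 1 "\<lambda>_. x" "\<lambda>_. f"] n3 by auto
  have d: "dot (f' i) (x' j) = of_bool (i = j)" if "i < 3" "j < 3" for i j
    using b(1) that n3 by (simp add: biorth_def)
  have f: "f' 0 = f" using b by simp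
  define a where "a = dot g (x' 1)"
  define b where "b = dot g (x' 2)"
  show ?thesis
  proof (cases "a = 0 \<and> b = 0")
    case True
    show ?thesis
      by (rule that[of "x' 1"]) (use d[of 1 1] d[of 0 1] f True dot_nonzero[of "f' 1" "x' 1"] in \<open>auto simp: a_def\<close>)
  next
    case False
    define z where "z = (\<lambda>i. b * x' 1 i - a * x' 2 i)"
    have "dot h z = b * dot h (x' 1) - a * dot h (x' 2)" for h
      unfolding z_def dot_simps ..
    then have "dot f z = 0" "dot g z = 0" "dot (f' 1) z = b" "dot (f' 2) z = - a"
      using d[of 0 1] d[of 0 2] d[of 1 1] d[of 1 2] d[of 2 1] d[of 2 2] f by (auto simp: a_def b_def)
    moreover from this have "\<exists>i<n. z i \<noteq> 0"
      using False dot_nonzero[of "f' 1" z] dot_nonzero[of "f' 2" z] by auto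
    ultimately show ?thesis using that by blast
  qed
qed

lemma perp2_outer:
  assumes "dot f x = 1" "dot g y = 1" "dot h z = 1"
  shows "outer z h \<in> perp2 (outer x f) (outer y g) \<longleftrightarrow> dot h x = 0 \<and> dot h y = 0 \<and> dot f z = 0 \<and> dot g z = 0"
  using assms by (auto simp: perp2_def orth_outer rank_oneI)

lemma not_parallel_kernel: "dot f x = 1 \<Longrightarrow> dot f z = 0 \<Longrightarrow> \<exists>i<n. z i \<noteq> 0 \<Longrightarrow> \<not> parallel z x"
proof
  assume *: "dot f x = 1" "dot f z = 0" "\<exists>i<n. z i \<noteq> 0" "parallel z x"
  then obtain c where c: "\<And>i. i < n \<Longrightarrow> z i = c * x i" by (auto simp: parallel_def)
  then have "dot f z = c" using dot_cong[of f f z "\<lambda>i. c * x i"] * by (simp add: dot_simps)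
  then show False using * c by auto
qed

text \<open>The hull of two idempotents with a common range \<open>x\<close> lies on an affine line
  of functionals. A member has range \<open>x\<close>, since otherwise some \<open>outer z h\<close>
  in \<open>perp2\<close> would have \<open>h\<close> nonzero on its range. Its functional kills the
  common kernel of \<open>f\<close> and \<open>g\<close>, so it is a combination of them, with
  coefficient sum one because all take the value one at \<open>x\<close>.\<close>

lemma perp_perp_same_range:
  assumes fg: "dot f x = 1" "dot g x = 1" and ne: "i < n" "f i \<noteq> g i" and kw: "dot k w = 1"
    and perp: "\<And>C. C \<in> perp2 (outer x f) (outer x g) \<Longrightarrow> orth (outer w k) C"
  shows "\<exists>b. outer w k = outer x (\<lambda>i. f i + b * (g i - f i))"
proof -
  have x0: "\<exists>i<n. x i \<noteq> 0" using dot_nonzero[of f x] fg by auto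
  have test: "dot k z = 0 \<and> dot h w = 0" if "dot h z = 1" "dot h x = 0" "dot f z = 0" "dot g z = 0" for z h
    using perp[of "outer z h"] that fg kw by (simp add: perp2_outer orth_outer)
  have "parallel w x"
  proof (rule ccontr)
    assume w: "\<not> parallel w x"
    obtain z where z: "\<exists>i<n. z i \<noteq> 0" "dot f z = 0" "dot g z = 0" using common_kernel[OF fg(1)] .
    obtain h where "dot h x = 0" "dot h z = 1" "dot h w \<noteq> 0"
      using functional_separating2[OF x0 not_parallel_kernel[OF fg(1) z(2,1)] w] .
    then show False using test z by blast
  qed
  then obtain c where c: "\<And>i. i < n \<Longrightarrow> w i = c * x i" by (auto simp: parallel_def)
  define k' where "k' = (\<lambda>i. c * k i)"
  have wk: "outer w k = outer x k'" using c by (auto simp: k'_def intro!: eq_matI)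
  have "dot k w = dot k' x"
    using dot_cong[of k k w "\<lambda>i. c * x i"] c unfolding k'_def dot_simps by simp
  then have k'x: "dot k' x = 1" using kw by simp
  have test': "dot k' z = 0" if z: "dot f z = 0" "dot g z = 0" for z
  proof (cases "\<exists>i<n. z i \<noteq> 0")
    case True
    obtain h where "dot h x = 0" "dot h z \<noteq> 0"
      using functional_separating[OF x0 not_parallel_kernel[OF fg(1) z(1) True]] .
    then have "dot k z = 0" using z test[of "\<lambda>i. h i / dot h z" z] by (simp add: dot_simps)
    then show ?thesis by (simp add: k'_def dot_simps)
  qed (simp add: dot_def)
  \<comment> \<open>The vectors \<open>x\<close> and \<open>y\<close> will be dual to the
    functionals \<open>f\<close> and \<open>d\<close>. Subtracting the components along them moves
    any basis vector into the common kernel of \<open>f\<close> and \<open>g\<close>, where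
    \<open>k'\<close> vanishes.\<close>
  define d where "d = (\<lambda>i. g i - f i)"
  define v where "v = (\<lambda>k. unit i k - f i * x k)"
  have dv: "dot h v = h i - f i * dot h x" for h
    unfolding v_def dot_simps using ne by (simp add: dot_unit)
  have dd: "dot d u = dot g u - dot f u" for u unfolding d_def dot_simps ..
  have "d i \<noteq> 0" using ne by (simp add: d_def)
  then have "dot d v \<noteq> 0" "dot f v = 0" using fg by (simp_all add: dv dd)
  define y where "y = (\<lambda>k. v k / dot d v)"
  have y: "dot h y = dot h v / dot d v" for h unfolding y_def dot_simps ..
  have y1: "dot f y = 0" "dot d y = 1" using \<open>dot d v \<noteq> 0\<close> \<open>dot f v = 0\<close> by (simp_all add: y)
  have "k' l = f l + dot k' y * (g l - f l)" if "l < n" for l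
  proof -
    define u where "u = (\<lambda>j. unit l j - (f l * x j + d l * y j))"
    have u: "dot h u = h l - (f l * dot h x + d l * dot h y)" for h
      unfolding u_def dot_simps using that by (simp add: dot_unit)
    have "dot f u = 0" using y1 fg by (simp add: u)
    moreover have "dot d u = 0" using y1 fg by (simp add: u dd)
    ultimately have "dot k' u = 0" by (intro test') (simp_all add: dd)
    then show ?thesis using k'x by (simp add: u d_def algebra_simps)
  qed
  then have "outer w k = outer x (\<lambda>i. f i + dot k' y * (g i - f i))"
    unfolding wk by (intro outer_cong) auto
  then show ?thesis by blast
qed

text \<open>Two distinct points of the affine line through \<open>f\<close> and \<open>g\<close>
  have the same common kernel as \<open>f\<close> and \<open>g\<close>, so their
  \<open>perp2\<close> imposes the same conditions.\<close>

lemma adj_same_range: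
  assumes fg: "dot f x = 1" "dot g x = 1" and ne: "outer x f \<noteq> outer x g"
  shows "adj (outer x f) (outer x g)"
  unfolding adj_def
proof (intro ballI impI)
  fix A B
  assume A: "A \<in> rank_one" and B: "B \<in> rank_one" and "A \<noteq> B"
    and perp: "\<forall>C\<in>perp2 (outer x f) (outer x g). orth A C \<and> orth B C"
  obtain i where i: "i < n" "f i \<noteq> g i" using ne by (metis outer_cong)
  define l where "l b = (\<lambda>i. f i + b * (g i - f i))" for b
  have l: "dot (l b) z = dot f z + b * (dot g z - dot f z)" for b z
    unfolding l_def dot_simps ..
  have "\<exists>b. A = outer x (l b)" if A: "A \<in> rank_one" and perp: "\<forall>C\<in>perp2 (outer x f) (outer x g). orth A C" for A
  proof -
    obtain w k where wk: "A = outer w k" "dot k w = 1" using A by (rule rank_oneE)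
    show ?thesis
      using perp_perp_same_range[OF fg i wk(2)] perp unfolding wk(1) l_def by blast
  qed
  then obtain a b where ab: "A = outer x (l a)" "B = outer x (l b)" using A B perp by metis
  then have "a \<noteq> b" using \<open>A \<noteq> B\<close> by auto
  show "perp2 A B \<subseteq> perp2 (outer x f) (outer x g)"
  proof
    fix C assume C: "C \<in> perp2 A B"
    then obtain z h where zh: "C = outer z h" "dot h z = 1" by (auto simp: perp2_def elim: rank_oneE)
    have "dot h x = 0" "dot (l a) z = 0" "dot (l b) z = 0"
      using C fg zh by (auto simp: ab perp2_outer l)
    then have *: "dot f z + a * (dot g z - dot f z) = 0" "dot f z + b * (dot g z - dot f z) = 0"
      by (simp_all add: l)
    have "(a - b) * (dot g z - dot f z) =
        (dot f z + a * (dot g z - dot f z)) - (dot f z + b * (dot g z - dot f z))" by (simp add: algebra_simps)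
    then have "(a - b) * (dot g z - dot f z) = 0" unfolding * by simp
    then have "dot g z = dot f z" using \<open>a \<noteq> b\<close> by simp
    then have "dot f z = 0" "dot g z = 0" using * by auto
    then show "C \<in> perp2 (outer x f) (outer x g)" using zh fg \<open>dot h x = 0\<close> by (simp add: perp2_outer)
  qed
qed

text \<open>The hull contains \<open>outer x f\<close> and a second idempotent with the same range
  \<open>x\<close>. The \<open>perp2\<close> of this pair restricts functionals only at
  \<open>x\<close>, so it contains an \<open>outer z h\<close> with \<open>dot h y\<close> nonzero,
  which is not in \<open>perp2\<close> of the original pair.\<close>

lemma not_adj:
  assumes fx: "dot f x = 1" and gy: "dot g y = 1" and par: "\<not> parallel y x" "\<not> parallel f g"
  shows "\<not> adj (outer x f) (outer y g)"
proof
  assume adj: "adj (outer x f) (outer y g)"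
  have x0: "\<exists>i<n. x i \<noteq> 0" using dot_nonzero[of f x] fx by auto
  \<comment> \<open>A combination of \<open>f\<close> and \<open>g\<close> with value one at
    \<open>x\<close>. Being a combination, it vanishes wherever both do, which puts
    \<open>outer x k\<close> into the hull.\<close>
  define k where "k = (\<lambda>i. f i + (g i - dot g x * f i))"
  have k: "dot k z = dot f z + (dot g z - dot g x * dot f z)" for z unfolding k_def dot_simps ..
  have kx: "dot k x = 1" using fx by (simp add: k)
  have "outer x f \<noteq> outer x k"
  proof
    assume "outer x f = outer x k"
    then obtain c where c: "c \<noteq> 0" "\<And>i. i < n \<Longrightarrow> f i = c * k i" "\<And>i. i < n \<Longrightarrow> x i = c * x i"
      using outer_eq_iff[OF fx kx] by auto
    have "c = 1" using x0 c(3) by auto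
    then have "g i = dot g x * f i" if "i < n" for i using c(2)[OF that] by (simp add: k_def)
    moreover from this have "dot g x \<noteq> 0" using dot_cong[of g "\<lambda>i. dot g x * f i" y y] gy
      by (auto simp: dot_simps)
    ultimately have "f i = 1 / dot g x * g i" if "i < n" for i using that by (simp add: field_simps)
    then show False using par(2) unfolding parallel_def by blast
  qed
  moreover have "orth (outer x f) C \<and> orth (outer x k) C" if C: "C \<in> perp2 (outer x f) (outer y g)" for C
  proof -
    obtain z h where zh: "C = outer z h" "dot h z = 1" using C by (auto simp: perp2_def elim: rank_oneE)
    then show ?thesis using C fx gy kx by (simp add: perp2_outer orth_outer k)
  qed
  ultimately have sub: "perp2 (outer x f) (outer x k) \<subseteq> perp2 (outer x f) (outer y g)"
    using adj fx kx unfolding adj_def by (metis rank_oneI)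
  obtain z where z: "\<exists>i<n. z i \<noteq> 0" "dot f z = 0" "dot g z = 0" using common_kernel[OF fx] .
  obtain h where h: "dot h x = 0" "dot h z = 1" "dot h y \<noteq> 0"
    using functional_separating2[OF x0 not_parallel_kernel[OF fx z(2,1)] par(1)] .
  have "outer z h \<in> perp2 (outer x f) (outer x k)" using fx kx h z by (simp add: perp2_outer k)
  then have "outer z h \<in> perp2 (outer x f) (outer y g)" using sub by blast
  then show False using h fx gy by (simp add: perp2_outer)
qed

lemma adj_iff:
  assumes P: "P \<in> rank_one" and Q: "Q \<in> rank_one" and "P \<noteq> Q"
  shows "adj P Q \<longleftrightarrow> P * Q = Q \<or> P * Q = P"
proof -
  obtain x f where P': "P = outer x f" "dot f x = 1" using P by (rule rank_oneE)
  obtain y g where Q': "Q = outer y g" "dot g y = 1" using Q by (rule rank_oneE)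
  have range: "P * Q = Q \<longleftrightarrow> parallel y x" and kernel: "P * Q = P \<longleftrightarrow> parallel f g"
    using same_range_iff[OF P'(2) Q'(2)] same_kernel_iff[OF P'(2) Q'(2)] by (simp_all add: P' Q' parallel_def)
  have same: "adj (outer x f) (outer y g)" if *: "parallel y x" "dot f x = 1" "dot g y = 1" "outer x f \<noteq> outer y g" for x f y g
  proof -
    obtain c where c: "\<And>i. i < n \<Longrightarrow> y i = c * x i" using *(1) unfolding parallel_def by blast
    have eq: "outer y g = outer x (\<lambda>i. c * g i)" using c by (auto intro!: eq_matI)
    have "dot (\<lambda>i. c * g i) x = 1"
      using dot_cong[of g g y "\<lambda>i. c * x i"] c *(3) unfolding dot_simps by simp
    then show ?thesis using adj_same_range[OF *(2)] *(4) unfolding eq by blast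
  qed
  have "adj P Q" if par: "parallel f g"
  proof -
    obtain c where c: "\<And>i. i < n \<Longrightarrow> f i = c * g i" using par unfolding parallel_def by blast
    have "c \<noteq> 0" using dot_cong[of f "\<lambda>i. c * g i" x x] c P'(2) by (auto simp: dot_simps)
    then have "parallel g f" using c by (auto simp: parallel_def field_simps intro!: exI[of _ "1 / c"])
    moreover have "outer f x \<noteq> outer g y"
      using \<open>P \<noteq> Q\<close> transpose_outer unfolding P' Q' by metis
    ultimately have "adj (outer f x) (outer g y)"
      using same[of g f x y] P'(2) Q'(2) by (simp add: dot_commute)
    then show ?thesis using orth_auto_adj[OF orth_auto_transpose P Q] by (simp add: P' Q' transpose_outer)
  qed
  moreover have "adj P Q" if "parallel y x"
    using same[OF that P'(2) Q'(2)] \<open>P \<noteq> Q\<close> by (simp add: P' Q')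
  moreover have "\<not> adj P Q" if "\<not> parallel y x" "\<not> parallel f g"
    using not_adj[OF P'(2) Q'(2) that] by (simp add: P' Q')
  ultimately show ?thesis using range kernel by blast
qed

text \<open>If one product vanishes, \<open>P\<close> can be moved, keeping its range or its kernel,
  to an idempotent orthogonal to \<open>Q\<close>. Orthogonality does not tell ranges from kernels,
  as transposition shows, so only the disjunction of the two products can be characterized.\<close>

lemma mult_eq_0_iff_adj_orth:
  assumes P: "P \<in> rank_one" and Q: "Q \<in> rank_one"
  shows "P * Q = 0\<^sub>m n n \<or> Q * P = 0\<^sub>m n n \<longleftrightarrow> (\<exists>P'\<in>rank_one. (P' = P \<or> adj P P') \<and> orth P' Q)"
proof -
  obtain x f where P': "P = outer x f" "dot f x = 1" using P by (rule rank_oneE)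
  obtain y g where Q': "Q = outer y g" "dot g y = 1" using Q by (rule rank_oneE)
  have zero: "P * Q = 0\<^sub>m n n \<longleftrightarrow> dot f y = 0" "Q * P = 0\<^sub>m n n \<longleftrightarrow> dot g x = 0"
    using P' Q' by (simp_all add: mult_outer_eq_0)
  show ?thesis
  proof
    assume "P * Q = 0\<^sub>m n n \<or> Q * P = 0\<^sub>m n n"
    then show "\<exists>P'\<in>rank_one. (P' = P \<or> adj P P') \<and> orth P' Q"
    proof
      assume "P * Q = 0\<^sub>m n n"
      then have fy: "dot f y = 0" by (simp add: zero)
      \<comment> \<open>Subtracting the component along \<open>y\<close> makes \<open>g\<close>
        vanish; the value of \<open>f\<close> is unaffected because
        \<open>dot f y = 0\<close>.\<close>
      define x' where "x' = (\<lambda>i. x i - dot g x * y i)"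
      have x': "dot h x' = dot h x - dot g x * dot h y" for h unfolding x'_def dot_simps ..
      have 1: "dot f x' = 1" "dot g x' = 0" using fy P' Q' by (simp_all add: x')
      have "P * outer x' f = P"
        unfolding P' using same_kernel_iff[OF P'(2) 1(1)] by (auto intro!: exI[of _ 1])
      then have "outer x' f = P \<or> adj P (outer x' f)"
        using adj_iff[OF P rank_oneI[OF 1(1)]] by auto
      moreover have "orth (outer x' f) Q" using 1 Q' fy by (simp add: orth_outer)
      ultimately show ?thesis using rank_oneI[OF 1(1)] by blast
    next
      assume "Q * P = 0\<^sub>m n n"
      then have gx: "dot g x = 0" by (simp add: zero)
      define f' where "f' = (\<lambda>i. f i - dot f y * g i)"
      have f': "dot f' z = dot f z - dot f y * dot g z" for z unfolding f'_def dot_simps ..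
      have 1: "dot f' x = 1" "dot f' y = 0" using gx P' Q' by (simp_all add: f')
      have "P * outer x f' = outer x f'"
        unfolding P' using same_range_iff[OF P'(2) 1(1)] by (auto intro!: exI[of _ 1])
      then have "outer x f' = P \<or> adj P (outer x f')"
        using adj_iff[OF P rank_oneI[OF 1(1)]] by auto
      moreover have "orth (outer x f') Q" using 1 Q' gx by (simp add: orth_outer)
      ultimately show ?thesis using rank_oneI[OF 1(1)] by blast
    qed
  next
    assume "\<exists>P'\<in>rank_one. (P' = P \<or> adj P P') \<and> orth P' Q"
    then obtain R where R: "R \<in> rank_one" "R = P \<or> adj P R" "orth R Q" by blast
    obtain w k where R': "R = outer w k" "dot k w = 1" using R(1) by (rule rank_oneE)
    have orth: "dot k y = 0" "dot g w = 0" using R(3) R' Q' by (simp_all add: orth_outer)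
    have "P * R = R \<or> P * R = P" using R adj_iff[OF P R(1)] rank_one_idem[OF P] by blast
    then have "parallel w x \<or> parallel f k"
      using same_range_iff[OF P'(2) R'(2)] same_kernel_iff[OF P'(2) R'(2)]
      by (auto simp: P' R' parallel_def)
    then show "P * Q = 0\<^sub>m n n \<or> Q * P = 0\<^sub>m n n"
    proof
      assume "parallel w x"
      then obtain c where c: "\<And>i. i < n \<Longrightarrow> w i = c * x i" by (auto simp: parallel_def)
      have "c * dot k x = 1" "c * dot g x = 0"
        using dot_cong[of k k w "\<lambda>i. c * x i"] dot_cong[of g g w "\<lambda>i. c * x i"] c R'(2) orth
        unfolding dot_simps by simp_all
      then show ?thesis by (auto simp: zero)
    next
      assume "parallel f k"
      then obtain c where c: "\<And>i. i < n \<Longrightarrow> f i = c * k i" by (auto simp: parallel_def)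
      have "dot f y = 0"
        using dot_cong[of f "\<lambda>i. c * k i" y y] c orth unfolding dot_simps by simp
      then show ?thesis by (simp add: zero)
    qed
  qed
qed

definition local_orth_auto :: "(complex mat \<Rightarrow> complex mat) \<Rightarrow> bool" where
  "local_orth_auto \<psi> \<longleftrightarrow> (\<forall>P\<in>rank_one. \<forall>Q\<in>rank_one. \<exists>g. orth_auto g \<and> \<psi> P = g P \<and> \<psi> Q = g Q)"

lemma local_orth_auto_comp:
  assumes "orth_auto h" "local_orth_auto \<psi>"
  shows "local_orth_auto (h \<circ> \<psi>)"
  unfolding local_orth_auto_def
proof (intro ballI)
  fix P Q assume "P \<in> rank_one" "Q \<in> rank_one"
  then obtain g where "orth_auto g" "\<psi> P = g P" "\<psi> Q = g Q"
    using assms(2) by (auto simp: local_orth_auto_def)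
  then show "\<exists>g. orth_auto g \<and> (h \<circ> \<psi>) P = g P \<and> (h \<circ> \<psi>) Q = g Q"
    using orth_auto_comp[OF assms(1)] by (intro exI[of _ "h \<circ> g"]) auto
qed

lemma orth_auto_closed: "orth_auto g \<Longrightarrow> P \<in> rank_one \<Longrightarrow> g P \<in> rank_one"
  by (auto simp: orth_auto_def dest: bij_betwE)

lemma orth_auto_inj: "orth_auto g \<Longrightarrow> P \<in> rank_one \<Longrightarrow> Q \<in> rank_one \<Longrightarrow> g P = g Q \<longleftrightarrow> P = Q"
  by (auto simp: orth_auto_def bij_betw_def inj_on_eq_iff)

lemma orth_auto_mult_eq_0:
  assumes g: "orth_auto g" and P: "P \<in> rank_one" and Q: "Q \<in> rank_one"
  shows "g P * g Q = 0\<^sub>m n n \<or> g Q * g P = 0\<^sub>m n n \<longleftrightarrow> P * Q = 0\<^sub>m n n \<or> Q * P = 0\<^sub>m n n"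
proof -
  have im: "rank_one = g ` rank_one"
    using g bij_betw_imp_surj_on unfolding orth_auto_def by metis
  have "(\<exists>P'\<in>rank_one. (P' = g P \<or> adj (g P) P') \<and> orth P' (g Q)) \<longleftrightarrow>
      (\<exists>P'\<in>rank_one. (g P' = g P \<or> adj (g P) (g P')) \<and> orth (g P') (g Q))"
    by (subst im) blast
  also have "\<dots> \<longleftrightarrow> (\<exists>P'\<in>rank_one. (P' = P \<or> adj P P') \<and> orth P' Q)"
    using g P Q by (intro bex_cong refl) (auto simp: orth_auto_adj orth_auto_inj orth_auto_def)
  finally show ?thesis using mult_eq_0_iff_adj_orth P Q orth_auto_closed[OF g] by simp
qed

text \<open>The quantifiers in \<open>adj\<close> range over all idempotents, whereas \<psi> is
  controlled only on pairs and may fail to be surjective. Each relation is therefore moved by the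
  bijection \<open>g\<close> belonging to the pair and restated on both sides as an equation between
  two matrices.\<close>

lemma local_orth_autoD:
  assumes "local_orth_auto \<psi>" and P: "P \<in> rank_one" and Q: "Q \<in> rank_one"
  shows "\<psi> P \<in> rank_one"
    and "\<psi> P = \<psi> Q \<longleftrightarrow> P = Q"
    and "orth (\<psi> P) (\<psi> Q) \<longleftrightarrow> orth P Q"
    and "P \<noteq> Q \<Longrightarrow> (\<psi> P * \<psi> Q = \<psi> Q \<or> \<psi> P * \<psi> Q = \<psi> P) \<longleftrightarrow> (P * Q = Q \<or> P * Q = P)"
    and "\<psi> P * \<psi> Q = 0\<^sub>m n n \<or> \<psi> Q * \<psi> P = 0\<^sub>m n n \<longleftrightarrow> P * Q = 0\<^sub>m n n \<or> Q * P = 0\<^sub>m n n"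
proof -
  obtain g where g: "orth_auto g" "\<psi> P = g P" "\<psi> Q = g Q"
    using assms by (auto simp: local_orth_auto_def)
  show "\<psi> P \<in> rank_one" using orth_auto_closed[OF g(1) P] g by simp
  show "\<psi> P = \<psi> Q \<longleftrightarrow> P = Q" using orth_auto_inj[OF g(1) P Q] g by simp
  show "orth (\<psi> P) (\<psi> Q) \<longleftrightarrow> orth P Q" using g P Q by (simp add: orth_auto_def)
  show "(\<psi> P * \<psi> Q = \<psi> Q \<or> \<psi> P * \<psi> Q = \<psi> P) \<longleftrightarrow> (P * Q = Q \<or> P * Q = P)" if "P \<noteq> Q"
    using orth_auto_adj[OF g(1) P Q] orth_auto_inj[OF g(1) P Q] adj_iff[OF P Q that]
      adj_iff[OF orth_auto_closed[OF g(1) P] orth_auto_closed[OF g(1) Q]] that g by simp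
  show "\<psi> P * \<psi> Q = 0\<^sub>m n n \<or> \<psi> Q * \<psi> P = 0\<^sub>m n n \<longleftrightarrow> P * Q = 0\<^sub>m n n \<or> Q * P = 0\<^sub>m n n"
    using orth_auto_mult_eq_0[OF g(1) P Q] g by simp
qed

section \<open>Maps that are locally orthogonality preserving\<close>

abbreviation E :: "nat \<Rightarrow> complex mat" where
  "E i \<equiv> outer (unit i) (unit i)"

definition row_elem :: "nat \<Rightarrow> nat \<Rightarrow> complex \<Rightarrow> complex mat" where
  "row_elem i j t = outer (unit i) (\<lambda>k. unit i k + t * unit j k)"

definition col_elem :: "nat \<Rightarrow> nat \<Rightarrow> complex \<Rightarrow> complex mat" where
  "col_elem j i t = outer (\<lambda>k. unit j k + t * unit i k) (unit j)"

text \<open>The rank one idempotents with the range of \<open>E i\<close>; \<open>col\<close> below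
  describes those with the kernel of \<open>E i\<close>.\<close>

definition row :: "nat \<Rightarrow> complex mat \<Rightarrow> bool" where
  "row i Q \<longleftrightarrow> (\<exists>f. f i = 1 \<and> Q = outer (unit i) f)"

definition col :: "nat \<Rightarrow> complex mat \<Rightarrow> bool" where
  "col i Q \<longleftrightarrow> (\<exists>y. y i = 1 \<and> Q = outer y (unit i))"

lemma rowI: "f i = 1 \<Longrightarrow> row i (outer (unit i) f)"
  and colI: "y i = 1 \<Longrightarrow> col i (outer y (unit i))"
  by (auto simp: row_def col_def)

lemma unit_simps [simp]: "unit i i = 1" "i \<noteq> j \<Longrightarrow> unit i j = 0"
  by (auto simp: unit_def)

lemma E_rank_one: "i < n \<Longrightarrow> E i \<in> rank_one"
  by (intro rank_oneI) (simp add: dot_unit)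

lemma row_rank_one: "i < n \<Longrightarrow> row i Q \<Longrightarrow> Q \<in> rank_one"
  and col_rank_one: "i < n \<Longrightarrow> col i Q \<Longrightarrow> Q \<in> rank_one"
  by (auto simp: row_def col_def dot_unit intro!: rank_oneI)

lemma row_elem: "i < n \<Longrightarrow> i \<noteq> j \<Longrightarrow> row i (row_elem i j t)"
  and col_elem: "j < n \<Longrightarrow> i \<noteq> j \<Longrightarrow> col j (col_elem j i t)"
  unfolding row_elem_def col_elem_def by (auto intro!: rowI colI)

lemma row_elem_ne:
  assumes "i < n" "j < n" "i \<noteq> j" "t \<noteq> 0" shows "row_elem i j t \<noteq> E i" "col_elem j i t \<noteq> E j"
proof -
  have "row_elem i j t $$ (i, j) \<noteq> E i $$ (i, j)" "col_elem j i t $$ (i, j) \<noteq> E j $$ (i, j)"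
    using assms by (auto simp: row_elem_def col_elem_def)
  then show "row_elem i j t \<noteq> E i" "col_elem j i t \<noteq> E j" by metis+
qed

lemma row_iff:
  assumes "Q \<in> rank_one" "i < n"
  shows "E i * Q = Q \<longleftrightarrow> row i Q"
proof
  obtain x f where Q: "Q = outer x f" "dot f x = 1" using assms(1) by (rule rank_oneE)
  assume "E i * Q = Q"
  then obtain c where c: "\<forall>k<n. x k = c * unit i k"
    using same_range_iff[of "unit i" "unit i" f x] Q assms(2) by (auto simp: dot_unit)
  then have "Q = outer (unit i) (\<lambda>k. c * f k)" unfolding Q by (auto intro!: eq_matI)
  moreover have "c * f i = 1"
    using dot_cong[of f f x "\<lambda>k. c * unit i k"] c Q(2) assms(2) unfolding dot_simps by (simp add: dot_unit)
  ultimately show "row i Q" unfolding row_def by (intro exI[of _ "\<lambda>k. c * f k"]) simp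
next
  assume "row i Q"
  then show "E i * Q = Q" using assms(2) by (auto simp: row_def outer_mult dot_unit)
qed

lemma col_iff:
  assumes "Q \<in> rank_one" "i < n"
  shows "E i * Q = E i \<longleftrightarrow> col i Q"
proof
  obtain x f where Q: "Q = outer x f" "dot f x = 1" using assms(1) by (rule rank_oneE)
  assume "E i * Q = E i"
  then obtain c where c: "\<forall>k<n. unit i k = c * f k"
    using same_kernel_iff[of "unit i" "unit i" f x] Q assms(2) by (auto simp: dot_unit)
  then have 1: "c * f i = 1" using assms(2) by (metis unit_simps(1))
  then have f: "f k = unit i k / c" if "k < n" for k using c that by (auto simp: field_simps)
  then have "Q = outer (\<lambda>k. x k / c) (unit i)" unfolding Q by (auto intro!: eq_matI)
  moreover have "x i / c = 1"
  proof -
    have "dot f x = dot (\<lambda>k. unit i k / c) x" using f by (intro dot_cong) auto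
    then show ?thesis using Q(2) assms(2) unfolding dot_simps by (simp add: dot_unit)
  qed
  ultimately show "col i Q" unfolding col_def by (intro exI[of _ "\<lambda>k. x k / c"]) simp
next
  assume "col i Q"
  then show "E i * Q = E i" using assms(2) by (auto simp: col_def outer_mult dot_unit)
qed

lemma row_col_E: "i < n \<Longrightarrow> row i Q \<Longrightarrow> col i Q \<Longrightarrow> Q = E i"
  using row_iff[of Q i] col_iff[of Q i] row_rank_one[of i Q] by simp

lemma row_row: "i < n \<Longrightarrow> row i P \<Longrightarrow> row i Q \<Longrightarrow> P * Q = Q"
  and col_col: "i < n \<Longrightarrow> col i P \<Longrightarrow> col i Q \<Longrightarrow> P * Q = P"
  by (auto simp: row_def col_def outer_mult dot_unit)

text \<open>Apart from \<open>E i\<close> itself, an idempotent with the range of \<open>E i\<close>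
  and one with its kernel share neither range nor kernel. This separates the two families, so a map
  preserving these relations cannot mix them.\<close>

lemma row_col_not_adj:
  assumes i: "i < n" and P: "row i P" "P \<noteq> E i" and Q: "col i Q" "Q \<noteq> E i"
  shows "P * Q \<noteq> P" "P * Q \<noteq> Q" "P \<noteq> Q"
proof -
  obtain f where f: "f i = 1" "P = outer (unit i) f" using P by (auto simp: row_def)
  obtain y where y: "y i = 1" "Q = outer y (unit i)" using Q by (auto simp: col_def)
  define c where "c = dot f y"
  have PQ: "P * Q = c \<cdot>\<^sub>m E i" by (simp add: f y outer_mult c_def)
  have idx: "P $$ (i, i) = 1" "Q $$ (i, i) = 1" "(c \<cdot>\<^sub>m E i) $$ (i, i) = c" using f y i by auto
  have "c \<cdot>\<^sub>m E i = E i" if "c = 1" using that by (auto intro!: eq_matI)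
  then show "P * Q \<noteq> P" "P * Q \<noteq> Q" using P Q idx unfolding PQ by metis+
  show "P \<noteq> Q" using P Q row_col_E[OF i] by metis
qed

lemma orth_E:
  assumes "i < n" "dot f x = 1"
  shows "orth (outer x f) (E i) \<longleftrightarrow> f i = 0 \<and> x i = 0"
  using orth_outer[OF assms(2), of "unit i" "unit i"] assms(1) by (auto simp: dot_unit)

lemma mult_eq_0_outer:
  assumes "dot f x = 1" "dot g y = 1"
  shows "outer x f * outer y g = 0\<^sub>m n n \<or> outer y g * outer x f = 0\<^sub>m n n \<longleftrightarrow> dot f y = 0 \<or> dot g x = 0"
  using assms by (simp add: mult_outer_eq_0)

text \<open>The normalized all-ones matrix. The images of the \<open>E i\<close> fix the basis
  vectors only up to scalars; the range of the image of this idempotent fixes the scalars relative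
  to each other.\<close>

definition ones_idem :: "complex mat" where
  "ones_idem = outer (\<lambda>_. 1) (\<lambda>_. 1 / of_nat n)"

lemma dot_ones: "dot (\<lambda>_. 1 / of_nat n) (\<lambda>_. 1) = 1"
  using n3 by (simp add: dot_def)

text \<open>The last conjunct excludes maps that exchange ranges and kernels.\<close>

definition normalized :: "(complex mat \<Rightarrow> complex mat) \<Rightarrow> bool" where
  "normalized \<psi> \<longleftrightarrow> local_orth_auto \<psi> \<and> (\<forall>i<n. \<psi> (E i) = E i) \<and>
    (\<exists>g. dot g (\<lambda>_. 1) = 1 \<and> \<psi> ones_idem = outer (\<lambda>_. 1) g) \<and> row 0 (\<psi> (row_elem 0 1 1))"

text \<open>The images of the \<open>E i\<close> are pairwise orthogonal, so their ranges and
  functionals form a biorthogonal system. Rescaling it by the coordinates of \<open>u\<close>, the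
  range vector of the image of \<open>ones_idem\<close>, turns \<open>u\<close> into the all-ones
  vector.\<close>

lemma normalize:
  assumes \<psi>: "local_orth_auto \<psi>" and row: "\<psi> (E 0) * \<psi> (row_elem 0 1 1) = \<psi> (row_elem 0 1 1)"
  obtains S S' where "inverse_pair S S'" "normalized (\<lambda>P. S' * \<psi> P * S)"
proof -
  note D = local_orth_autoD[OF \<psi>]
  have "\<exists>x f. dot f x = 1 \<and> \<psi> (E i) = outer x f" if "i < n" for i
    using D(1)[OF E_rank_one[OF that] E_rank_one[OF that]] by (metis rank_oneE)
  then obtain x f where xf: "\<And>i. i < n \<Longrightarrow> dot (f i) (x i) = 1" "\<And>i. i < n \<Longrightarrow> \<psi> (E i) = outer (x i) (f i)"
    by metis
  have J: "ones_idem \<in> rank_one" unfolding ones_idem_def by (intro rank_oneI dot_ones)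
  then obtain u g where ug: "\<psi> ones_idem = outer u g" "dot g u = 1"
    using D(1) by (metis rank_oneE)
  have orth: "dot (f i) (x j) = 0" if "i < n" "j < n" "i \<noteq> j" for i j
  proof -
    have "orth (E i) (E j)" using that by (simp add: orth_E dot_unit)
    then have "orth (outer (x i) (f i)) (outer (x j) (f j))"
      using D(3)[OF E_rank_one E_rank_one] that xf(2) by metis
    then show ?thesis using that xf(1) by (simp add: orth_outer)
  qed
  define c where "c i = dot (f i) u" for i
  \<comment> \<open>No product of \<open>E i\<close> with \<open>ones_idem\<close> vanishes, and
    this is preserved, so \<open>u\<close> has nonzero coordinates in the new basis.\<close>
  have c: "c i \<noteq> 0" if "i < n" for i
  proof -
    have "\<not> (E i * ones_idem = 0\<^sub>m n n \<or> ones_idem * E i = 0\<^sub>m n n)"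
      unfolding ones_idem_def using that n3 by (subst mult_eq_0_outer) (simp_all add: dot_ones dot_unit)
    then have "\<not> (outer (x i) (f i) * outer u g = 0\<^sub>m n n \<or> outer u g * outer (x i) (f i) = 0\<^sub>m n n)"
      using D(5)[OF E_rank_one[OF that] J] xf(2)[OF that] ug by simp
    then show ?thesis using mult_eq_0_outer[OF xf(1)[OF that] ug(2)] by (simp add: c_def)
  qed
  define y where "y i k = c i * x i k" for i k
  define h where "h i k = f i k / c i" for i k
  have "biorth n y h"
    unfolding biorth_def y_def h_def dot_simps using c xf(1) orth by auto
  from biorth_matrices[OF this] obtain S S' where S: "inverse_pair S S'"
    "\<And>i j. i < n \<Longrightarrow> j < n \<Longrightarrow> S' $$ (i, j) = h i j" "\<And>i. i < n \<Longrightarrow> S * E i * S' = outer (y i) (h i)" by metis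
  note S' = inverse_pair_sym[OF S(1)]
  have hy: "outer (y i) (h i) = \<psi> (E i)" if "i < n" for i
    using c[OF that] xf(2)[OF that] by (auto simp: y_def h_def intro!: eq_matI)
  have EE: "S' * \<psi> (E i) * S = E i" if "i < n" for i
    using conj_conj[OF S(1), of "E i"] S(3)[OF that] hy[OF that] by simp
  show ?thesis
  proof (rule that[OF S(1)])
    have "local_orth_auto (\<lambda>P. S' * \<psi> P * S)"
      using local_orth_auto_comp[OF orth_auto_conj[OF S'] \<psi>] by (simp add: comp_def)
    moreover have "\<exists>g. dot g (\<lambda>_. 1) = 1 \<and> S' * \<psi> ones_idem * S = outer (\<lambda>_. 1) g"
    proof -
      have one: "apply_mat S' u i = 1" if "i < n" for i
      proof -
        have "apply_mat S' u i = dot (h i) u"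
          using S(2) that by (simp add: apply_mat_def dot_def)
        then show ?thesis using c[OF that] unfolding h_def dot_simps by (simp add: c_def)
      qed
      have "dot (apply_mat (transpose_mat S) g) (\<lambda>_. 1) = dot g u"
        using dot_conj[OF S', of g u] one dot_cong[of _ _ "apply_mat S' u" "\<lambda>_. 1"] by simp
      moreover have "S' * \<psi> ones_idem * S = outer (\<lambda>_. 1) (apply_mat (transpose_mat S) g)"
        unfolding ug conj_outer[OF S'] using one by (intro outer_cong) auto
      ultimately show ?thesis using ug by auto
    qed
    moreover have "row 0 (S' * \<psi> (row_elem 0 1 1) * S)"
    proof -
      have Q: "row_elem 0 1 1 \<in> rank_one" using row_elem n3 by (intro row_rank_one[of 0]) auto
      have "E 0 * (S' * \<psi> (row_elem 0 1 1) * S) = (S' * \<psi> (E 0) * S) * (S' * \<psi> (row_elem 0 1 1) * S)"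
        using EE n3 by simp
      also have "\<dots> = S' * \<psi> (row_elem 0 1 1) * S"
        using conj_mult[OF S', of "\<psi> (E 0)" "\<psi> (row_elem 0 1 1)"] row D(1) Q E_rank_one[of 0] n3
        by (simp add: rank_one_carrier)
      finally show ?thesis
        using row_iff[of "S' * \<psi> (row_elem 0 1 1) * S" 0] conj_rank_one[OF S'] D(1) Q n3 by simp
    qed
    ultimately show "normalized (\<lambda>P. S' * \<psi> P * S)" using EE by (simp add: normalized_def)
  qed
qed

text \<open>For each \<open>i\<close> the image of a row or column idempotent is of one of the two
  types, and by \<open>row_col_not_adj\<close> either all types are kept or all are exchanged. Index
  0 keeps them by normalization; an orthogonal pair consisting of a row element at 0 and a column
  element at \<open>i\<close> carries this over to \<open>i\<close>.\<close>

lemma normalized_row_col: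
  assumes \<psi>: "normalized \<psi>" and i: "i < n"
  shows "row i Q \<Longrightarrow> row i (\<psi> Q)" "col i Q \<Longrightarrow> col i (\<psi> Q)"
proof -
  note D = local_orth_autoD[of \<psi>]
  have loc: "local_orth_auto \<psi>" and fixE: "\<And>i. i < n \<Longrightarrow> \<psi> (E i) = E i"
    using \<psi> by (auto simp: normalized_def)
  have ne: "\<psi> Q \<noteq> E i" if "Q \<in> rank_one" "Q \<noteq> E i" "i < n" for Q i
    using D(2)[OF loc that(1) E_rank_one[OF that(3)]] that fixE by simp
  have either: "row i (\<psi> Q) \<or> col i (\<psi> Q)" if "row i Q \<or> col i Q" "Q \<noteq> E i" "i < n" for Q i
  proof -
    have Q: "Q \<in> rank_one" using that row_rank_one col_rank_one by blast
    have "E i * Q = Q \<or> E i * Q = E i" using that row_iff[OF Q] col_iff[OF Q] by blast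
    then have "\<psi> (E i) * \<psi> Q = \<psi> Q \<or> \<psi> (E i) * \<psi> Q = \<psi> (E i)"
      using D(4)[OF loc E_rank_one[OF that(3)] Q] that(2) by auto
    then show ?thesis
      using row_iff[OF D(1)[OF loc Q Q] that(3)] col_iff[OF D(1)[OF loc Q Q] that(3)] fixE that(3) by auto
  qed
  have rr: "row i (\<psi> Q)" if "row i P" "P \<noteq> E i" "row i (\<psi> P)" "row i Q" "Q \<noteq> E i" "i < n" for P Q i
  proof (rule ccontr)
    assume "\<not> row i (\<psi> Q)"
    then have c: "col i (\<psi> Q)" using either that by blast
    have R: "P \<in> rank_one" "Q \<in> rank_one" using that row_rank_one by blast+
    have "P \<noteq> Q" using that \<open>\<not> row i (\<psi> Q)\<close> by auto
    moreover have "P * Q = Q" using row_row that by blast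
    ultimately show False
      using D(4)[OF loc R] row_col_not_adj[OF that(6,3) ne[OF R(1)] c ne[OF R(2)]] that by auto
  qed
  have rc: "col i (\<psi> Q)" if "row i P" "P \<noteq> E i" "row i (\<psi> P)" "col i Q" "Q \<noteq> E i" "i < n" for P Q i
  proof (rule ccontr)
    assume "\<not> col i (\<psi> Q)"
    then have c: "row i (\<psi> Q)" using either that by blast
    have R: "P \<in> rank_one" "Q \<in> rank_one" using that row_rank_one col_rank_one by blast+
    have "\<psi> P * \<psi> Q = \<psi> Q" using row_row[OF that(6,3) c] .
    then show False
      using D(4)[OF loc R] row_col_not_adj[OF that(6,1,2,4,5)] by auto
  qed
  have cr: "row i (\<psi> Q)" if "col i P" "P \<noteq> E i" "col i (\<psi> P)" "row i Q" "Q \<noteq> E i" "i < n" for P Q i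
  proof (rule ccontr)
    assume "\<not> row i (\<psi> Q)"
    then have c: "col i (\<psi> Q)" using either that by blast
    have R: "P \<in> rank_one" "Q \<in> rank_one" using that row_rank_one col_rank_one by blast+
    have "\<psi> Q * \<psi> P = \<psi> Q" using col_col[OF that(6) c that(3)] .
    then show False
      using D(4)[OF loc R(2,1)] row_col_not_adj[OF that(6,4,5,1,2)] by auto
  qed
  have type0: "row 0 (\<psi> Q)" if "row 0 Q" "Q \<noteq> E 0" for Q
    using rr[of 0 "row_elem 0 1 1" Q] that \<psi> n3 row_elem[of 0 1 1] row_elem_ne(1)[of 0 1 1]
    by (auto simp: normalized_def)
  have typei: "\<exists>P. col i P \<and> P \<noteq> E i \<and> col i (\<psi> P)" if i: "i < n" "i \<noteq> 0" for i
  proof (intro exI conjI)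
    \<comment> \<open>The sign makes the pair orthogonal: the functional of \<open>?Q\<close> has
      values 1 at both \<open>unit 0\<close> and \<open>unit i\<close>, whose difference spans the
      range of \<open>?P\<close>.\<close>
    let ?P = "col_elem i 0 (- 1)" let ?Q = "row_elem 0 i 1"
    have n0: "0 < n" using n3 by simp
    show P: "col i ?P" "?P \<noteq> E i" using col_elem row_elem_ne(2)[of 0 i] that n0 by auto
    have Q: "row 0 ?Q" "?Q \<noteq> E 0" using row_elem row_elem_ne(1)[of 0 i] that n0 by auto
    have R: "?P \<in> rank_one" "?Q \<in> rank_one" using P Q row_rank_one col_rank_one that n0 by blast+
    obtain f where f: "f 0 = 1" "\<psi> ?Q = outer (unit 0) f" using type0[OF Q] by (auto simp: row_def)
    have f1: "dot f (unit 0) = 1" using f n0 by (simp add: dot_unit)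
    have zero: "f k = 0" if k: "k < n" "k \<noteq> 0" "k \<noteq> i" for k
    proof -
      have "orth ?Q (E k)" unfolding row_elem_def
        using k i n0 by (subst orth_E) (auto simp: dot_unit)
      then have "orth (\<psi> ?Q) (E k)" using D(3)[OF loc R(2) E_rank_one[OF k(1)]] fixE k by simp
      then show ?thesis using k f f1 by (simp add: orth_E)
    qed
    \<comment> \<open>Otherwise the image would be \<open>E 0\<close>, against injectivity. A
      nonzero value prevents orthogonality to any idempotent with range \<open>unit i\<close>, so
      the image of \<open>?P\<close> is not a row.\<close>
    have fi: "f i \<noteq> 0"
    proof
      assume "f i = 0"
      then have "f k = unit 0 k" if "k < n" for k
        using zero[OF that] f(1) by (cases "k = 0"; cases "k = i") (auto simp: unit_def)
      then have "\<psi> ?Q = E 0" unfolding f(2) by (intro outer_cong) auto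
      then show False using ne[OF R(2) Q(2) n0] by simp
    qed
    have "orth ?Q ?P"
    proof -
      have "dot (unit i) (\<lambda>k. unit i k + - 1 * unit 0 k) = 1" "dot (\<lambda>k. unit 0 k + 1 * unit i k) (unit 0) = 1"
        using i n0 by (simp_all add: dot_unit)
      from orth_outer[OF this(2,1)] show ?thesis
        unfolding row_elem_def col_elem_def using i n0 by (auto simp: dot_unit)
          (simp only: dot_simps(7) dot_unit, simp)
    qed
    then have orth: "orth (\<psi> ?Q) (\<psi> ?P)" using D(3)[OF loc R(2,1)] by simp
    show "col i (\<psi> ?P)"
    proof (rule ccontr)
      assume "\<not> col i (\<psi> ?P)"
      then have "row i (\<psi> ?P)" using either[of i ?P] P i by blast
      then obtain g where g: "g i = 1" "\<psi> ?P = outer (unit i) g" by (auto simp: row_def)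
      then have "dot g (unit i) = 1" using i by (simp add: dot_unit)
      then have "dot f (unit i) = 0" using orth_outer[OF f1, of g "unit i"] orth f g by simp
      then show False using fi i by (simp add: dot_unit)
    qed
  qed
  have row: "row i (\<psi> Q)" if "row i Q" "Q \<noteq> E i" "i < n" for Q i
    using type0[of Q] typei[of i] cr[of i _ Q] that by (cases "i = 0") auto
  have col: "col i (\<psi> Q)" if "col i Q" "Q \<noteq> E i" "i < n" for Q i
  proof -
    define j where "j = (if i = 0 then 1 else 0 :: nat)"
    have j: "j < n" "j \<noteq> i" using n3 by (auto simp: j_def)
    have *: "row i (row_elem i j 1)" "row_elem i j 1 \<noteq> E i"
      using row_elem row_elem_ne(1)[of i j] j that by auto
    show ?thesis by (rule rc[OF * row[OF * that(3)] that])
  qed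
  have "row i (E i)" "col i (E i)" by (simp_all add: rowI colI)
  then show "row i Q \<Longrightarrow> row i (\<psi> Q)" "col i Q \<Longrightarrow> col i (\<psi> Q)"
    using row[OF _ _ i] col[OF _ _ i] fixE[OF i] by metis+
qed

lemma dot_comb:
  assumes "i < n" "j < n"
  shows "dot f (\<lambda>k. unit i k + t * unit j k) = f i + t * f j"
    "dot (\<lambda>k. unit i k + t * unit j k) x = x i + t * x j"
  using assms unfolding dot_simps by (simp_all add: dot_unit)

text \<open>Orthogonality to every \<open>E k\<close> with \<open>k\<close> other than
  \<open>i\<close> and \<open>j\<close> leaves one free entry.\<close>

lemma normalized_row_elem:
  assumes \<psi>: "normalized \<psi>" and ij: "i < n" "j < n" "i \<noteq> j"
  shows "\<exists>t'. \<psi> (row_elem i j t) = row_elem i j t'"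
    and "\<exists>t'. \<psi> (col_elem j i t) = col_elem j i t'"
proof -
  note D = local_orth_autoD[of \<psi>]
  have loc: "local_orth_auto \<psi>" and fixE: "\<And>i. i < n \<Longrightarrow> \<psi> (E i) = E i"
    using \<psi> by (auto simp: normalized_def)
  show "\<exists>t'. \<psi> (row_elem i j t) = row_elem i j t'"
  proof -
    let ?Q = "row_elem i j t"
    have Q: "row i ?Q" using row_elem ij by blast
    then have R: "?Q \<in> rank_one" using row_rank_one ij by blast
    obtain f where f: "f i = 1" "\<psi> ?Q = outer (unit i) f"
      using normalized_row_col(1)[OF \<psi> ij(1) Q] by (auto simp: row_def)
    have "f k = 0" if k: "k < n" "k \<noteq> i" "k \<noteq> j" for k
    proof -
      have "orth ?Q (E k)" unfolding row_elem_def
        using k ij by (subst orth_E) (auto simp: dot_comb)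
      then have "orth (\<psi> ?Q) (E k)" using D(3)[OF loc R E_rank_one[OF k(1)]] fixE k by simp
      moreover have "dot f (unit i) = 1" using f ij by (simp add: dot_unit)
      ultimately show ?thesis using k f by (simp add: orth_E)
    qed
    then have "f k = unit i k + f j * unit j k" if "k < n" for k using that f ij
      by (cases "k = i"; cases "k = j") auto
    then have "outer (unit i) f = row_elem i j (f j)" unfolding row_elem_def by (intro outer_cong) auto
    then show ?thesis using f by metis
  qed
  show "\<exists>t'. \<psi> (col_elem j i t) = col_elem j i t'"
  proof -
    let ?Q = "col_elem j i t"
    have Q: "col j ?Q" using col_elem ij by blast
    then have R: "?Q \<in> rank_one" using col_rank_one ij by blast
    obtain y where y: "y j = 1" "\<psi> ?Q = outer y (unit j)"
      using normalized_row_col(2)[OF \<psi> ij(2) Q] by (auto simp: col_def)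
    have "y k = 0" if k: "k < n" "k \<noteq> i" "k \<noteq> j" for k
    proof -
      have "orth ?Q (E k)" unfolding col_elem_def
        using k ij by (subst orth_E) (auto simp: dot_comb)
      then have "orth (\<psi> ?Q) (E k)" using D(3)[OF loc R E_rank_one[OF k(1)]] fixE k by simp
      moreover have "dot (unit j) y = 1" using y ij by (simp add: dot_unit)
      ultimately show ?thesis using k y by (simp add: orth_E)
    qed
    then have "y k = unit j k + y i * unit i k" if "k < n" for k using that y ij
      by (cases "k = i"; cases "k = j") auto
    then have "outer y (unit j) = col_elem j i (y i)" unfolding col_elem_def by (intro outer_cong) auto
    then show ?thesis using y by metis
  qed
qed

end

section \<open>A normalized map in coordinates: reading off the field endomorphism\<close>

locale normalized_map = dim3 +
  fixes \<psi> :: "complex mat \<Rightarrow> complex mat"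
  assumes normalized: "normalized \<psi>"
begin

lemma psi_local: "local_orth_auto \<psi>" and psi_E: "i < n \<Longrightarrow> \<psi> (E i) = E i"
  using normalized by (auto simp: normalized_def)

lemmas psi_simps = local_orth_autoD[OF psi_local]
lemmas psi_row_col = normalized_row_col[OF normalized]

definition \<tau> :: "nat \<Rightarrow> nat \<Rightarrow> complex \<Rightarrow> complex" where
  "\<tau> i j a = \<psi> (col_elem j i a) $$ (i, j)"

lemma \<tau>_col: 
  assumes "i < n" "j < n" "i \<noteq> j" shows "\<psi> (col_elem j i a) = col_elem j i (\<tau> i j a)"
proof -
  obtain t where "\<psi> (col_elem j i a) = col_elem j i t" using normalized_row_elem(2)[OF normalized assms] by blast
  moreover from this have "\<tau> i j a = t" using assms by (simp add: \<tau>_def col_elem_def)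
  ultimately show ?thesis by simp
qed

text \<open>A row element with parameter \<open>s\<close> and a column element with parameter
  \<open>u\<close> are orthogonal exactly if \<open>u + s = 0\<close>, so one function governs both
  kinds. The signs stay on both sides because oddness of \<tau> is not yet available.\<close>

lemma \<tau>_row: 
  assumes ij: "i < n" "j < n" "i \<noteq> j" shows "\<psi> (row_elem i j (- a)) = row_elem i j (- \<tau> i j a)"
proof -
  obtain t where t: "\<psi> (row_elem i j (- a)) = row_elem i j t" using normalized_row_elem(1)[OF normalized assms] by blast
  have R: "row_elem i j s \<in> rank_one" "col_elem j i s \<in> rank_one" for s
    using row_elem col_elem row_rank_one col_rank_one ij by blast+
  have orth: "orth (row_elem i j s) (col_elem j i u) \<longleftrightarrow> u + s = 0" for s u
    unfolding row_elem_def col_elem_def using ij by (subst orth_outer) (simp_all add: dot_comb dot_unit add.commute)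
  have "orth (row_elem i j t) (col_elem j i (\<tau> i j a))"
    using psi_simps(3)[OF R, of "- a" a] \<tau>_col[OF ij, of a] t orth by simp
  then have "t = - \<tau> i j a" using orth by (simp add: eq_neg_iff_add_eq_0 add.commute)
  then show ?thesis using t by simp
qed

lemma \<tau>_0: "i < n \<Longrightarrow> j < n \<Longrightarrow> i \<noteq> j \<Longrightarrow> \<tau> i j 0 = 0"
proof -
  assume ij: "i < n" "j < n" "i \<noteq> j"
  have "col_elem j i 0 = E j" by (simp add: col_elem_def)
  then show ?thesis using ij psi_E[of j] by (simp add: \<tau>_def)
qed

lemma \<tau>_inj: "i < n \<Longrightarrow> j < n \<Longrightarrow> i \<noteq> j \<Longrightarrow> \<tau> i j a = \<tau> i j b \<Longrightarrow> a = b"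
proof -
  assume ij: "i < n" "j < n" "i \<noteq> j" and "\<tau> i j a = \<tau> i j b"
  then have "\<psi> (col_elem j i a) = \<psi> (col_elem j i b)" using \<tau>_col by simp
  moreover have "col_elem j i s \<in> rank_one" for s using col_elem col_rank_one ij by blast
  ultimately have "col_elem j i a $$ (i, j) = col_elem j i b $$ (i, j)" using psi_simps(2) by metis
  then show "a = b" using ij by (simp add: col_elem_def)
qed

lemma mult_eq_0_image:
  assumes "dot f x = 1" "\<psi> (outer x f) = outer x' f'" "dot f' x' = 1"
    and "dot g y = 1" "\<psi> (outer y g) = outer y' g'" "dot g' y' = 1"
  shows "dot f' y' = 0 \<or> dot g' x' = 0 \<longleftrightarrow> dot f y = 0 \<or> dot g x = 0"
  using psi_simps(5)[OF rank_oneI[OF assms(1)] rank_oneI[OF assms(4)]] assms by (simp add: mult_eq_0_outer)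

lemma image_diag:
  assumes "dot f x = 1" "\<psi> (outer x f) = outer x' f'" "dot f' x' = 1" "i < n"
  shows "f' i = 0 \<or> x' i = 0 \<longleftrightarrow> f i = 0 \<or> x i = 0"
  using mult_eq_0_image[OF assms(1-3) _ psi_E[OF assms(4)]] assms(4) by (simp add: dot_unit)

lemma image_zero:
  assumes "dot f x = 1" "\<psi> (outer x f) = outer x' f'" "dot f' x' = 1" "i < n"
  shows "f' i = 0 \<and> x' i = 0 \<longleftrightarrow> f i = 0 \<and> x i = 0"
  using psi_simps(3)[OF rank_oneI[OF assms(1)] E_rank_one[OF assms(4)]] assms psi_E[OF assms(4)] by (simp add: orth_E)

text \<open>The functional \<open>unit i - a * unit j\<close> vanishes at \<open>x\<close> exactly
  when \<open>x i = a * x j\<close>. So vanishing products with row elements compare ratios of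
  coordinates before and after \<psi>; the alternative \<open>f i = 0\<close> is the price for
  preserving only a disjunction of products.\<close>

lemma image_row_test:
  assumes "dot f x = 1" "\<psi> (outer x f) = outer x' f'" "dot f' x' = 1" and ij: "i < n" "j < n" "i \<noteq> j"
  shows "f' i = 0 \<or> x' i = \<tau> i j a * x' j \<longleftrightarrow> f i = 0 \<or> x i = a * x j"
proof -
  have "dot (\<lambda>k. unit i k + t * unit j k) (unit i) = 1" for t using ij by (simp add: dot_comb)
  from mult_eq_0_image[OF assms(1-3) this \<tau>_row[OF ij, of a, unfolded row_elem_def] this]
  show ?thesis unfolding dot_comb[OF ij(1,2)] dot_unit[OF ij(1)] by simp
qed

lemma image_col_test:
  assumes "dot f x = 1" "\<psi> (outer x f) = outer x' f'" "dot f' x' = 1" and ij: "i < n" "j < n" "i \<noteq> j"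
  shows "x' j = 0 \<or> f' j = - \<tau> i j b * f' i \<longleftrightarrow> x j = 0 \<or> f j = - b * f i"
proof -
  have "dot (unit j) (\<lambda>k. unit j k + t * unit i k) = 1" for t using ij by (simp add: dot_comb)
  from mult_eq_0_image[OF assms(1-3) this \<tau>_col[OF ij, of b, unfolded col_elem_def] this]
  show ?thesis unfolding dot_comb[OF ij(2,1)] dot_unit[OF ij(2)] by (simp add: eq_neg_iff_add_eq_0 disj_commute)
qed

lemma \<tau>_1:
  assumes ij: "i < n" "j < n" "i \<noteq> j" shows "\<tau> i j 1 = 1"
proof -
  obtain g where g: "dot g (\<lambda>_. 1) = 1" "\<psi> ones_idem = outer (\<lambda>_. 1) g"
    using normalized by (auto simp: normalized_def)
  have "g i \<noteq> 0" using image_diag[OF dot_ones g(2)[unfolded ones_idem_def] g(1) ij(1)] n3 by simp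
  then show ?thesis
    using image_row_test[OF dot_ones g(2)[unfolded ones_idem_def] g(1) ij, of 1] by simp
qed

text \<open>A single idempotent whose range vector has the coordinate ratios \<open>a\<close>,
  \<open>b\<close> and \<open>a * b\<close> for the three pairs of indices; the ratios of its image
  multiply in the same way.\<close>

lemma \<tau>_mult_aux:
  assumes ijk: "i < n" "j < n" "k < n" "i \<noteq> j" "j \<noteq> k" "i \<noteq> k" and ab: "a \<noteq> 0" "b \<noteq> 0"
  shows "\<tau> i j a * \<tau> j k b = \<tau> i k (a * b)"
proof -
  define x where "x = (\<lambda>m. if m = i then a * b else if m = j then b else 1)"
  have x0: "x m \<noteq> 0" for m using ab by (simp add: x_def)
  \<comment> \<open>All coordinates of \<open>f\<close> are nonzero, which excludes the unwanted
    alternative in the ratio tests; the factor \<open>of_nat n\<close> gives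
    \<open>dot f x = 1\<close>.\<close>
  define f where "f = (\<lambda>m. 1 / (of_nat n * x m))"
  have f0: "f m \<noteq> 0" for m using x0 n3 by (simp add: f_def)
  have fx: "dot f x = 1" using x0 n3 by (simp add: dot_def f_def)
  obtain x' f' where *: "\<psi> (outer x f) = outer x' f'" "dot f' x' = 1"
    using psi_simps(1)[OF rank_oneI[OF fx] rank_oneI[OF fx]] by (metis rank_oneE)
  have nz: "f' m \<noteq> 0 \<and> x' m \<noteq> 0" if "m < n" for m using image_diag[OF fx * that] x0 f0 by auto
  note T = image_row_test[OF fx *]
  have "x' i = \<tau> i j a * x' j" using T[OF ijk(1,2,4), of a] nz[of i] ijk by (auto simp: x_def)
  moreover have "x' j = \<tau> j k b * x' k" using T[OF ijk(2,3,5), of b] nz[of j] ijk by (auto simp: x_def)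
  moreover have "x' i = \<tau> i k (a * b) * x' k" using T[OF ijk(1,3,6), of "a * b"] nz[of i] ijk by (auto simp: x_def)
  ultimately show ?thesis using nz[OF ijk(3)] by auto
qed

definition \<sigma> :: "complex \<Rightarrow> complex" where "\<sigma> = \<tau> 0 1"

text \<open>With one factor equal to 1, the multiplication rule changes one index at a time, through
  a third index distinct from both; such moves connect every pair to \<open>(0, 1)\<close>.\<close>

lemma \<tau>_eq:
  assumes ij: "i < n" "j < n" "i \<noteq> j" shows "\<tau> i j a = \<sigma> a"
proof (cases "a = 0")
  case False
  have A: "\<tau> i j a = \<tau> i k a" if "i < n" "j < n" "k < n" "i \<noteq> j" "j \<noteq> k" "i \<noteq> k" for i j k
    using \<tau>_mult_aux[OF that False, of 1] \<tau>_1[of j k] that by simp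
  have B: "\<tau> j k a = \<tau> i k a" if "i < n" "j < n" "k < n" "i \<noteq> j" "j \<noteq> k" "i \<noteq> k" for i j k
    using \<tau>_mult_aux[OF that _ False, of 1] \<tau>_1[of i j] that by simp
  have n: "0 < n" "1 < n" "2 < n" using n3 by auto
  consider "i = 0" "j = 1" | "i = 0" "j \<noteq> 1" | "i = 1" "j = 0" | "i = 1" "j \<noteq> 0" | "i \<noteq> 0" "i \<noteq> 1" "j = 1" |
    "i \<noteq> 0" "i \<noteq> 1" "j \<noteq> 1" by blast
  then show ?thesis
  proof cases
    case 2 then show ?thesis using A[of 0 j 1] ij n by (auto simp: \<sigma>_def)
  next
    case 3 then show ?thesis using A[of 1 0 2] B[of 0 1 2] A[of 0 2 1] n by (auto simp: \<sigma>_def)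
  next
    case 4 then show ?thesis using B[of 0 1 j] A[of 0 j 1] ij n by (cases "j = 1") (auto simp: \<sigma>_def)
  next
    case 5 then show ?thesis using B[of 0 i 1] ij n by (auto simp: \<sigma>_def)
  next
    case 6 then show ?thesis using A[of i j 1] B[of 0 i 1] ij n by (auto simp: \<sigma>_def)
  qed (simp add: \<sigma>_def)
qed (use \<tau>_0 ij n3 in \<open>auto simp: \<sigma>_def\<close>)

lemma \<sigma>_0: "\<sigma> 0 = 0" and \<sigma>_1: "\<sigma> 1 = 1"
  using \<tau>_0[of 0 1] \<tau>_1[of 0 1] n3 by (simp_all add: \<sigma>_def)

lemma \<sigma>_inj: "\<sigma> a = \<sigma> b \<Longrightarrow> a = b"
  using \<tau>_inj[of 0 1 a b] n3 by (simp add: \<sigma>_def)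

lemma \<sigma>_nonzero: "\<sigma> a = 0 \<longleftrightarrow> a = 0"
  using \<sigma>_0 \<sigma>_inj by metis

lemma \<sigma>_mult: "\<sigma> (a * b) = \<sigma> a * \<sigma> b"
proof (cases "a = 0 \<or> b = 0")
  case False
  then show ?thesis using \<tau>_mult_aux[of 0 1 2 a b] \<tau>_eq[of 1 2] \<tau>_eq[of 0 2] n3 by (simp add: \<sigma>_def)
qed (auto simp: \<sigma>_0)

text \<open>The value squares to 1 and differs from 1 by injectivity.\<close>

lemma \<sigma>_minus_1: "\<sigma> (- 1) = - 1"
proof -
  have "\<sigma> (- 1) * \<sigma> (- 1) = 1" using \<sigma>_mult[of "- 1" "- 1"] \<sigma>_1 by simp
  then have "(\<sigma> (- 1) - 1) * (\<sigma> (- 1) + 1) = 0" by (simp add: algebra_simps)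
  moreover have "\<sigma> (- 1) \<noteq> 1" using \<sigma>_inj[of "- 1" 1] \<sigma>_1 by auto
  ultimately show ?thesis by (simp add: eq_neg_iff_add_eq_0)
qed

lemma \<sigma>_minus: "\<sigma> (- a) = - \<sigma> a"
  using \<sigma>_mult[of "- 1" a] \<sigma>_minus_1 by simp

lemma \<sigma>_divide: "\<sigma> (a / b) = \<sigma> a / \<sigma> b"
proof (cases "b = 0")
  case False
  then show ?thesis using \<sigma>_mult[of "a / b" b] \<sigma>_nonzero[of b] by (simp add: field_simps)
qed (simp add: \<sigma>_0)

text \<open>Each coordinate of the functional is recovered separately by a ratio test. The argument
  has to avoid additivity of \<sigma>, which is deduced from this lemma and its analogue for
  columns.\<close>

lemma image_row:
  assumes i: "i < n" and f: "f i = 1"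
  shows "\<psi> (outer (unit i) f) = outer (unit i) (\<lambda>k. \<sigma> (f k))"
proof -
  have fx: "dot f (unit i) = 1" using i f by (simp add: dot_unit)
  obtain f' where f': "f' i = 1" "\<psi> (outer (unit i) f) = outer (unit i) f'"
    using psi_row_col(1)[OF i rowI[of f i, OF f]] by (auto simp: row_def)
  have f'x: "dot f' (unit i) = 1" using i f' by (simp add: dot_unit)
  have "f' j = \<sigma> (f j)" if j: "j < n" for j
  proof (cases "j = i")
    case False
    show ?thesis
    proof (cases "f j = 0")
      case True
      then show ?thesis using image_zero[OF fx f'(2) f'x j] False \<sigma>_0 by auto
    next
      case nz: False
      have "f i = - (- 1 / f j) * f j" using f nz by simp
      then have "f' i = - \<tau> j i (- 1 / f j) * f' j"
        using image_col_test[OF fx f'(2) f'x j i False, of "- 1 / f j"] by (simp only: unit_simps simp_thms) simp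
      then show ?thesis
        using f' nz \<tau>_eq[OF j i False] \<sigma>_nonzero[of "f j"] by (simp add: \<sigma>_divide \<sigma>_minus \<sigma>_1 field_simps)
    qed
  qed (use f f' \<sigma>_1 in simp)
  then show ?thesis using f'(2) by (auto intro!: outer_cong)
qed

lemma image_col:
  assumes i: "i < n" and y: "y i = 1"
  shows "\<psi> (outer y (unit i)) = outer (\<lambda>k. \<sigma> (y k)) (unit i)"
proof -
  have fx: "dot (unit i) y = 1" using i y by (simp add: dot_unit)
  obtain y' where y': "y' i = 1" "\<psi> (outer y (unit i)) = outer y' (unit i)"
    using psi_row_col(2)[OF i colI[of y i, OF y]] by (auto simp: col_def)
  have f'x: "dot (unit i) y' = 1" using i y' by (simp add: dot_unit)
  have "y' j = \<sigma> (y j)" if j: "j < n" for j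
  proof (cases "j = i")
    case False
    then have ij: "i \<noteq> j" by simp
    show ?thesis
    proof (cases "y j = 0")
      case True
      then show ?thesis using image_zero[OF fx y'(2) f'x j] False \<sigma>_0 by auto
    next
      case nz: False
      have "y' i = \<tau> i j (1 / y j) * y' j"
        using image_row_test[OF fx y'(2) f'x i j ij, of "1 / y j"] nz y by simp
      then show ?thesis
        using y' nz \<tau>_eq[OF i j ij] \<sigma>_nonzero[of "y j"] by (simp add: \<sigma>_divide \<sigma>_1 field_simps)
    qed
  qed (use y y' \<sigma>_1 in simp)
  then show ?thesis using y'(2) by (auto intro!: outer_cong)
qed

text \<open>The product of a row with functional coordinates \<open>1, a, b\<close> and a column
  with coordinates \<open>1, 1, 1\<close> vanishes exactly if \<open>1 + (a + b) = 0\<close>. The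
  choice of \<open>a\<close> and \<open>b\<close> makes this identity a homogeneous form of the
  claim for \<open>u\<close> and \<open>v\<close>, and \<psi> transports it to the values of
  \<sigma>.\<close>

lemma \<sigma>_add: "\<sigma> (u + v) = \<sigma> u + \<sigma> v"
proof (cases "u + v = 0")
  case True
  then have "v = - u" by (simp add: add_eq_0_iff)
  then show ?thesis by (simp add: \<sigma>_minus \<sigma>_0)
next
  case False
  define a b where "a = - u / (u + v)" and "b = - v / (u + v)"
  define f where "f = (\<lambda>k. unit 0 k + (a * unit 1 k + b * unit 2 k))"
  define y where "y = (\<lambda>k. unit 0 k + (unit 1 k + unit 2 k))"
  have n: "0 < n" "1 < n" "2 < n" using n3 by auto
  have dotf: "dot (\<lambda>k. unit 0 k + (a * unit 1 k + b * unit 2 k)) z = z 0 + (a * z 1 + b * z 2)" for a b z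
    unfolding dot_simps using n by (simp add: dot_unit)
  have doty: "dot (unit 0) y = 1" unfolding y_def dot_simps using n by (simp add: dot_unit)
  have \<sigma>f: "(\<lambda>k. \<sigma> (f k)) = (\<lambda>k. unit 0 k + (\<sigma> a * unit 1 k + \<sigma> b * unit 2 k))"
    by (auto simp: f_def fun_eq_iff unit_def \<sigma>_0 \<sigma>_1)
  have \<sigma>y: "(\<lambda>k. \<sigma> (y k)) = y" by (auto simp: y_def fun_eq_iff unit_def \<sigma>_0 \<sigma>_1)
  have f1: "dot f (unit 0) = 1" "dot (\<lambda>k. \<sigma> (f k)) (unit 0) = 1"
    unfolding \<sigma>f unfolding f_def dotf by simp_all
  have f: "f 0 = 1" "y 0 = 1" by (simp_all add: f_def y_def)
  have "dot f y = 1 + (a + b)" "dot (\<lambda>k. \<sigma> (f k)) y = 1 + (\<sigma> a + \<sigma> b)"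
    unfolding \<sigma>f unfolding f_def dotf by (simp_all add: y_def)
  moreover have "(u + v) * (1 + (a + b)) = 0" using False by (simp add: a_def b_def distrib_left right_diff_distrib)
  then have "1 + (a + b) = 0" using False by simp
  ultimately have "1 + (\<sigma> a + \<sigma> b) = 0"
    using mult_eq_0_image[OF f1(1) image_row[of 0 f, OF n(1) f(1)] f1(2) doty image_col[of 0 y, OF n(1) f(2)]] doty n
    by (simp add: \<sigma>y dot_unit)
  moreover have "\<sigma> (u + v) * (1 + (\<sigma> a + \<sigma> b)) = \<sigma> (u + v) - (\<sigma> u + \<sigma> v)"
    using False \<sigma>_nonzero[of "u + v"] by (simp add: a_def b_def \<sigma>_divide \<sigma>_minus distrib_left right_diff_distrib)
  ultimately show ?thesis by simp
qed

lemma \<sigma>_endomorphism: "nonzero_field_endomorphism \<sigma>"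
  unfolding nonzero_field_endomorphism_def using \<sigma>_add \<sigma>_mult \<sigma>_1 by (metis zero_neq_one)

text \<open>Where \<open>x k\<close> is nonzero, the ratio test against \<open>i\<close> applies. A
  vanishing coordinate cannot be reached by a ratio, so there a functional supported on
  \<open>i\<close>, \<open>k\<close> and a further index \<open>m\<close> with \<open>x m\<close>
  nonzero is used.\<close>

lemma image_range:
  assumes fx: "dot f x = 1" and im: "\<psi> (outer x f) = outer x' f'" "dot f' x' = 1"
    and i: "i < n" "f i \<noteq> 0" "x i \<noteq> 0" and other: "m < n" "m \<noteq> i" "x m \<noteq> 0" and k: "k < n"
  shows "x' k = x' i / \<sigma> (x i) * \<sigma> (x k)"
proof (cases "k = i")
  case False
  have f'x': "f' i \<noteq> 0" "x' i \<noteq> 0" using image_diag[OF fx im i(1)] i by auto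
  show ?thesis
  proof (cases "x k = 0")
    case False
    have "x' i = \<tau> i k (x i / x k) * x' k"
      using image_row_test[OF fx im i(1) k, of "x i / x k"] \<open>k \<noteq> i\<close> False f'x' by auto
    then show ?thesis using \<tau>_eq[of i k] i k \<open>k \<noteq> i\<close> False \<sigma>_nonzero
      by (simp add: \<sigma>_divide field_simps)
  next
    case True
    then have "m \<noteq> k" using other by auto
    \<comment> \<open>This functional kills \<open>x\<close> for every \<open>a\<close>, because
      \<open>x k = 0\<close>. The images for \<open>a = 0\<close> and \<open>a = 1\<close> both kill
      \<open>x'\<close>, and their difference isolates \<open>x' k\<close>.\<close>
    define g where "g a = (\<lambda>l. unit i l + (a * unit k l + (- x i / x m) * unit m l))" for a
    have dg: "dot (\<lambda>l. unit i l + (a * unit k l + b * unit m l)) z = z i + (a * z k + b * z m)" for a b z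
      unfolding dot_simps using i k other by (simp add: dot_unit)
    have \<sigma>g: "(\<lambda>l. \<sigma> (g a l)) = (\<lambda>l. unit i l + (\<sigma> a * unit k l + \<sigma> (- x i / x m) * unit m l))" for a
      using \<open>m \<noteq> k\<close> other \<open>k \<noteq> i\<close> by (auto simp: g_def fun_eq_iff unit_def \<sigma>_0 \<sigma>_1)
    have 1: "x' i + (\<sigma> a * x' k + \<sigma> (- x i / x m) * x' m) = 0" for a
    proof -
      have g: "g a i = 1" "dot (g a) (unit i) = 1" "dot (\<lambda>l. \<sigma> (g a l)) (unit i) = 1"
        unfolding \<sigma>g unfolding g_def dg using other \<open>k \<noteq> i\<close> by simp_all
      have "dot (g a) x = 0" unfolding g_def dg using True other by simp
      then have "dot (\<lambda>l. \<sigma> (g a l)) x' = 0 \<or> f' i = 0"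
        using mult_eq_0_image[OF fx im g(2) image_row[of i "g a", OF i(1) g(1)] g(3)] i by (auto simp: dot_unit)
      then show ?thesis using f'x' unfolding \<sigma>g by (simp add: dg)
    qed
    have "x' k = (x' i + (\<sigma> 1 * x' k + \<sigma> (- x i / x m) * x' m)) -
        (x' i + (\<sigma> 0 * x' k + \<sigma> (- x i / x m) * x' m))"
      by (simp add: \<sigma>_0 \<sigma>_1)
    then have "x' k = 0" unfolding 1 by simp
    then show ?thesis using True \<sigma>_0 by simp
  qed
qed (use i \<sigma>_nonzero in simp)

lemma image_kernel:
  assumes fx: "dot f x = 1" and im: "\<psi> (outer x f) = outer x' f'" "dot f' x' = 1"
    and i: "i < n" "f i \<noteq> 0" "x i \<noteq> 0" and other: "m < n" "m \<noteq> i" "f m \<noteq> 0" and k: "k < n"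
  shows "f' k = f' i / \<sigma> (f i) * \<sigma> (f k)"
proof (cases "k = i")
  case False
  have f'x': "f' i \<noteq> 0" "x' i \<noteq> 0" using image_diag[OF fx im i(1)] i by auto
  show ?thesis
  proof (cases "f k = 0")
    case False
    have "f' i = - \<tau> k i (- f i / f k) * f' k"
      using image_col_test[OF fx im k i(1), of "- f i / f k"] \<open>k \<noteq> i\<close> False f'x' i by auto
    then show ?thesis using \<tau>_eq[of k i] i k \<open>k \<noteq> i\<close> False \<sigma>_nonzero
      by (simp add: \<sigma>_divide \<sigma>_minus field_simps)
  next
    case True
    then have "m \<noteq> k" using other by auto
    define g where "g a = (\<lambda>l. unit i l + (a * unit k l + (- f i / f m) * unit m l))" for a
    have dg: "dot z (\<lambda>l. unit i l + (a * unit k l + b * unit m l)) = z i + (a * z k + b * z m)" for a b z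
      unfolding dot_simps using i k other by (simp add: dot_unit)
    have \<sigma>g: "(\<lambda>l. \<sigma> (g a l)) = (\<lambda>l. unit i l + (\<sigma> a * unit k l + \<sigma> (- f i / f m) * unit m l))" for a
      using \<open>m \<noteq> k\<close> other \<open>k \<noteq> i\<close> by (auto simp: g_def fun_eq_iff unit_def \<sigma>_0 \<sigma>_1)
    have 1: "f' i + (\<sigma> a * f' k + \<sigma> (- f i / f m) * f' m) = 0" for a
    proof -
      have g: "g a i = 1" "dot (unit i) (g a) = 1" "dot (unit i) (\<lambda>l. \<sigma> (g a l)) = 1"
        unfolding \<sigma>g unfolding g_def dg using other \<open>k \<noteq> i\<close> by simp_all
      have "dot f (g a) = 0" unfolding g_def dg using True other by simp
      then have "dot f' (\<lambda>l. \<sigma> (g a l)) = 0 \<or> x' i = 0"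
        using mult_eq_0_image[OF fx im g(2) image_col[of i "g a", OF i(1) g(1)] g(3)] i by (auto simp: dot_unit)
      then show ?thesis using f'x' unfolding \<sigma>g by (simp add: dg)
    qed
    have "f' k = (f' i + (\<sigma> 1 * f' k + \<sigma> (- f i / f m) * f' m)) -
        (f' i + (\<sigma> 0 * f' k + \<sigma> (- f i / f m) * f' m))"
      by (simp add: \<sigma>_0 \<sigma>_1)
    then have "f' k = 0" unfolding 1 by simp
    then show ?thesis using True \<sigma>_0 by simp
  qed
qed (use i \<sigma>_nonzero in simp)

lemma dot_\<sigma>: "dot (\<lambda>k. \<sigma> (f k)) (\<lambda>k. \<sigma> (x k)) = \<sigma> (dot f x)"
proof -
  interpret field_hom \<sigma> by (rule field_hom_endomorphism[OF \<sigma>_endomorphism])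
  show ?thesis by (simp add: dot_def hom_distribs)
qed

text \<open>If \<open>x\<close> or \<open>f\<close> is supported at the single index
  \<open>i\<close>, the idempotent is a row or a column up to scaling. Otherwise range and kernel
  are determined separately up to factors \<open>c\<close> and \<open>d\<close>, and the
  normalization \<open>dot f' x' = 1\<close> forces \<open>d * c = 1\<close>.\<close>

lemma image_outer:
  assumes fx: "dot f x = 1"
  shows "\<psi> (outer x f) = outer (\<lambda>k. \<sigma> (x k)) (\<lambda>k. \<sigma> (f k))"
proof -
  obtain x' f' where im: "\<psi> (outer x f) = outer x' f'" "dot f' x' = 1"
    using psi_simps(1)[OF rank_oneI[OF fx] rank_oneI[OF fx]] by (metis rank_oneE)
  have "\<exists>i<n. f i * x i \<noteq> 0"
    using fx unfolding dot_def by (metis (mono_tags, lifting) lessThan_iff sum.neutral zero_neq_one)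
  then obtain i where i: "i < n" "f i \<noteq> 0" "x i \<noteq> 0" by auto
  consider "\<forall>m<n. m \<noteq> i \<longrightarrow> x m = 0" | "\<forall>m<n. m \<noteq> i \<longrightarrow> f m = 0" |
    m m' where "m < n" "m \<noteq> i" "x m \<noteq> 0" "m' < n" "m' \<noteq> i" "f m' \<noteq> 0" by blast
  then show ?thesis
  proof cases
    case 1
    have "dot f x = dot f (\<lambda>k. x i * unit i k)" using 1 by (intro dot_cong) (auto simp: unit_def)
    then have "x i * f i = 1" using fx i unfolding dot_simps by (simp add: dot_unit)
    moreover have "outer x f = outer (unit i) (\<lambda>k. x i * f k)"
      using 1 by (auto intro!: eq_matI simp: unit_def)
    moreover have "outer (\<lambda>k. \<sigma> (x k)) (\<lambda>k. \<sigma> (f k)) = outer (unit i) (\<lambda>k. \<sigma> (x i * f k))"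
      using 1 by (auto intro!: eq_matI simp: unit_def \<sigma>_0 \<sigma>_mult)
    ultimately show ?thesis using image_row[OF i(1), of "\<lambda>k. x i * f k"] by simp
  next
    case 2
    have "dot f x = dot (\<lambda>k. f i * unit i k) x" using 2 by (intro dot_cong) (auto simp: unit_def)
    then have "f i * x i = 1" using fx i unfolding dot_simps by (simp add: dot_unit)
    moreover have "outer x f = outer (\<lambda>k. f i * x k) (unit i)"
      using 2 by (auto intro!: eq_matI simp: unit_def)
    moreover have "outer (\<lambda>k. \<sigma> (x k)) (\<lambda>k. \<sigma> (f k)) = outer (\<lambda>k. \<sigma> (f i * x k)) (unit i)"
      using 2 by (auto intro!: eq_matI simp: unit_def \<sigma>_0 \<sigma>_mult)
    ultimately show ?thesis using image_col[OF i(1), of "\<lambda>k. f i * x k"] by simp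
  next
    case 3
    define c d where "c = x' i / \<sigma> (x i)" and "d = f' i / \<sigma> (f i)"
    have x': "x' k = c * \<sigma> (x k)" and f': "f' k = d * \<sigma> (f k)" if "k < n" for k
      using image_range[OF fx im i 3(1-3) that] image_kernel[OF fx im i 3(4-6) that] by (simp_all add: c_def d_def)
    have "dot f' x' = dot (\<lambda>k. d * \<sigma> (f k)) (\<lambda>k. c * \<sigma> (x k))" using x' f' by (intro dot_cong)
    then have "d * c = 1" using im fx unfolding dot_simps dot_\<sigma> by (simp add: \<sigma>_1)
    then have "(c * \<sigma> (x k)) * (d * \<sigma> (f l)) = \<sigma> (x k) * \<sigma> (f l)" for k l
      by (metis (no_types, lifting) mult.assoc mult.commute mult.left_neutral)
    then show ?thesis using x' f' unfolding im by (auto intro!: eq_matI)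
  qed
qed

lemma image_map_mat: "P \<in> rank_one \<Longrightarrow> \<psi> P = map_mat \<sigma> P"
  by (auto elim!: rank_oneE simp: image_outer \<sigma>_mult intro!: eq_matI)

end

context dim3
begin

text \<open>Whether ranges and kernels are exchanged is decided by the pair \<open>E 0\<close>,
  \<open>row_elem 0 1 1\<close>: their images still share a range or else a kernel. In the second
  case the transposed map satisfies the assumption of the first.\<close>

theorem local_orth_auto_semilinear:
  assumes \<psi>: "local_orth_auto \<psi>"
  obtains S S' \<sigma> where "inverse_pair S S'" "nonzero_field_endomorphism \<sigma>"
    "(\<forall>P\<in>rank_one. \<psi> P = S * map_mat \<sigma> P * S') \<or>
      (\<forall>P\<in>rank_one. transpose_mat (\<psi> P) = S * map_mat \<sigma> P * S')"
proof -
  have row_case: "\<exists>S S' \<sigma>. inverse_pair S S' \<and> nonzero_field_endomorphism \<sigma> \<and>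
      (\<forall>P\<in>rank_one. \<psi> P = S * map_mat \<sigma> P * S')"
    if \<psi>: "local_orth_auto \<psi>" and row: "\<psi> (E 0) * \<psi> (row_elem 0 1 1) = \<psi> (row_elem 0 1 1)" for \<psi>
  proof -
    obtain S S' where S: "inverse_pair S S'" "normalized (\<lambda>P. S' * \<psi> P * S)"
      using normalize[OF \<psi> row] .
    interpret normalized_map n "\<lambda>P. S' * \<psi> P * S" by unfold_locales (rule S)
    have "\<psi> P = S * map_mat \<sigma> P * S'" if P: "P \<in> rank_one" for P
      using image_map_mat[OF P] conj_conj[OF inverse_pair_sym[OF S(1)] rank_one_carrier[OF local_orth_autoD(1)[OF \<psi> P P]]]
      by simp
    then show ?thesis using S(1) \<sigma>_endomorphism by blast
  qed
  note D = local_orth_autoD[OF \<psi>]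
  have n: "0 < n" "1 < n" using n3 by auto
  have Q: "row 0 (row_elem 0 1 1)" "row_elem 0 1 1 \<noteq> E 0"
    using row_elem row_elem_ne(1)[of 0 1 1] n by auto
  note R = E_rank_one[OF n(1)] row_rank_one[OF n(1) Q(1)]
  have "\<psi> (E 0) * \<psi> (row_elem 0 1 1) = \<psi> (row_elem 0 1 1) \<or> \<psi> (E 0) * \<psi> (row_elem 0 1 1) = \<psi> (E 0)"
    using D(4)[OF R] Q row_iff[OF R(2) n(1)] by auto
  then show ?thesis
  proof
    assume "\<psi> (E 0) * \<psi> (row_elem 0 1 1) = \<psi> (row_elem 0 1 1)"
    from row_case[OF \<psi> this] show ?thesis using that by blast
  next
    assume eq: "\<psi> (E 0) * \<psi> (row_elem 0 1 1) = \<psi> (E 0)"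
    obtain x f where xf: "\<psi> (E 0) = outer x f" "dot f x = 1" using D(1)[OF R(1) R(1)] by (rule rank_oneE)
    obtain y g where yg: "\<psi> (row_elem 0 1 1) = outer y g" "dot g y = 1" using D(1)[OF R(2) R(2)] by (rule rank_oneE)
    obtain c where c: "\<forall>i<n. f i = c * g i" using same_kernel_iff[OF xf(2) yg(2)] eq xf yg by auto
    have "outer f x * outer g y = outer g y"
    proof -
      have "c \<noteq> 0" using c xf(2) dot_cong[of f "\<lambda>i. c * g i" x x] by (auto simp: dot_simps)
      then have "\<forall>i<n. g i = (1 / c) * f i" using c by auto
      then show ?thesis using same_range_iff[of x f y g] xf(2) yg(2) dot_commute by metis
    qed
    then have "(transpose_mat \<circ> \<psi>) (E 0) * (transpose_mat \<circ> \<psi>) (row_elem 0 1 1) = (transpose_mat \<circ> \<psi>) (row_elem 0 1 1)"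
      unfolding comp_def xf yg transpose_outer .
    from row_case[OF local_orth_auto_comp[OF orth_auto_transpose \<psi>] this] show ?thesis
      using that by auto
  qed
qed

section \<open>The special linear group and its reflections\<close>

abbreviation G :: "complex mat set" where "G \<equiv> carrier (SL n)"

lemma carrier_GL_iff: "A \<in> carrier (GL n) \<longleftrightarrow> (\<exists>A'. inverse_pair A A')"
  unfolding GL_def inverse_pair_def by (auto simp: units_of_def Units_def ring_mat_simps)

lemma inv_GL:
  assumes "inverse_pair A A'" shows "inv\<^bsub>GL n\<^esub> A = A'"
proof -
  interpret group "GL n" by (rule group_GL)
  have "A \<in> carrier (GL n)" "A' \<in> carrier (GL n)"
    using assms inverse_pair_sym carrier_GL_iff by blast+
  then show ?thesis using assms
    by (intro inv_equality) (auto simp: mult_GL one_GL inverse_pair_def)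
qed

lemma inverse_pair_det: "inverse_pair A A' \<Longrightarrow> det A * det A' = 1"
  using det_mult[of A n A'] by (auto simp: inverse_pair_def)

lemma G_iff: "A \<in> G \<longleftrightarrow> A \<in> carrier_mat n n \<and> det A = 1"
proof
  assume "A \<in> G"
  then show "A \<in> carrier_mat n n \<and> det A = 1"
    using carrier_GL_subset by (auto simp: SL_def)
next
  assume A: "A \<in> carrier_mat n n \<and> det A = 1"
  then have "A \<in> Units (ring_mat TYPE(complex) n ())" by (intro det_non_zero_imp_unit) auto
  then show "A \<in> G" using A by (simp add: SL_def GL_def units_of_def)
qed

definition mi :: "complex mat \<Rightarrow> complex mat" where "mi A = inv\<^bsub>GL n\<^esub> A"

lemma mi: "inverse_pair A A' \<Longrightarrow> mi A = A'"
  by (simp add: mi_def inv_GL)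

lemma G_inverse_pair: "A \<in> G \<Longrightarrow> inverse_pair A (mi A)"
  using mi carrier_GL_iff by (auto simp: SL_def)

lemma mi_G: "A \<in> G \<Longrightarrow> mi A \<in> G"
  using G_inverse_pair[of A] inverse_pair_det[of A "mi A"] by (auto simp: G_iff inverse_pair_def)

lemma G_carrier: "A \<in> G \<Longrightarrow> A \<in> carrier_mat n n" by (simp add: G_iff)

lemma mult_G: "A \<in> G \<Longrightarrow> B \<in> G \<Longrightarrow> A * B \<in> G"
  by (auto simp: G_iff det_mult[of _ n])

lemma one_G: "1\<^sub>m n \<in> G" by (simp add: G_iff)

lemma conj_G:
  assumes "inverse_pair S S'" "A \<in> G" shows "S * A * S' \<in> G"
  using assms inverse_pair_det[OF assms(1)]
  by (auto simp: G_iff inverse_pair_def det_mult[of _ n] mult.commute)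

section \<open>Standard automorphisms: conjugation, contragredient and entrywise field
  automorphisms\<close>

definition sl_aut :: "(complex mat \<Rightarrow> complex mat) \<Rightarrow> bool" where
  "sl_aut f \<longleftrightarrow> bij_betw f G G \<and> (\<forall>A\<in>G. \<forall>B\<in>G. f (A * B) = f A * f B)"

lemma sl_aut_iff: "sl_aut f \<longleftrightarrow> f \<in> iso (SL n) (SL n)"
proof -
  have m: "A \<otimes>\<^bsub>SL n\<^esub> B = A * B" for A B by (simp add: SL_def mult_GL)
  show ?thesis by (auto simp: sl_aut_def iso_def hom_def m dest: bij_betwE)
qed

lemma sl_autD:
  assumes "sl_aut f"
  shows "A \<in> G \<Longrightarrow> f A \<in> G" "A \<in> G \<Longrightarrow> B \<in> G \<Longrightarrow> f (A * B) = f A * f B"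
    "A \<in> G \<Longrightarrow> B \<in> G \<Longrightarrow> f A = f B \<longleftrightarrow> A = B" "C \<in> G \<Longrightarrow> \<exists>A\<in>G. C = f A" "f (1\<^sub>m n) = 1\<^sub>m n"
    "A \<in> G \<Longrightarrow> f (mi A) = mi (f A)"
proof -
  have b: "bij_betw f G G" and m: "\<And>A B. A \<in> G \<Longrightarrow> B \<in> G \<Longrightarrow> f (A * B) = f A * f B"
    using assms by (auto simp: sl_aut_def)
  show fG: "f A \<in> G" if "A \<in> G" for A using b that by (auto dest: bij_betwE)
  show "A \<in> G \<Longrightarrow> B \<in> G \<Longrightarrow> f (A * B) = f A * f B" by (rule m)
  show "A \<in> G \<Longrightarrow> B \<in> G \<Longrightarrow> f A = f B \<longleftrightarrow> A = B" using b by (auto simp: bij_betw_def inj_on_eq_iff)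
  show "C \<in> G \<Longrightarrow> \<exists>A\<in>G. C = f A" using b by (auto simp: bij_betw_def)
  have "f (1\<^sub>m n) * f (1\<^sub>m n) = f (1\<^sub>m n)" using m[OF one_G one_G] by simp
  then have "mi (f (1\<^sub>m n)) * (f (1\<^sub>m n) * f (1\<^sub>m n)) = mi (f (1\<^sub>m n)) * f (1\<^sub>m n)" by simp
  then show one: "f (1\<^sub>m n) = 1\<^sub>m n"
    using inverse_pair_cancel(2)[OF G_inverse_pair[OF fG[OF one_G]] G_carrier[OF fG[OF one_G]]]
      G_inverse_pair[OF fG[OF one_G]] by (simp add: inverse_pair_def)
  assume A: "A \<in> G"
  have "f A * f (mi A) = 1\<^sub>m n" "f (mi A) * f A = 1\<^sub>m n"
    using m[OF A mi_G[OF A]] m[OF mi_G[OF A] A] G_inverse_pair[OF A] one by (auto simp: inverse_pair_def)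
  then have "inverse_pair (f A) (f (mi A))"
    using A by (auto simp: inverse_pair_def intro!: G_carrier fG mi_G)
  then show "f (mi A) = mi (f A)" using mi by simp
qed

lemma sl_aut_comp: "sl_aut f \<Longrightarrow> sl_aut g \<Longrightarrow> sl_aut (f \<circ> g)"
  unfolding sl_aut_def using bij_betw_trans[of g G G f G] by (auto dest: bij_betwE)

lemma sl_aut_conj:
  assumes S: "inverse_pair S S'" shows "sl_aut (\<lambda>A. S * A * S')"
  unfolding sl_aut_def
proof
  show "bij_betw (\<lambda>A. S * A * S') G G"
    by (rule bij_betwI[where g = "\<lambda>A. S' * A * S"])
      (auto simp: S conj_conj inverse_pair_sym G_carrier intro!: conj_G)
qed (simp add: conj_mult[OF S] G_carrier)

definition ct :: "complex mat \<Rightarrow> complex mat" where "ct A = transpose_mat (mi A)"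

lemma inverse_pair_transpose: "inverse_pair A A' \<Longrightarrow> inverse_pair (transpose_mat A') (transpose_mat A)"
proof -
  assume A: "inverse_pair A A'"
  then have "transpose_mat A' * transpose_mat A = transpose_mat (A * A')"
    "transpose_mat A * transpose_mat A' = transpose_mat (A' * A)"
    using transpose_mult unfolding inverse_pair_def by metis+
  then show ?thesis using A by (simp add: inverse_pair_def)
qed

lemma inverse_pair_mult:
  assumes "inverse_pair A A'" "inverse_pair B B'" shows "inverse_pair (A * B) (B' * A')"
  using assms[unfolded inverse_pair_def]
  by (auto simp: inverse_pair_def mat_assoc inverse_pair_cancel[OF assms(1)] inverse_pair_cancel[OF assms(2)])

lemma ct_mult:
  assumes "inverse_pair A A'" "inverse_pair B B'" shows "ct (A * B) = ct A * ct B"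
  using assms transpose_mult[of B' n n A' n]
  by (simp add: ct_def mi[OF assms(1)] mi[OF assms(2)] mi[OF inverse_pair_mult[OF assms]] inverse_pair_def)

lemma ct_inverse_pair:
  assumes "inverse_pair A A'" shows "ct A = transpose_mat A'" "inverse_pair (ct A) (transpose_mat A)" "ct (ct A) = A"
proof -
  show *: "ct A = transpose_mat A'" by (simp add: ct_def mi[OF assms])
  show **: "inverse_pair (ct A) (transpose_mat A)" unfolding * by (rule inverse_pair_transpose[OF assms])
  show "ct (ct A) = A" using mi[OF **] by (simp add: ct_def[of "ct A"])
qed

lemma ct_G: "A \<in> G \<Longrightarrow> ct A \<in> G"
  using mi_G[of A] by (auto simp: ct_def G_iff det_transpose[of _ n])

lemma sl_aut_ct: "sl_aut ct"
  unfolding sl_aut_def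
proof
  show "bij_betw ct G G"
    by (rule bij_betwI[where g = ct]) (auto simp: ct_G ct_inverse_pair(3)[OF G_inverse_pair])
qed (auto intro!: ct_mult G_inverse_pair)

lemma map_mat_inverse_pair:
  assumes \<sigma>: "nonzero_field_endomorphism \<sigma>" and "inverse_pair A A'"
  shows "inverse_pair (map_mat \<sigma> A) (map_mat \<sigma> A')"
proof -
  interpret field_hom \<sigma> by (rule field_hom_endomorphism[OF \<sigma>])
  have "map_mat \<sigma> A * map_mat \<sigma> A' = map_mat \<sigma> (A * A')" "map_mat \<sigma> A' * map_mat \<sigma> A = map_mat \<sigma> (A' * A)"
    using assms(2) mat_hom_mult unfolding inverse_pair_def by metis+
  then show ?thesis using assms(2) by (simp add: inverse_pair_def mat_hom_one)
qed

lemma map_mat_G: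
  assumes \<sigma>: "nonzero_field_endomorphism \<sigma>" and "A \<in> G"
  shows "map_mat \<sigma> A \<in> G"
proof -
  interpret field_hom \<sigma> by (rule field_hom_endomorphism[OF \<sigma>])
  show ?thesis using assms(2) by (auto simp: G_iff)
qed

lemma map_mat_mult:
  assumes \<sigma>: "nonzero_field_endomorphism \<sigma>" and "A \<in> carrier_mat n n" "B \<in> carrier_mat n n"
  shows "map_mat \<sigma> (A * B) = map_mat \<sigma> A * map_mat \<sigma> B"
proof -
  interpret field_hom \<sigma> by (rule field_hom_endomorphism[OF \<sigma>])
  show ?thesis using mat_hom_mult assms by blast
qed

lemma sl_aut_map_mat:
  assumes "field_automorphism \<tau>" shows "sl_aut (map_mat \<tau>)"
  unfolding sl_aut_def
proof
  note e = field_automorphism_endomorphism[OF assms]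
  note e' = field_automorphism_endomorphism[OF field_automorphism_inv[OF assms]]
  have b: "bij \<tau>" using assms by (simp add: field_automorphism_def)
  have "map_mat (inv_into UNIV \<tau>) (map_mat \<tau> A) = A" "map_mat \<tau> (map_mat (inv_into UNIV \<tau>) A) = A" for A
    using b by (auto intro!: eq_matI simp: bij_is_inj bij_is_surj surj_f_inv_f)
  then show "bij_betw (map_mat \<tau>) G G"
    by (intro bij_betwI[where g = "map_mat (inv_into UNIV \<tau>)"]) (auto intro: map_mat_G[OF e] map_mat_G[OF e'])
  show "\<forall>A\<in>G. \<forall>B\<in>G. map_mat \<tau> (A * B) = map_mat \<tau> A * map_mat \<tau> B"
    using map_mat_mult[OF e] G_carrier by blast
qed

section \<open>Matrices of the form \<open>a + b P\<close> with \<open>P\<close> idempotent\<close>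

definition comb :: "complex \<Rightarrow> complex \<Rightarrow> complex mat \<Rightarrow> complex mat" where
  "comb a b P = a \<cdot>\<^sub>m 1\<^sub>m n + b \<cdot>\<^sub>m P"

lemma comb_carrier [simp]: "P \<in> carrier_mat n n \<Longrightarrow> comb a b P \<in> carrier_mat n n"
  by (simp add: comb_def)

lemma comb_index: "P \<in> carrier_mat n n \<Longrightarrow> i < n \<Longrightarrow> j < n \<Longrightarrow>
    comb a b P $$ (i, j) = a * of_bool (i = j) + b * P $$ (i, j)"
  by (auto simp: comb_def)

lemma comb_mult:
  assumes "P \<in> carrier_mat n n" "Q \<in> carrier_mat n n"
  shows "comb a b P * comb c d Q = (a * c) \<cdot>\<^sub>m 1\<^sub>m n + (a * d) \<cdot>\<^sub>m Q + (b * c) \<cdot>\<^sub>m P + (b * d) \<cdot>\<^sub>m (P * Q)"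
proof -
  have "comb a b P * comb c d Q = comb a b P * (c \<cdot>\<^sub>m 1\<^sub>m n) + comb a b P * (d \<cdot>\<^sub>m Q)"
    unfolding comb_def[of c] using assms by (intro mult_add_distrib_mat[of _ n n _ n]) auto
  also have "comb a b P * (c \<cdot>\<^sub>m 1\<^sub>m n) = c \<cdot>\<^sub>m comb a b P" using assms right_mult_one_mat[OF comb_carrier[OF assms(1)]]
    by (simp add: mult_smult_distrib[of _ n n _ n])
  also have "comb a b P * (d \<cdot>\<^sub>m Q) = (a \<cdot>\<^sub>m 1\<^sub>m n) * (d \<cdot>\<^sub>m Q) + (b \<cdot>\<^sub>m P) * (d \<cdot>\<^sub>m Q)"
    unfolding comb_def using assms by (intro add_mult_distrib_mat[of _ n n _ _ n]) auto
  also have "(a \<cdot>\<^sub>m 1\<^sub>m n) * (d \<cdot>\<^sub>m Q) = (a * d) \<cdot>\<^sub>m Q"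
    using assms by (simp add: mult_smult_distrib[of _ n n _ n] mult_smult_assoc_mat[of _ n n _ n])
      (auto intro!: eq_matI)
  also have "(b \<cdot>\<^sub>m P) * (d \<cdot>\<^sub>m Q) = (b * d) \<cdot>\<^sub>m (P * Q)"
    using assms by (simp add: mult_smult_distrib[of _ n n _ n] mult_smult_assoc_mat[of _ n n _ n])
      (auto intro!: eq_matI)
  finally show ?thesis using assms
    by (auto intro!: eq_matI simp: comb_def algebra_simps simp del: index_mult_mat(1))
qed

lemma comb_mult_idem:
  assumes "P \<in> carrier_mat n n" "P * P = P"
  shows "comb a b P * comb c d P = comb (a * c) (a * d + b * c + b * d) P"
  unfolding comb_mult[OF assms(1,1)] assms(2) using assms(1)
  by (auto intro!: eq_matI simp: comb_def algebra_simps)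

lemma conj_comb:
  assumes "inverse_pair S S'" "P \<in> carrier_mat n n"
  shows "S * comb a b P * S' = comb a b (S * P * S')"
proof -
  have c: "S \<in> carrier_mat n n" "S' \<in> carrier_mat n n" "S * S' = 1\<^sub>m n" using assms by (auto simp: inverse_pair_def)
  have "S * comb a b P = S * (a \<cdot>\<^sub>m 1\<^sub>m n) + S * (b \<cdot>\<^sub>m P)"
    unfolding comb_def using assms c by (intro mult_add_distrib_mat[of _ n n _ n]) auto
  also have "\<dots> = a \<cdot>\<^sub>m S + b \<cdot>\<^sub>m (S * P)" using assms c by (simp add: mult_smult_distrib[of _ n n _ n])
  also have "\<dots> * S' = (a \<cdot>\<^sub>m S) * S' + (b \<cdot>\<^sub>m (S * P)) * S'"
    using assms c by (intro add_mult_distrib_mat[of _ n n _ _ n]) auto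
  also have "\<dots> = comb a b (S * P * S')"
    using assms c by (simp add: comb_def mult_smult_assoc_mat[of _ n n _ n])
  finally show ?thesis .
qed

lemma conj_to_E0:
  assumes "P \<in> rank_one"
  obtains S S' where "inverse_pair S S'" "P = S * E 0 * S'"
proof -
  obtain x f where xf: "P = outer x f" "dot f x = 1" using assms by (rule rank_oneE)
  have "biorth 1 (\<lambda>_. x) (\<lambda>_. f)" using xf by (simp add: biorth_def)
  then obtain x' f' where b: "biorth n x' f'" "\<And>i. i < 1 \<Longrightarrow> x' i = x" "\<And>i. i < 1 \<Longrightarrow> f' i = f"
    using biorth_extend[of 1 "\<lambda>_. x" "\<lambda>_. f"] n3 by auto
  obtain S S' where "inverse_pair S S'" "\<And>i. i < n \<Longrightarrow> S * E i * S' = outer (x' i) (f' i)"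
    using biorth_matrices[OF b(1)] by metis
  then show ?thesis using that b n3 xf by (metis (no_types, lifting) less_numeral_extra(1) less_le_trans zero_less_numeral)
qed

lemma conj_pair:
  assumes P: "P \<in> rank_one" "Q \<in> rank_one" "orth P Q"
  obtains S S' where "inverse_pair S S'" "P = S * E 0 * S'" "Q = S * E 1 * S'"
proof -
  obtain x f where xf: "P = outer x f" "dot f x = 1" using P(1) by (rule rank_oneE)
  obtain y g where yg: "Q = outer y g" "dot g y = 1" using P(2) by (rule rank_oneE)
  define X where "X = (\<lambda>i::nat. if i = 0 then x else y)"
  define F where "F = (\<lambda>i::nat. if i = 0 then f else g)"
  have "dot f y = 0" "dot g x = 0" using P(3) xf yg by (auto simp: orth_outer)
  then have "biorth 2 X F" using xf yg by (auto simp: biorth_def X_def F_def less_2_cases_iff)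
  then obtain x' f' where b: "biorth n x' f'" "\<And>i. i < 2 \<Longrightarrow> x' i = X i" "\<And>i. i < 2 \<Longrightarrow> f' i = F i"
    using biorth_extend[of 2 X F] n3 by auto
  obtain S S' where S: "inverse_pair S S'" "\<And>i. i < n \<Longrightarrow> S * E i * S' = outer (x' i) (f' i)"
    using biorth_matrices[OF b(1)] by metis
  show ?thesis using that[OF S(1)] S(2)[of 0] S(2)[of 1] b(2,3)[of 0] b(2,3)[of 1] n3 xf yg by (simp add: X_def F_def)
qed

lemma det_comb:
  assumes "P \<in> rank_one"
  shows "det (comb a b P) = a ^ (n - 1) * (a + b)"
proof -
  obtain S S' where S: "inverse_pair S S'" "P = S * E 0 * S'" using conj_to_E0[OF assms] .
  have "comb a b P = S * comb a b (E 0) * S'" using conj_comb[OF S(1)] S(2) by simp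
  then have "det (comb a b P) = det (comb a b (E 0))"
    using inverse_pair_det[OF S(1)] S(1) by (auto simp: inverse_pair_def det_mult[of _ n] mult.commute)
  also have "\<dots> = (\<Prod>i<n. comb a b (E 0) $$ (i, i))"
  proof -
    have "upper_triangular (comb a b (E 0))" by (auto simp: upper_triangular_def comb_index comb_def unit_def)
    then show ?thesis
      by (subst det_upper_triangular[of _ n]) (auto simp: prod_list_diag_prod comb_def atLeast0LessThan)
  qed
  also have "\<dots> = (\<Prod>i\<in>insert 0 {1..<n}. comb a b (E 0) $$ (i, i))"
    using n3 by (intro prod.cong) auto
  also have "\<dots> = (a + b) * (\<Prod>i\<in>{1..<n}. a)"
    using n3 by (subst prod.insert) (auto simp: comb_index unit_def intro!: prod.cong)
  finally show ?thesis by (simp add: mult.commute)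
qed

text \<open>A nonzero vector killed by both functionals is an eigenvector of both sides, with
  eigenvalues \<open>a\<close> and \<open>c\<close>. After cancelling these,
  \<open>b P = d Q\<close>, and squaring separates the scalar from the idempotent.\<close>

lemma comb_eq_iff:
  assumes "P \<in> rank_one" "Q \<in> rank_one" "b \<noteq> 0" "comb a b P = comb c d Q"
  shows "a = c" "b = d" "P = Q"
proof -
  obtain x f where xf: "P = outer x f" "dot f x = 1" using assms(1) by (rule rank_oneE)
  obtain y g where yg: "Q = outer y g" "dot g y = 1" using assms(2) by (rule rank_oneE)
  have ap: "apply_mat (comb a b (outer x f)) z i = a * z i + b * x i * dot f z" if "i < n" for a b x f z i
    using that unfolding apply_mat_def
    by (simp add: comb_index dot_def distrib_right sum.distrib sum_distrib_left mult.assoc of_bool_def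
        if_distrib[of "\<lambda>c. _ * c"] if_distrib[of "\<lambda>c. c * _"] cong: if_cong)
  have eq: "a * z i + b * x i * dot f z = c * z i + d * y i * dot g z" if "i < n" for i z
    using assms(4) ap[OF that, of a b x f z] ap[OF that, of c d y g z] xf yg by simp
  obtain z where z: "\<exists>i<n. z i \<noteq> 0" "dot f z = 0" "dot g z = 0" using common_kernel[OF xf(2)] .
  show ac: "a = c" using eq[of _ z] z by auto
  then have eq': "b * x i * dot f z = d * y i * dot g z" if "i < n" for i z using eq[OF that, of z] by simp
  have 1: "b \<cdot>\<^sub>m P = d \<cdot>\<^sub>m Q"
  proof (rule eq_matI)
    fix i j assume "i < dim_row (d \<cdot>\<^sub>m Q)" "j < dim_col (d \<cdot>\<^sub>m Q)"
    then have ij: "i < n" "j < n" using yg by auto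
    show "(b \<cdot>\<^sub>m P) $$ (i, j) = (d \<cdot>\<^sub>m Q) $$ (i, j)"
      using eq'[OF ij(1), of "unit j"] ij by (simp add: xf yg dot_unit mult.assoc)
  qed (auto simp: xf yg)
  have "b \<cdot>\<^sub>m (b \<cdot>\<^sub>m P) = (b \<cdot>\<^sub>m P) * (b \<cdot>\<^sub>m P)" "d \<cdot>\<^sub>m (d \<cdot>\<^sub>m Q) = (d \<cdot>\<^sub>m Q) * (d \<cdot>\<^sub>m Q)"
    using assms(1,2) rank_one_idem rank_one_carrier
    by (auto simp: mult_smult_distrib[of _ n n _ n] mult_smult_assoc_mat[of _ n n _ n])
  then have 2: "b \<cdot>\<^sub>m (b \<cdot>\<^sub>m P) = d \<cdot>\<^sub>m (b \<cdot>\<^sub>m P)" using 1 by simp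
  obtain i j where ij: "i < n" "j < n" "P $$ (i, j) \<noteq> 0"
    using dot_nonzero[of f x] xf by auto
  then show bd: "b = d" using arg_cong[OF 2, of "\<lambda>M. M $$ (i, j)"] assms(3) xf by simp
  have "(1 / b) \<cdot>\<^sub>m (b \<cdot>\<^sub>m P) = P" "(1 / b) \<cdot>\<^sub>m (b \<cdot>\<^sub>m Q) = Q" using assms(3) by (auto intro!: eq_matI)
  then show "P = Q" using 1 bd by metis
qed

lemma comb_not_scalar:
  assumes "P \<in> rank_one" "b \<noteq> 0" shows "comb a b P \<noteq> c \<cdot>\<^sub>m 1\<^sub>m n"
proof
  assume "comb a b P = c \<cdot>\<^sub>m 1\<^sub>m n"
  then have "comb a b P = comb c 0 P" using rank_one_carrier[OF assms(1)] by (auto simp: comb_def intro!: eq_matI)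
  then show False using comb_eq_iff(2)[OF assms(1,1,2)] assms(2) by blast
qed

lemma comb_commute:
  assumes c: "P \<in> carrier_mat n n" "Q \<in> carrier_mat n n" and "P * Q = Q * P"
  shows "comb a b P * comb c d Q = comb c d Q * comb a b P"
  unfolding comb_mult[OF c] comb_mult[OF c(2,1)] assms(3) using c
  by (auto intro!: eq_matI simp: algebra_simps simp del: index_mult_mat(1))

lemma comb_commute_iff:
  assumes "P \<in> rank_one" "Q \<in> rank_one" "b \<noteq> 0" "d \<noteq> 0"
  shows "comb a b P * comb c d Q = comb c d Q * comb a b P \<longleftrightarrow> P * Q = Q * P"
proof -
  have c: "P \<in> carrier_mat n n" "Q \<in> carrier_mat n n" using assms rank_one_carrier by auto
  have PQ: "P * Q \<in> carrier_mat n n" "Q * P \<in> carrier_mat n n" using c by auto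
  show ?thesis
  proof
    assume eq: "comb a b P * comb c d Q = comb c d Q * comb a b P"
    have "(b * d) * (P * Q) $$ (i, j) = (b * d) * (Q * P) $$ (i, j)" if "i < n" "j < n" for i j
      using arg_cong[OF eq, of "\<lambda>M. M $$ (i, j)"] that c PQ unfolding comb_mult[OF c] comb_mult[OF c(2,1)]
      by (simp add: algebra_simps del: index_mult_mat(1))
    then show "P * Q = Q * P" using assms c by (intro eq_matI) auto
  next
    assume "P * Q = Q * P"
    then show "comb a b P * comb c d Q = comb c d Q * comb a b P"
      unfolding comb_mult[OF c] comb_mult[OF c(2,1)] using c
      by (auto intro!: eq_matI simp: algebra_simps simp del: index_mult_mat(1))
  qed
qed

text \<open>For commuting \<open>P\<close> and \<open>Q\<close> the product \<open>P * Q\<close>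
  equals \<open>P * Q * P\<close> and \<open>Q * P * Q\<close>, which are the same scalar multiple
  of \<open>P\<close> and of \<open>Q\<close>; so the scalar is zero or \<open>P = Q\<close>. This
  makes orthogonality visible in the group as commutation of reflections.\<close>

lemma rank_one_commute:
  assumes "P \<in> rank_one" "Q \<in> rank_one"
  shows "orth P Q \<longleftrightarrow> P \<noteq> Q \<and> P * Q = Q * P"
proof
  assume "orth P Q"
  then show "P \<noteq> Q \<and> P * Q = Q * P" using orth_ne[OF assms(1)] by (auto simp: orth_def)
next
  assume *: "P \<noteq> Q \<and> P * Q = Q * P"
  obtain x f where xf: "P = outer x f" "dot f x = 1" using assms(1) by (rule rank_oneE)
  obtain y g where yg: "Q = outer y g" "dot g y = 1" using assms(2) by (rule rank_oneE)
  show "orth P Q"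
  proof (cases "dot f y = 0 \<or> dot g x = 0")
    case True
    have "P * Q = 0\<^sub>m n n \<or> Q * P = 0\<^sub>m n n" using True xf yg by (auto simp: mult_outer_eq_0)
    then show ?thesis using * by (auto simp: orth_def)
  next
    case False
    have "P * Q * P = dot f y * dot g x \<cdot>\<^sub>m P"
      unfolding xf yg outer_mult by (auto simp: outer_mult mult_smult_assoc_mat[of _ n n _ n] intro!: eq_matI)
    moreover have "P * Q * Q = P * Q"
      using rank_one_idem[OF assms(2)] rank_one_carrier assms by (metis assoc_mult_mat)
    ultimately have PQP: "P * Q = (dot f y * dot g x) \<cdot>\<^sub>m P" 
      using * rank_one_idem[OF assms(1)] rank_one_carrier[OF assms(1)] rank_one_carrier[OF assms(2)]
      by (metis assoc_mult_mat)
    have "P * Q = (dot f y * dot g x) \<cdot>\<^sub>m Q"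
    proof -
      have "Q * P * Q = dot g x * dot f y \<cdot>\<^sub>m Q"
        unfolding xf yg outer_mult by (auto simp: outer_mult mult_smult_assoc_mat[of _ n n _ n] intro!: eq_matI)
      moreover have "Q * P * Q = P * Q"
        using * rank_one_idem[OF assms(2)] rank_one_carrier[OF assms(1)] rank_one_carrier[OF assms(2)]
        by (metis assoc_mult_mat)
      ultimately show ?thesis by (simp add: mult.commute)
    qed
    then have "(dot f y * dot g x) \<cdot>\<^sub>m P = (dot f y * dot g x) \<cdot>\<^sub>m Q" using PQP by simp
    then have "(dot f y * dot g x) * P $$ (i, j) = (dot f y * dot g x) * Q $$ (i, j)" if "i < n" "j < n" for i j
      using arg_cong[of _ _ "\<lambda>M. M $$ (i, j)"] that xf yg by (metis index_smult_mat(1) outer_carrier(2,3))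
    then have "P = Q" using False xf yg by (intro eq_matI) auto
    then show ?thesis using * by simp
  qed
qed

section \<open>Conjugacy and the characterization of reflections inside the group\<close>

definition similar :: "complex mat \<Rightarrow> complex mat \<Rightarrow> bool" where
  "similar A B \<longleftrightarrow> (\<exists>S S'. inverse_pair S S' \<and> B = S * A * S')"

lemma complex_root_exists:
  assumes "0 < k" obtains c :: complex where "c ^ k = d"
proof -
  obtain r a where d: "d = rcis r a" "0 \<le> r" using rcis_Ex[of d] by (metis norm_ge_zero rcis_cmod_Arg)
  have "rcis (root k r) (a / of_nat k) ^ k = d"
    using assms d by (simp add: DeMoivre2)
  then show ?thesis using that by blast
qed

text \<open>Multiplying \<open>S\<close> by a suitable root of \<open>1 / det S\<close> gives
  determinant one without changing the conjugation. Hence \<open>similar\<close> is invariant under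
  automorphisms of the special linear group.\<close>

lemma conj_by_G:
  assumes "inverse_pair S S'"
  obtains T where "T \<in> G" "\<And>A. A \<in> carrier_mat n n \<Longrightarrow> T * A * mi T = S * A * S'"
    "\<exists>c. c \<noteq> 0 \<and> T = c \<cdot>\<^sub>m S"
proof -
  have c: "S \<in> carrier_mat n n" "S' \<in> carrier_mat n n" using assms by (auto simp: inverse_pair_def)
  have d: "det S \<noteq> 0" using inverse_pair_det[OF assms] by auto
  obtain c where ck: "c ^ n = 1 / det S" using complex_root_exists[of n] n3 by auto
  then have c0: "c \<noteq> 0" using d n3 by (metis divide_eq_0_iff power_0_left zero_neq_one not_numeral_le_zero)
  have T: "inverse_pair (c \<cdot>\<^sub>m S) ((1 / c) \<cdot>\<^sub>m S')"
    using assms c0 c unfolding inverse_pair_def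
    by (auto simp: mult_smult_distrib[of _ n n _ n] mult_smult_assoc_mat[of _ n n _ n] intro!: eq_matI)
  show ?thesis
  proof (rule that)
    show "c \<cdot>\<^sub>m S \<in> G" using c ck d by (simp add: G_iff)
    show "c \<cdot>\<^sub>m S * A * mi (c \<cdot>\<^sub>m S) = S * A * S'" if "A \<in> carrier_mat n n" for A
    proof -
      have "c \<cdot>\<^sub>m S * A * ((1 / c) \<cdot>\<^sub>m S') = (1 / c) \<cdot>\<^sub>m (c \<cdot>\<^sub>m (S * A * S'))"
        using that c by (simp add: mult_smult_distrib[of _ n n _ n] mult_smult_assoc_mat[of _ n n _ n])
      also have "\<dots> = S * A * S'" using c0 c by (auto intro!: eq_matI simp del: index_mult_mat(1))
      finally show ?thesis using mi[OF T] by simp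
    qed
  qed (use c0 in blast)
qed

lemma similar_sl_aut:
  assumes f: "sl_aut f" and "A \<in> G" "similar A B"
  shows "similar (f A) (f B)"
proof -
  obtain S S' where S: "inverse_pair S S'" "B = S * A * S'" using assms by (auto simp: similar_def)
  obtain T where T: "T \<in> G" "T * A * mi T = B" using conj_by_G[OF S(1)] S(2) G_carrier[OF assms(2)] by metis
  have "f B = f T * f A * mi (f T)"
    using sl_autD(2,6)[OF f] T assms(2) mi_G[OF T(1)] mult_G by metis
  then show ?thesis unfolding similar_def using G_inverse_pair[OF sl_autD(1)[OF f T(1)]] by blast
qed

lemma similar_G: "A \<in> G \<Longrightarrow> similar A B \<Longrightarrow> B \<in> G"
  by (auto simp: similar_def intro: conj_G)

lemma similar_sl_aut_iff:
  assumes f: "sl_aut f" and "A \<in> G" "B \<in> G"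
  shows "similar (f A) (f B) \<longleftrightarrow> similar A B"
proof
  assume "similar (f A) (f B)"
  then obtain S S' where S: "inverse_pair S S'" "f B = S * f A * S'" by (auto simp: similar_def)
  have fA: "f A \<in> G" using sl_autD(1)[OF f assms(2)] .
  obtain T where T: "T \<in> G" "T * f A * mi T = f B" using conj_by_G[OF S(1)] S(2) G_carrier[OF fA] by metis
  obtain U where U: "U \<in> G" "T = f U" using sl_autD(4)[OF f T(1)] by blast
  have "f (U * A * mi U) = f B"
    using T(2) U(2) by (simp add: sl_autD(2,6)[OF f] assms(2) mi_G U(1) mult_G)
  then have "U * A * mi U = B" by (simp add: sl_autD(3)[OF f] assms mi_G U(1) mult_G)
  then show "similar A B" unfolding similar_def using G_inverse_pair[OF U(1)] by blast
qed (rule similar_sl_aut[OF f assms(2)])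

definition central :: "complex mat \<Rightarrow> bool" where
  "central A \<longleftrightarrow> (\<forall>B\<in>G. A * B = B * A)"

definition reflection_like :: "complex mat \<Rightarrow> bool" where
  "reflection_like A \<longleftrightarrow> A \<in> G \<and> \<not> central A \<and> central (A * A) \<and>
    (\<forall>B C. similar A B \<longrightarrow> similar A C \<longrightarrow> A * B = B * A \<longrightarrow> A * C = C * A \<longrightarrow> B \<noteq> A \<longrightarrow> C \<noteq> A \<longrightarrow>
      similar (A * B) (A * C))"

lemma central_sl_aut:
  assumes f: "sl_aut f" and A: "A \<in> G" shows "central (f A) \<longleftrightarrow> central A"
proof -
  note D = sl_autD[OF f]
  have "f A * f B = f B * f A \<longleftrightarrow> A * B = B * A" if "B \<in> G" for B
    using D(2)[OF A that] D(2)[OF that A] D(3)[OF mult_G[OF A that] mult_G[OF that A]] by simp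
  then show ?thesis unfolding central_def using D(1,4) by metis
qed

lemma reflection_like_sl_aut:
  assumes f: "sl_aut f" and A: "reflection_like A"
  shows "reflection_like (f A)"
proof -
  note D = sl_autD[OF f]
  have AG: "A \<in> G" using A by (simp add: reflection_like_def)
  have comm: "f A * f B = f B * f A \<longleftrightarrow> A * B = B * A" if "B \<in> G" for B
    using D(2)[OF AG that] D(2)[OF that AG] D(3)[OF mult_G[OF AG that] mult_G[OF that AG]] by simp
  have "similar (f A * B) (f A * C)" if BC: "similar (f A) B" "similar (f A) C" "f A * B = B * f A" "f A * C = C * f A"
    "B \<noteq> f A" "C \<noteq> f A" for B C
  proof -
    have "B \<in> G" "C \<in> G" using BC similar_G D(1)[OF AG] by blast+
    then obtain B' C' where B': "B' \<in> G" "B = f B'" and C': "C' \<in> G" "C = f C'" using D(4) by metis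
    have "similar A B'" "similar A C'" using BC similar_sl_aut_iff[OF f AG] B' C' by auto
    moreover have "A * B' = B' * A" "A * C' = C' * A" "B' \<noteq> A" "C' \<noteq> A" using BC comm B' C' by auto
    ultimately have "similar (A * B') (A * C')" using A unfolding reflection_like_def by blast
    then show ?thesis
      using similar_sl_aut_iff[OF f mult_G[OF AG B'(1)] mult_G[OF AG C'(1)]] D(2)[OF AG] B' C' by simp
  qed
  then show ?thesis
    using A D(1)[OF AG] central_sl_aut[OF f AG] central_sl_aut[OF f mult_G[OF AG AG]] D(2)[OF AG AG]
    unfolding reflection_like_def by auto
qed

text \<open>A transvection is a product of two reflections with the same range, so its determinant is one.\<close>

lemma transvection_G:
  assumes "dot f x = 0" shows "comb 1 1 (outer x f) \<in> G"
proof (cases "\<exists>i<n. x i \<noteq> 0")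
  case False
  then have "comb 1 1 (outer x f) = 1\<^sub>m n" by (auto simp: comb_def intro!: eq_matI)
  then show ?thesis by (simp add: one_G)
next
  case True
  then obtain i where i: "i < n" "x i \<noteq> 0" by blast
  define g where "g = (\<lambda>k. unit i k / x i)"
  have g: "dot g x = 1" unfolding g_def dot_simps using i by (simp add: dot_unit)
  \<comment> \<open>Expanding \<open>(1 - 2 x g) (1 - 2 x h)\<close> with \<open>dot g x = 1\<close>
    leaves \<open>1 + 2 x (h - g)\<close>, so \<open>h - g\<close> has to be half of
    \<open>f\<close>.\<close>
  define h where "h = (\<lambda>k. g k + f k / 2)"
  have h: "dot h x = 1" unfolding h_def dot_simps using g assms by simp
  have P: "outer x g \<in> rank_one" "outer x h \<in> rank_one" using g h by (auto intro: rank_oneI)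
  have "comb 1 (- 2) (outer x g) * comb 1 (- 2) (outer x h) = comb 1 1 (outer x (\<lambda>k. 2 * (h k - g k)))"
    by (subst comb_mult) (auto simp: outer_mult g comb_def algebra_simps intro!: eq_matI)
  also have "(\<lambda>k. 2 * (h k - g k)) = f" by (simp add: h_def)
  finally have "det (comb 1 1 (outer x f)) = det (comb 1 (- 2) (outer x g)) * det (comb 1 (- 2) (outer x h))"
    by (metis det_mult comb_carrier outer_carrier(1))
  then show ?thesis by (simp add: G_iff det_comb P)
qed

lemma commute_elementary_scalar:
  assumes A: "A \<in> carrier_mat n n"
    and comm: "\<And>i j. i < n \<Longrightarrow> j < n \<Longrightarrow> i \<noteq> j \<Longrightarrow> A * outer (unit i) (unit j) = outer (unit i) (unit j) * A"
  obtains c where "A = c \<cdot>\<^sub>m 1\<^sub>m n"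
proof -
  have ap: "apply_mat A (unit i) k = A $$ (k, i)" if "i < n" "k < n" for A i k
    using that by (simp add: apply_mat_def unit_def of_bool_def if_distrib[of "\<lambda>c. _ * c"] cong: if_cong)
  have eq: "A $$ (k, i) * unit j l = unit i k * A $$ (j, l)" if "i < n" "j < n" "i \<noteq> j" "k < n" "l < n" for i j k l
  proof -
    have "(A * outer (unit i) (unit j)) $$ (k, l) = A $$ (k, i) * unit j l"
      using that A unfolding mult_outer[OF A] by (simp add: ap)
    moreover have "(outer (unit i) (unit j) * A) $$ (k, l) = unit i k * A $$ (j, l)"
      using that A unfolding outer_mult_mat[OF A] by (simp add: ap)
    ultimately show ?thesis using comm[OF that(1-3)] by simp
  qed
  have other: "\<exists>j<n. j \<noteq> i" for i :: nat using n3 by (cases "i = 0") (auto intro: exI[of _ 0] exI[of _ 1])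
  have off: "A $$ (k, i) = 0" if "k < n" "i < n" "k \<noteq> i" for k i
  proof -
    obtain j where "j < n" "j \<noteq> i" using other by blast
    then show ?thesis using eq[of i j k j] that by simp
  qed
  have diag: "A $$ (i, i) = A $$ (0, 0)" if "i < n" for i
    using eq[of i 0 i 0] that n3 by (cases "i = 0") auto
  have "A = A $$ (0, 0) \<cdot>\<^sub>m 1\<^sub>m n"
  proof (rule eq_matI)
    fix i j assume "i < dim_row (A $$ (0, 0) \<cdot>\<^sub>m 1\<^sub>m n)" "j < dim_col (A $$ (0, 0) \<cdot>\<^sub>m 1\<^sub>m n)"
    then have "i < n" "j < n" by auto
    then show "A $$ (i, j) = (A $$ (0, 0) \<cdot>\<^sub>m 1\<^sub>m n) $$ (i, j)"
      using off[of i j] diag[of i] by (cases "i = j") simp_all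
  qed (use A in auto)
  then show ?thesis using that by blast
qed

text \<open>Commuting with the transvection \<open>1 + N\<close> amounts to commuting with the
  matrix unit \<open>N\<close>.\<close>

lemma central_scalar:
  assumes "A \<in> carrier_mat n n" "central A" obtains c where "A = c \<cdot>\<^sub>m 1\<^sub>m n"
proof (rule commute_elementary_scalar[OF assms(1)])
  fix i j assume ij: "i < n" "j < n" "i \<noteq> j"
  let ?N = "outer (unit i) (unit j)"
  have "comb 1 1 ?N \<in> G" using ij by (intro transvection_G) (simp add: dot_unit)
  then have eq: "A * comb 1 1 ?N = comb 1 1 ?N * A" using assms(2) by (simp add: central_def)
  have "comb 1 1 ?N = 1\<^sub>m n + ?N" by (auto simp: comb_def intro!: eq_matI)
  moreover have "A * (1\<^sub>m n + ?N) = A + A * ?N"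
    using assms(1) by (simp add: mult_add_distrib_mat[of _ n n _ n])
  moreover have "(1\<^sub>m n + ?N) * A = A + ?N * A"
    using assms(1) by (simp add: add_mult_distrib_mat[of _ n n _ _ n])
  ultimately have "A + A * ?N = A + ?N * A" using eq by simp
  then have "(A + A * ?N) $$ (k, l) = (A + ?N * A) $$ (k, l)" if "k < n" "l < n" for k l by simp
  then have "(A * ?N) $$ (k, l) = (?N * A) $$ (k, l)" if "k < n" "l < n" for k l
    using that assms(1) by (simp del: index_mult_mat(1))
  then show "A * ?N = ?N * A" using assms(1) by (intro eq_matI) auto
qed (rule that)

lemma scalar_commute: "(B :: complex mat) \<in> carrier_mat n n \<Longrightarrow> (c \<cdot>\<^sub>m 1\<^sub>m n) * B = B * (c \<cdot>\<^sub>m 1\<^sub>m n)"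
  using mult_smult_assoc_mat[of "1\<^sub>m n" n n B n c] mult_smult_distrib[of B n n "1\<^sub>m n" n c] by simp

lemma scalar_central: "central (c \<cdot>\<^sub>m 1\<^sub>m n)"
  unfolding central_def using scalar_commute G_carrier by blast

text \<open>The matrix \<open>s (1 - 2 P)\<close>. An ordinary reflection has determinant -1, which
  the scalar must correct: membership in the group means \<open>s ^ n = - 1\<close>.\<close>

definition reflection :: "complex \<Rightarrow> complex mat \<Rightarrow> complex mat" where
  "reflection s P = comb s (- 2 * s) P"

lemma reflection_carrier: "P \<in> carrier_mat n n \<Longrightarrow> reflection s P \<in> carrier_mat n n"
  by (simp add: reflection_def)

lemma reflection_G_iff: "P \<in> rank_one \<Longrightarrow> reflection s P \<in> G \<longleftrightarrow> s ^ n = - 1"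
proof -
  assume P: "P \<in> rank_one"
  have "s ^ (n - 1) * (s + - 2 * s) = - (s ^ Suc (n - 1))" by (simp add: algebra_simps)
  also have "Suc (n - 1) = n" using n3 by simp
  finally show ?thesis using P by (simp add: G_iff reflection_def det_comb rank_one_carrier minus_equation_iff) metis
qed

lemma reflection_eq_iff:
  assumes "P \<in> rank_one" "Q \<in> rank_one" "s ^ n = - 1"
  shows "reflection s P = reflection t Q \<longleftrightarrow> s = t \<and> P = Q"
proof -
  have "s \<noteq> 0" using assms(3) n3 by (auto simp: power_0_left)
  then show ?thesis using comb_eq_iff[OF assms(1,2), of "- 2 * s" s t "- 2 * t"] by (auto simp: reflection_def)
qed

lemma reflection_commute_iff:
  assumes "P \<in> rank_one" "Q \<in> rank_one" "s ^ n = - 1" "t ^ n = - 1"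
  shows "reflection s P * reflection t Q = reflection t Q * reflection s P \<longleftrightarrow> P * Q = Q * P"
proof -
  have "s \<noteq> 0" "t \<noteq> 0" using assms(3,4) n3 by (auto simp: power_0_left)
  then show ?thesis unfolding reflection_def using assms by (intro comb_commute_iff) auto
qed

lemma conj_reflection: "inverse_pair S S' \<Longrightarrow> P \<in> carrier_mat n n \<Longrightarrow> S * reflection s P * S' = reflection s (S * P * S')"
  by (simp add: reflection_def conj_comb)

text \<open>The other commuting conjugates are the \<open>reflection s Q\<close> with
  \<open>Q\<close> orthogonal to \<open>P\<close>. Any such pair \<open>P\<close>, \<open>Q\<close>
  can be moved to \<open>E 0\<close>, \<open>E 1\<close> by one conjugation, so all products are
  conjugate.\<close>

lemma reflection_like_reflection:
  assumes P: "P \<in> rank_one" and s: "s ^ n = - 1"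
  shows "reflection_like (reflection s P)"
  unfolding reflection_like_def
proof (intro conjI allI impI)
  have s0: "s \<noteq> 0" using s n3 by (auto simp: power_0_left)
  have Pc: "P \<in> carrier_mat n n" using rank_one_carrier[OF P] .
  show "reflection s P \<in> G" using reflection_G_iff[OF P] s by simp
  show "\<not> central (reflection s P)"
  proof
    assume "central (reflection s P)"
    then obtain c where "reflection s P = c \<cdot>\<^sub>m 1\<^sub>m n" using central_scalar[OF reflection_carrier[OF Pc]] by blast
    then show False using comb_not_scalar[OF P, of "- 2 * s"] s0 by (simp add: reflection_def)
  qed
  have "reflection s P * reflection s P = (s * s) \<cdot>\<^sub>m 1\<^sub>m n"
    unfolding reflection_def comb_mult_idem[OF Pc rank_one_idem[OF P]] using Pc
    by (auto simp: comb_def intro!: eq_matI)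
  then show "central (reflection s P * reflection s P)" using scalar_central by simp
  fix B C
  assume B: "similar (reflection s P) B" and C: "similar (reflection s P) C" and
    comm: "reflection s P * B = B * reflection s P" "reflection s P * C = C * reflection s P" and ne: "B \<noteq> reflection s P" "C \<noteq> reflection s P"
  have *: "\<exists>Q\<in>rank_one. B = reflection s Q \<and> orth P Q" if B: "similar (reflection s P) B" and comm: "reflection s P * B = B * reflection s P" and ne: "B \<noteq> reflection s P" for B
  proof -
    obtain S S' where S: "inverse_pair S S'" "B = S * reflection s P * S'" using B unfolding similar_def by blast
    define Q where "Q = S * P * S'"
    have Q: "Q \<in> rank_one" "B = reflection s Q" using conj_rank_one[OF S(1) P] conj_reflection[OF S(1) Pc] S(2) by (auto simp: Q_def)
    moreover have "orth P Q"
      using comm ne Q reflection_commute_iff[OF P Q(1) s s] rank_one_commute[OF P Q(1)] by auto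
    ultimately show ?thesis by blast
  qed
  obtain Q R where Q: "Q \<in> rank_one" "B = reflection s Q" "orth P Q" and R: "R \<in> rank_one" "C = reflection s R" "orth P R"
    using *[OF B comm(1) ne(1)] *[OF C comm(2) ne(2)] by blast
  obtain S S' where S: "inverse_pair S S'" "P = S * E 0 * S'" "Q = S * E 1 * S'" using conj_pair[OF P Q(1,3)] .
  obtain T T' where T: "inverse_pair T T'" "P = T * E 0 * T'" "R = T * E 1 * T'" using conj_pair[OF P R(1,3)] .
  let ?M = "reflection s (E 0) * reflection s (E 1)"
  have M: "?M \<in> carrier_mat n n" by (simp add: reflection_carrier mult_carrier_mat[of _ n n _ n])
  have 1: "reflection s P * B = S * ?M * S'" "reflection s P * C = T * ?M * T'"
    using conj_mult[OF S(1), of "reflection s (E 0)" "reflection s (E 1)"] conj_mult[OF T(1), of "reflection s (E 0)" "reflection s (E 1)"]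
      conj_reflection[OF S(1)] conj_reflection[OF T(1)] S T Q R by (simp_all add: reflection_carrier)
  have "inverse_pair (T * S') (S * T')" using inverse_pair_mult[OF T(1) inverse_pair_sym[OF S(1)]] .
  moreover have "T * ?M * T' = (T * S') * (S * ?M * S') * (S * T')"
    using M S(1)[unfolded inverse_pair_def] T(1)[unfolded inverse_pair_def]
    by (simp add: mat_assoc inverse_pair_cancel[OF S(1)])
  ultimately show "similar (reflection s P * B) (reflection s P * C)" unfolding similar_def 1 by blast
qed

declare minus_carrier_mat [simp]

section \<open>Traces and rank one idempotents below an idempotent\<close>

definition tr :: "complex mat \<Rightarrow> complex" where "tr A = (\<Sum>i<n. A $$ (i, i))"

lemma tr_mult_commute:
  assumes "A \<in> carrier_mat n n" "B \<in> carrier_mat n n" shows "tr (A * B) = tr (B * A)"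
  using assms unfolding tr_def
  by (simp add: mult_mat_index mult.commute del: index_mult_mat(1)) (rule sum.swap)

lemma tr_similar:
  assumes "similar A B" "A \<in> carrier_mat n n" shows "tr B = tr A"
proof -
  obtain S S' where S: "inverse_pair S S'" "B = S * A * S'" using assms(1) unfolding similar_def by blast
  note c = S(1)[unfolded inverse_pair_def]
  have "tr B = tr (S' * (S * A))" using S(2) c assms(2) tr_mult_commute[of "S * A" S'] mult_carrier_mat[of S n n A n] by simp
  then show ?thesis using inverse_pair_cancel(2)[OF S(1) assms(2)] by simp
qed

lemma tr_comb_mult:
  assumes "P \<in> carrier_mat n n" "Q \<in> carrier_mat n n"
  shows "tr (reflection s P * reflection s Q) = s ^ 2 * (of_nat n - 2 * tr P - 2 * tr Q + 4 * tr (P * Q))"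
proof -
  have "P * Q \<in> carrier_mat n n" using assms by simp
  then show ?thesis using assms unfolding reflection_def comb_mult[OF assms] tr_def
    by (simp add: sum.distrib sum_subtractf algebra_simps power2_eq_square sum_distrib_left sum_negf del: index_mult_mat(1))
qed

text \<open>For a nonzero entry at \<open>(k, l)\<close> take column \<open>l\<close> as vector and
  row \<open>k\<close>, divided by that entry, as functional. By \<open>M * M = M\<close> both are
  fixed, and their pairing gives back the entry divided by itself.\<close>

lemma idempotent_contains_rank_one:
  assumes M: "M \<in> carrier_mat n n" "M * M = M" "M \<noteq> 0\<^sub>m n n"
  obtains x f where "dot f x = 1" "\<And>i. i < n \<Longrightarrow> apply_mat M x i = x i"
    "\<And>i. i < n \<Longrightarrow> apply_mat (transpose_mat M) f i = f i"
proof -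
  obtain k l where kl: "k < n" "l < n" "M $$ (k, l) \<noteq> 0" using M(1,3) by (auto simp: mat_eq_iff)
  have MM: "(\<Sum>r<n. M $$ (i, r) * M $$ (r, j)) = M $$ (i, j)" if "i < n" "j < n" for i j
    using mult_mat_index[OF M(1,1) that] M(2) by simp
  show ?thesis
  proof (rule that[of "\<lambda>i. M $$ (k, i) / M $$ (k, l)" "\<lambda>i. M $$ (i, l)"])
    show "dot (\<lambda>i. M $$ (k, i) / M $$ (k, l)) (\<lambda>i. M $$ (i, l)) = 1"
      unfolding dot_simps using MM[OF kl(1,2)] kl(3) by (simp add: dot_def)
    show "apply_mat M (\<lambda>i. M $$ (i, l)) i = M $$ (i, l)" if "i < n" for i
      using MM[OF that kl(2)] by (simp add: apply_mat_def)
    show "apply_mat (transpose_mat M) (\<lambda>i. M $$ (k, i) / M $$ (k, l)) i = M $$ (k, i) / M $$ (k, l)" if "i < n" for i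
      using MM[OF kl(1) that] that M(1)
      by (simp add: apply_mat_def sum_divide_distrib[symmetric] mult.commute)
  qed
qed

lemma apply_mat_update:
  assumes "P \<in> carrier_mat n n" "i < n"
  shows "apply_mat (P - outer x f + outer y g) z i = apply_mat P z i - x i * dot f z + y i * dot g z"
    "apply_mat (P - outer x f) z i = apply_mat P z i - x i * dot f z"
  using assms unfolding apply_mat_def dot_def
  by (simp_all add: algebra_simps sum.distrib sum_subtractf sum_distrib_left)

lemma outer_fixed:
  assumes "P \<in> carrier_mat n n" "\<And>i. i < n \<Longrightarrow> apply_mat P x i = x i"
    "\<And>i. i < n \<Longrightarrow> apply_mat (transpose_mat P) f i = f i"
  shows "P * outer x f = outer x f" "outer x f * P = outer x f"
  unfolding mult_outer[OF assms(1)] outer_mult_mat[OF assms(1)] using assms by (auto intro!: outer_cong)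

lemma idempotent_minus_rank_one:
  assumes P: "P \<in> carrier_mat n n" "P * P = P" and x: "\<And>i. i < n \<Longrightarrow> apply_mat P x i = x i"
    "\<And>i. i < n \<Longrightarrow> apply_mat (transpose_mat P) f i = f i" "dot f x = 1"
  shows "(P - outer x f) * (P - outer x f) = P - outer x f"
proof -
  let ?Q = "outer x f"
  have Q: "?Q * ?Q = ?Q" using x(3) by (simp add: outer_mult) (auto intro!: eq_matI)
  have "(P - ?Q) * (P - ?Q) = P * (P - ?Q) - ?Q * (P - ?Q)"
    using P by (intro minus_mult_distrib_mat[of _ n n _ _ n]) auto
  also have "P * (P - ?Q) = P * P - P * ?Q" using P by (intro mult_minus_distrib_mat[of _ n n _ n]) auto
  also have "?Q * (P - ?Q) = ?Q * P - ?Q * ?Q" using P by (intro mult_minus_distrib_mat[of _ n n _ n]) auto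
  finally have "(P - ?Q) * (P - ?Q) = (P * P - P * ?Q) - (?Q * P - ?Q * ?Q)" .
  moreover have "P * ?Q = ?Q" "?Q * P = ?Q" using outer_fixed[OF P(1)] x(1,2) by blast+
  ultimately show ?thesis unfolding P(2) Q using P(1) by (auto intro!: eq_matI)
qed

lemma idempotent_complement:
  assumes P: "(P :: complex mat) \<in> carrier_mat n n" "P * P = P"
  shows "(1\<^sub>m n - P) * (1\<^sub>m n - P) = 1\<^sub>m n - P"
proof -
  have "(1\<^sub>m n - P) * (1\<^sub>m n - P) = 1\<^sub>m n * (1\<^sub>m n - P) - P * (1\<^sub>m n - P)"
    using P by (intro minus_mult_distrib_mat[of _ n n _ _ n]) auto
  also have "P * (1\<^sub>m n - P) = P * 1\<^sub>m n - P * P" using P by (intro mult_minus_distrib_mat[of _ n n _ n]) auto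
  finally show ?thesis using P by (auto intro!: eq_matI)
qed

text \<open>The involution exchanging \<open>x\<close> with \<open>y\<close> and \<open>f\<close> with \<open>g\<close> is \<open>1 - (x - y)(f - g)\<close>.\<close>

lemma exchange_conj:
  assumes P: "P \<in> carrier_mat n n" and x: "\<And>i. i < n \<Longrightarrow> apply_mat P x i = x i"
    "\<And>i. i < n \<Longrightarrow> apply_mat (transpose_mat P) f i = f i" "dot f x = 1"
    and y: "\<And>i. i < n \<Longrightarrow> apply_mat P y i = 0" "\<And>i. i < n \<Longrightarrow> apply_mat (transpose_mat P) g i = 0" "dot g y = 1"
  shows "\<exists>S S'. inverse_pair S S' \<and> S * P * S' = P - outer x f + outer y g"
proof -
  have fy: "dot f y = 0"
  proof -
    have "dot f y = dot (apply_mat (transpose_mat P) f) y" using x(2) by (intro dot_cong) auto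
    also have "\<dots> = dot f (\<lambda>_. 0)" unfolding dot_apply_transpose[OF P] using y(1) by (intro dot_cong) auto
    finally show ?thesis by (simp add: dot_def)
  qed
  have gx: "dot g x = 0"
  proof -
    have "dot g x = dot g (apply_mat P x)" using x(1) by (intro dot_cong) auto
    also have "\<dots> = dot (\<lambda>_. 0) x" unfolding dot_apply_transpose[OF P, symmetric] using y(2) by (intro dot_cong) auto
    finally show ?thesis by (simp add: dot_def)
  qed
  define u where "u = (\<lambda>i. x i - y i)"
  define h where "h = (\<lambda>i. f i - g i)"
  have hu: "dot h u = 2" "dot f u = 1" unfolding h_def u_def dot_simps using x y fy gx by simp_all
  define W where "W = 1\<^sub>m n - outer u h"
  have W: "W \<in> carrier_mat n n" by (simp add: W_def)
  have "W * W = 1\<^sub>m n * W - outer u h * W"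
    unfolding W_def by (intro minus_mult_distrib_mat[of _ n n _ _ n]) auto
  also have "outer u h * W = outer u h * 1\<^sub>m n - outer u h * outer u h"
    unfolding W_def by (intro mult_minus_distrib_mat[of _ n n _ n]) auto
  finally have "W * W = 1\<^sub>m n"
    using W by (auto simp: outer_mult hu W_def intro!: eq_matI)
  then have pair: "inverse_pair W W" using W by (simp add: inverse_pair_def)
  have "W * P = 1\<^sub>m n * P - outer u h * P"
    unfolding W_def using P by (intro minus_mult_distrib_mat[of _ n n _ _ n]) auto
  also have "outer u h * P = outer u f"
    unfolding outer_mult_mat[OF P] h_def apply_mat_simps using x y by (intro outer_cong) auto
  finally have WP: "W * P = P - outer u f" using P by simp
  have "W * P * W = (P - outer u f) * 1\<^sub>m n - (P - outer u f) * outer u h"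
    unfolding WP unfolding W_def using P by (intro mult_minus_distrib_mat[of _ n n _ n]) auto
  also have "(P - outer u f) * outer u h = P * outer u h - outer u f * outer u h"
    using P by (intro minus_mult_distrib_mat[of _ n n _ _ n]) auto
  also have "P * outer u h = outer x h"
    unfolding mult_outer[OF P] u_def apply_mat_simps using x y by (intro outer_cong) auto
  also have "outer u f * outer u h = outer u h"
    unfolding outer_mult hu by (auto intro!: eq_matI)
  finally have "W * P * W = P - outer x f + outer y g"
    using P by (auto simp: u_def h_def algebra_simps intro!: eq_matI)
  then show ?thesis using pair by blast
qed

lemma tr_update:
  "P \<in> carrier_mat n n \<Longrightarrow> tr (P - outer x f + outer y g) = tr P - dot f x + dot g y"
  "P \<in> carrier_mat n n \<Longrightarrow> tr (P - outer x f) = tr P - dot f x"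
  by (simp_all add: tr_def dot_def sum.distrib sum_subtractf mult.commute)

text \<open>If both \<open>P\<close> and \<open>1 - P\<close> have rank at least two, then exchanging one or two dimensions between them
  yields commuting conjugates with products of different traces.\<close>

lemma reflection_like_form:
  assumes A: "reflection_like A"
  obtains s P where "s ^ n = - 1" "P \<in> rank_one" "A = reflection s P"
proof -
  have AG: "A \<in> G" "A \<in> carrier_mat n n" "\<not> central A" "central (A * A)"
    using A G_carrier by (auto simp: reflection_like_def)
  obtain c where c: "A * A = c \<cdot>\<^sub>m 1\<^sub>m n" using central_scalar[OF _ AG(4)] AG(2) by auto
  have "c ^ n = 1" using arg_cong[OF c, of det] mult_G[OF AG(1,1)] by (simp add: G_iff)
  then have "c \<noteq> 0" using n3 by (auto simp: power_0_left)
  define s where "s = csqrt c"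
  have s: "s * s = c" "s \<noteq> 0" using \<open>c \<noteq> 0\<close> power2_csqrt[of c] by (auto simp: s_def power2_eq_square)
  define P where "P = (1 / 2) \<cdot>\<^sub>m (1\<^sub>m n - (1 / s) \<cdot>\<^sub>m A)"
  have P: "P \<in> carrier_mat n n" using AG by (simp add: P_def)
  have AP: "A = reflection s P"
    using AG s by (auto simp: reflection_def comb_def P_def algebra_simps intro!: eq_matI)
  have PP: "P * P = P"
  proof -
    have c2: "P * P \<in> carrier_mat n n" using P by simp
    have "s * s * (of_bool (i = j) - 4 * P $$ (i, j) + 4 * (P * P) $$ (i, j)) = s * s * of_bool (i = j)"
      if "i < n" "j < n" for i j
    proof -
      have "(A * A) $$ (i, j) = s * s * (of_bool (i = j) - 4 * P $$ (i, j) + 4 * (P * P) $$ (i, j))"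
        unfolding AP reflection_def comb_mult[OF P P] using that P c2
        by (simp add: algebra_simps del: index_mult_mat(1))
      moreover have "(A * A) $$ (i, j) = s * s * of_bool (i = j)" unfolding c using that s by simp
      ultimately show ?thesis by simp
    qed
    then have "(P * P) $$ (i, j) = P $$ (i, j)" if "i < n" "j < n" for i j
      using that s(2) by (simp del: index_mult_mat(1))
    then show ?thesis using P by (intro eq_matI) auto
  qed
  \<comment> \<open>Replacing \<open>s\<close> by \<open>- s\<close> interchanges \<open>P\<close>
    and \<open>1 - P\<close>, so it suffices that one of the two has rank one.\<close>
  have refl': "A = reflection (- s) (1\<^sub>m n - P)"
    unfolding AP using P by (auto simp: reflection_def comb_def algebra_simps intro!: eq_matI)
  show ?thesis
  proof (cases "P \<in> rank_one \<or> 1\<^sub>m n - P \<in> rank_one")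
    case True
    then show ?thesis using that AG(1) AP refl' reflection_G_iff by metis
  next
    case False
    have idQ: "(1\<^sub>m n - P) * (1\<^sub>m n - P) = 1\<^sub>m n - P" by (rule idempotent_complement[OF P PP])
    have Qc: "1\<^sub>m n - P \<in> carrier_mat n n" using P by simp
    have not_scalar: "A \<noteq> k \<cdot>\<^sub>m 1\<^sub>m n" for k using AG(3) scalar_central by auto
    have P0: "P \<noteq> 0\<^sub>m n n"
    proof
      assume "P = 0\<^sub>m n n"
      then have "A = s \<cdot>\<^sub>m 1\<^sub>m n" unfolding AP by (auto simp: reflection_def comb_def intro!: eq_matI)
      then show False using not_scalar by blast
    qed
    have Q0: "1\<^sub>m n - P \<noteq> 0\<^sub>m n n"
    proof
      assume "1\<^sub>m n - P = 0\<^sub>m n n"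
      then have "A = (- s) \<cdot>\<^sub>m 1\<^sub>m n" unfolding refl' by (auto simp: reflection_def comb_def intro!: eq_matI)
      then show False using not_scalar by blast
    qed
    have apQ: "apply_mat (1\<^sub>m n - P) z i = z i - apply_mat P z i" "apply_mat (transpose_mat (1\<^sub>m n - P)) z i =
        z i - apply_mat (transpose_mat P) z i" if "i < n" for z i
      using that P by (simp_all add: apply_mat_def left_diff_distrib sum_subtractf
          if_distrib[of "\<lambda>c. c * _"] cong: if_cong)
    obtain x1 f1 where 1: "dot f1 x1 = 1" "\<And>i. i < n \<Longrightarrow> apply_mat P x1 i = x1 i"
      "\<And>i. i < n \<Longrightarrow> apply_mat (transpose_mat P) f1 i = f1 i"
      using idempotent_contains_rank_one[OF P PP P0] by metis
    obtain y1 g1 where 2: "dot g1 y1 = 1" "\<And>i. i < n \<Longrightarrow> apply_mat (1\<^sub>m n - P) y1 i = y1 i"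
      "\<And>i. i < n \<Longrightarrow> apply_mat (transpose_mat (1\<^sub>m n - P)) g1 i = g1 i"
      using idempotent_contains_rank_one[OF Qc idQ Q0] by metis
    \<comment> \<open>An idempotent that is not of rank one remains nonzero after splitting off a
      rank one part, and what remains contains another rank one idempotent orthogonal to the
      first.\<close>
    have second: "\<exists>x f. dot f x = 1 \<and> (\<forall>i<n. apply_mat M x i = x i) \<and> (\<forall>i<n. apply_mat (transpose_mat M) f i = f i) \<and>
        dot f1 x = 0 \<and> dot f x1 = 0"
      if M: "M \<in> carrier_mat n n" "M * M = M" "M \<notin> rank_one" and 1: "dot f1 x1 = 1" "\<And>i. i < n \<Longrightarrow> apply_mat M x1 i = x1 i"
        "\<And>i. i < n \<Longrightarrow> apply_mat (transpose_mat M) f1 i = f1 i" for M x1 f1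
    proof -
      have ne: "M - outer x1 f1 \<noteq> 0\<^sub>m n n"
      proof
        assume eq: "M - outer x1 f1 = 0\<^sub>m n n"
        have "M $$ (i, j) = outer x1 f1 $$ (i, j)" if "i < n" "j < n" for i j
          using arg_cong[OF eq, of "\<lambda>M. M $$ (i, j)"] that M(1) by simp
        then have "M = outer x1 f1" using M(1) by (intro eq_matI) auto
        then show False using M(3) rank_oneI[OF 1(1)] by simp
      qed
      have c: "M - outer x1 f1 \<in> carrier_mat n n" using M(1) by simp
      obtain x f where xf: "dot f x = 1" "\<And>i. i < n \<Longrightarrow> apply_mat (M - outer x1 f1) x i = x i"
        "\<And>i. i < n \<Longrightarrow> apply_mat (transpose_mat (M - outer x1 f1)) f i = f i"
        using idempotent_contains_rank_one[OF c idempotent_minus_rank_one[OF M(1,2) 1(2,3,1)] ne] by metis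
      have Mx: "apply_mat M x i = x i + x1 i * dot f1 x" if "i < n" for i
        using xf(2)[OF that] apply_mat_update(2)[OF M(1) that, of x1 f1 x] by (simp add: diff_eq_eq)
      have tM: "transpose_mat (M - outer x1 f1) = transpose_mat M - outer f1 x1"
        using M(1) by (auto intro!: eq_matI)
      have Mf: "apply_mat (transpose_mat M) f i = f i + f1 i * dot x1 f" if "i < n" for i
        using xf(3)[OF that] apply_mat_update(2)[of "transpose_mat M" i f1 x1 f] that M(1) unfolding tM by (simp add: diff_eq_eq)
      have "dot f1 x = dot (apply_mat (transpose_mat M) f1) x" using 1(3) by (intro dot_cong) auto
      also have "\<dots> = dot f1 (\<lambda>i. x i + x1 i * dot f1 x)"
        unfolding dot_apply_transpose[OF M(1)] using Mx by (intro dot_cong) auto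
      also have "\<dots> = dot f1 x + dot f1 x" unfolding dot_simps using 1(1) by simp
      finally have f1x: "dot f1 x = 0" by simp
      have "dot f x1 = dot f (apply_mat M x1)" using 1(2) by (intro dot_cong) auto
      also have "\<dots> = dot (\<lambda>i. f i + f1 i * dot x1 f) x1"
        unfolding dot_apply_transpose[OF M(1), symmetric] using Mf by (intro dot_cong) auto
      also have "\<dots> = dot f x1 + dot f x1" unfolding dot_simps using 1(1) by (simp add: dot_commute)
      finally have fx1: "dot f x1 = 0" by simp
      show ?thesis using xf(1) Mx Mf f1x fx1 by (intro exI[of _ x] exI[of _ f]) (simp add: dot_commute)
    qed
    obtain x2 f2 where 3: "dot f2 x2 = 1" "\<And>i. i < n \<Longrightarrow> apply_mat P x2 i = x2 i"
      "\<And>i. i < n \<Longrightarrow> apply_mat (transpose_mat P) f2 i = f2 i" "dot f1 x2 = 0" "dot f2 x1 = 0"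
      using second[OF P PP _ 1] False by metis
    obtain y2 g2 where 4: "dot g2 y2 = 1" "\<And>i. i < n \<Longrightarrow> apply_mat (1\<^sub>m n - P) y2 i = y2 i"
      "\<And>i. i < n \<Longrightarrow> apply_mat (transpose_mat (1\<^sub>m n - P)) g2 i = g2 i" "dot g1 y2 = 0" "dot g2 y1 = 0"
      using second[OF Qc idQ _ 2] False by metis
    have y: "apply_mat P y1 i = 0" "apply_mat (transpose_mat P) g1 i = 0"
      "apply_mat P y2 i = 0" "apply_mat (transpose_mat P) g2 i = 0" if "i < n" for i
      using 2(2,3)[OF that] 4(2,3)[OF that] apQ[OF that] by auto
    have dot0: "dot f z = 0" if "\<And>i. i < n \<Longrightarrow> apply_mat (transpose_mat P) f i = f i" "\<And>i. i < n \<Longrightarrow> apply_mat P z i = 0" for f z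
    proof -
      have "dot f z = dot (apply_mat (transpose_mat P) f) z" using that(1) by (intro dot_cong) auto
      also have "\<dots> = dot f (\<lambda>_. 0)" unfolding dot_apply_transpose[OF P] using that(2) by (intro dot_cong) auto
      finally show ?thesis by (simp add: dot_def)
    qed
    have dot0': "dot g z = 0" if "\<And>i. i < n \<Longrightarrow> apply_mat (transpose_mat P) g i = 0" "\<And>i. i < n \<Longrightarrow> apply_mat P z i = z i" for g z
    proof -
      have "dot g z = dot g (apply_mat P z)" using that(2) by (intro dot_cong) auto
      also have "\<dots> = dot (\<lambda>_. 0) z" unfolding dot_apply_transpose[OF P, symmetric] using that(1) by (intro dot_cong) auto
      finally show ?thesis by (simp add: dot_def)
    qed
    \<comment> \<open>One exchange of dimensions between \<open>P\<close> and its complement gives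
      \<open>R\<close>, a second one gives \<open>R2\<close>. Products with \<open>P\<close> lose
      one and two rank one summands.\<close>
    define R where "R = P - outer x1 f1 + outer y1 g1"
    define R2 where "R2 = R - outer x2 f2 + outer y2 g2"
    have Rc: "R \<in> carrier_mat n n" "R2 \<in> carrier_mat n n" using P by (auto simp: R_def R2_def)
    obtain S S' where S: "inverse_pair S S'" "S * P * S' = R"
      using exchange_conj[OF P 1(2,3,1) y(1,2) 2(1)] by (auto simp: R_def)
    have tR: "transpose_mat R = transpose_mat P - outer f1 x1 + outer g1 y1"
      using P by (auto simp: R_def intro!: eq_matI)
    have apR: "apply_mat R z i = apply_mat P z i - x1 i * dot f1 z + y1 i * dot g1 z"
      "apply_mat (transpose_mat R) z i = apply_mat (transpose_mat P) z i - f1 i * dot x1 z + g1 i * dot y1 z" if "i < n" for z i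
      using apply_mat_update(1)[OF _ that] P that unfolding tR unfolding R_def by auto
    have "\<exists>S S'. inverse_pair S S' \<and> S * R * S' = R2"
      unfolding R2_def
    proof (rule exchange_conj[OF Rc(1) _ _ 3(1) _ _ 4(1)])
      fix i assume i: "i < n"
      show "apply_mat R x2 i = x2 i" using 3 dot0'[of g1 x2] y i by (simp add: apR)
      show "apply_mat (transpose_mat R) f2 i = f2 i" using 3 dot0[of f2 y1] y i by (simp add: apR dot_commute)
      show "apply_mat R y2 i = 0" using 4 dot0[of f1 y2] 1 y i by (simp add: apR)
      show "apply_mat (transpose_mat R) g2 i = 0" using 4 dot0'[of g2 x1] 1 y i by (simp add: apR dot_commute)
    qed
    then obtain T T' where T: "inverse_pair T T'" "T * R * T' = R2" by blast
    have "similar A (reflection s R)" unfolding similar_def AP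
      using S conj_reflection[OF S(1) P, of s] by metis
    moreover have "similar A (reflection s R2)"
    proof -
      have "(T * S) * reflection s P * (S' * T') = T * (S * reflection s P * S') * T'"
        using S(1)[unfolded inverse_pair_def] T(1)[unfolded inverse_pair_def] reflection_carrier[OF P]
        by (simp add: mat_assoc)
      also have "\<dots> = reflection s R2"
        using conj_reflection[OF S(1) P, of s] conj_reflection[OF T(1) Rc(1), of s] S T by simp
      finally show ?thesis unfolding similar_def AP using inverse_pair_mult[OF T(1) S(1)] by metis
    qed
    moreover have prod: "P * R = P - outer x1 f1" "R * P = P - outer x1 f1"
      "P * R2 = P - outer x1 f1 - outer x2 f2" "R2 * P = P - outer x1 f1 - outer x2 f2"
    proof -
      have d: "P * (M - outer x f + outer y g) = P * M - outer x f"
        "(M - outer x f + outer y g) * P = M * P - outer x f"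
        if "M \<in> carrier_mat n n" "\<And>i. i < n \<Longrightarrow> apply_mat P x i = x i"
        "\<And>i. i < n \<Longrightarrow> apply_mat (transpose_mat P) f i = f i"
        "\<And>i. i < n \<Longrightarrow> apply_mat P y i = 0" "\<And>i. i < n \<Longrightarrow> apply_mat (transpose_mat P) g i = 0" for M x f y g
      proof -
        have "P * (M - outer x f + outer y g) = P * (M - outer x f) + P * outer y g"
          using P that(1) by (intro mult_add_distrib_mat[of _ n n _ n]) auto
        also have "P * (M - outer x f) = P * M - P * outer x f"
          using P that(1) by (intro mult_minus_distrib_mat[of _ n n _ n]) auto
        also have "P * outer y g = 0\<^sub>m n n" unfolding mult_outer[OF P] outer_eq_0 using that(4) by auto
        finally have "P * (M - outer x f + outer y g) = P * M - P * outer x f + 0\<^sub>m n n" .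
        moreover have fixed: "P * outer x f = outer x f" "outer x f * P = outer x f"
          using outer_fixed[OF P] that(2,3) by blast+
        ultimately show "P * (M - outer x f + outer y g) = P * M - outer x f"
          using P that(1) by simp
        have "(M - outer x f + outer y g) * P = (M - outer x f) * P + outer y g * P"
          using P that(1) by (intro add_mult_distrib_mat[of _ n n _ _ n]) auto
        also have "(M - outer x f) * P = M * P - outer x f * P"
          using P that(1) by (intro minus_mult_distrib_mat[of _ n n _ _ n]) auto
        also have "outer y g * P = 0\<^sub>m n n" unfolding outer_mult_mat[OF P] outer_eq_0 using that(5) by auto
        finally show "(M - outer x f + outer y g) * P = M * P - outer x f"
          using fixed P that(1) by simp
      qed
      show 5: "P * R = P - outer x1 f1" "R * P = P - outer x1 f1"
        unfolding R_def using d[OF P 1(2,3) y(1,2)] PP by simp_all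
      show "P * R2 = P - outer x1 f1 - outer x2 f2" "R2 * P = P - outer x1 f1 - outer x2 f2"
        unfolding R2_def using d[OF Rc(1) 3(2,3) y(3,4)] 5 by simp_all
    qed
    moreover have trR: "tr R = tr P" "tr R2 = tr P"
      unfolding R2_def tr_update(1)[OF Rc(1)] unfolding R_def tr_update(1)[OF P] using 1 2 3 4 by simp_all
    moreover have "P - outer x1 f1 \<in> carrier_mat n n" using P by simp
    then have trPR: "tr (P * R) = tr P - 1" "tr (P * R2) = tr P - 2"
      unfolding prod using tr_update(2) P 1(1) 3(1) by simp_all
    have ne: "reflection s R \<noteq> A" "reflection s R2 \<noteq> A"
    proof -
      have "M = P" if "reflection s M = A" "M \<in> carrier_mat n n" for M
      proof (rule eq_matI)
        fix i j assume "i < dim_row P" "j < dim_col P"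
        then have "i < n" "j < n" using P by auto
        then show "M $$ (i, j) = P $$ (i, j)"
          using arg_cong[OF that(1)[unfolded AP], of "\<lambda>M. M $$ (i, j)"] that(2) P s(2)
          by (simp add: reflection_def comb_index)
      qed (use P that in auto)
      then show "reflection s R \<noteq> A" "reflection s R2 \<noteq> A" using trPR PP Rc by (metis add_cancel_right_right diff_add_cancel zero_neq_one zero_neq_numeral diff_eq_eq add_cancel_left_right)+
    qed
    have comm: "A * reflection s R = reflection s R * A" "A * reflection s R2 = reflection s R2 * A"
      unfolding AP reflection_def using prod by (auto intro!: comb_commute P Rc)
    have "similar (A * reflection s R) (A * reflection s R2)"
      using A calculation(1,2) comm ne unfolding reflection_like_def by blast
    then have "tr (A * reflection s R2) = tr (A * reflection s R)"
      using tr_similar AG(2) reflection_carrier[OF Rc(1)] by simp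
    \<comment> \<open>All terms of the trace formula agree except \<open>4 * tr (P * R)\<close> and
      \<open>4 * tr (P * R2)\<close>, whose arguments have traces differing by one.\<close>
    then have "s\<^sup>2 * (of_nat n - 2 * tr P - 2 * tr P + 4 * (tr P - 2)) = s\<^sup>2 * (of_nat n - 2 * tr P - 2 * tr P + 4 * (tr P - 1))"
      unfolding AP tr_comb_mult[OF P Rc(1)] tr_comb_mult[OF P Rc(2)] trR trPR .
    then have False using s(2) by (simp add: algebra_simps)
    then show ?thesis ..
  qed
qed

section \<open>Automorphisms\<close>

lemma reflection_similar:
  assumes P: "P \<in> rank_one" "Q \<in> rank_one" shows "similar (reflection s P) (reflection s Q)"
proof -
  obtain S S' where S: "inverse_pair S S'" "P = S * E 0 * S'" using conj_to_E0[OF P(1)] .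
  obtain T T' where T: "inverse_pair T T'" "Q = T * E 0 * T'" using conj_to_E0[OF P(2)] .
  have "(T * S') * P * (S * T') = T * (S' * (S * E 0 * S') * S) * T'"
    using S T unfolding S(2) by (simp add: inverse_pair_def mat_assoc inverse_pair_cancel[OF S(1)])
  also have "\<dots> = Q" using conj_conj[OF S(1), of "E 0"] T(2) by simp
  finally have "(T * S') * reflection s P * (S * T') = reflection s Q"
    using conj_reflection[OF inverse_pair_mult[OF T(1) inverse_pair_sym[OF S(1)]] rank_one_carrier[OF P(1)], of s] by simp
  then show ?thesis unfolding similar_def using inverse_pair_mult[OF T(1) inverse_pair_sym[OF S(1)]] by metis
qed

lemma similar_reflection:
  assumes "similar (reflection s P) B" "P \<in> rank_one" obtains Q where "Q \<in> rank_one" "B = reflection s Q"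
  using assms conj_rank_one conj_reflection rank_one_carrier unfolding similar_def by metis

text \<open>All reflections with parameter \<open>s\<close> are conjugate, so their images are
  conjugate reflections and share one parameter \<mu>. Uniqueness of the representation turns this
  into a map of idempotents, surjective because conjugacy is also reflected, and commutation
  translates into orthogonality.\<close>

lemma sl_aut_reflection:
  assumes f: "sl_aut f" and s: "s ^ n = - 1"
  obtains \<mu> g where "\<mu> ^ n = - 1" "orth_auto g" "\<And>P. P \<in> rank_one \<Longrightarrow> f (reflection s P) = reflection \<mu> (g P)"
proof -
  note D = sl_autD[OF f]
  have E0: "E 0 \<in> rank_one" using E_rank_one n3 by simp
  have rG: "reflection s P \<in> G" if "P \<in> rank_one" for P using reflection_G_iff[OF that] s by simp
  obtain \<mu> P0 where P0: "\<mu> ^ n = - 1" "P0 \<in> rank_one" "f (reflection s (E 0)) = reflection \<mu> P0"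
    using reflection_like_form[OF reflection_like_sl_aut[OF f reflection_like_reflection[OF E0 s]]] by metis
  have "\<exists>Q. Q \<in> rank_one \<and> f (reflection s P) = reflection \<mu> Q" if P: "P \<in> rank_one" for P
  proof -
    have "similar (reflection \<mu> P0) (f (reflection s P))"
      using similar_sl_aut[OF f rG[OF E0] reflection_similar[OF E0 P]] P0 by simp
    then show ?thesis using similar_reflection[OF _ P0(2)] by metis
  qed
  then obtain g where g: "\<And>P. P \<in> rank_one \<Longrightarrow> g P \<in> rank_one"
    "\<And>P. P \<in> rank_one \<Longrightarrow> f (reflection s P) = reflection \<mu> (g P)" by metis
  have inj: "g P = g Q \<longleftrightarrow> P = Q" if "P \<in> rank_one" "Q \<in> rank_one" for P Q
    using D(3)[OF rG[OF that(1)] rG[OF that(2)]] g that reflection_eq_iff[OF that s, of s]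
      reflection_eq_iff[OF g(1)[OF that(1)] g(1)[OF that(2)] P0(1), of \<mu>] by simp
  have surj: "\<exists>P\<in>rank_one. Q = g P" if Q: "Q \<in> rank_one" for Q
  proof -
    have QG: "reflection \<mu> Q \<in> G" using reflection_G_iff[OF Q] P0(1) by simp
    then obtain B where B: "B \<in> G" "reflection \<mu> Q = f B" using D(4) by blast
    have "similar (f (reflection s (E 0))) (f B)"
      unfolding P0(3) B(2)[symmetric] by (rule reflection_similar[OF P0(2) Q])
    then have "similar (reflection s (E 0)) B" using similar_sl_aut_iff[OF f rG[OF E0] B(1)] by simp
    then obtain P where P: "P \<in> rank_one" "B = reflection s P" using similar_reflection[OF _ E0] by metis
    then have "reflection \<mu> Q = reflection \<mu> (g P)" using B g by simp
    then have "Q = g P" using reflection_eq_iff[OF Q g(1)[OF P(1)] P0(1), of \<mu>] by simp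
    then show ?thesis using P(1) by blast
  qed
  have "orth (g P) (g Q) \<longleftrightarrow> orth P Q" if "P \<in> rank_one" "Q \<in> rank_one" for P Q
  proof -
    have "g P * g Q = g Q * g P \<longleftrightarrow> f (reflection s P) * f (reflection s Q) = f (reflection s Q) * f (reflection s P)"
      using reflection_commute_iff[OF g(1)[OF that(1)] g(1)[OF that(2)] P0(1) P0(1)] g that by simp
    also have "\<dots> \<longleftrightarrow> reflection s P * reflection s Q = reflection s Q * reflection s P"
      using D(2,3) rG that mult_G by metis
    also have "\<dots> \<longleftrightarrow> P * Q = Q * P" by (rule reflection_commute_iff[OF that s s])
    finally show ?thesis using rank_one_commute that g(1) inj[OF that] by simp
  qed
  moreover have "bij_betw g rank_one rank_one"
  proof -
    have "g ` rank_one = rank_one" using surj g(1) unfolding image_def by blast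
    then show ?thesis using inj by (auto simp: bij_betw_def inj_on_def)
  qed
  ultimately have "orth_auto g" by (simp add: orth_auto_def)
  then show ?thesis by (rule that[OF P0(1) _ g(2)])
qed

definition local_aut :: "(complex mat \<Rightarrow> complex mat) \<Rightarrow> bool" where
  "local_aut \<phi> \<longleftrightarrow> (\<forall>A\<in>G. \<forall>B\<in>G. \<exists>f. sl_aut f \<and> \<phi> A = f A \<and> \<phi> B = f B)"

text \<open>The automorphism, and with it \<mu>, depends on the pair of idempotents. Pairing each
  \<open>P\<close> with \<open>E 0\<close> shows that \<mu> is always the same.\<close>

lemma local_aut_reflection:
  assumes \<phi>: "local_aut \<phi>" and s: "s ^ n = - 1"
  obtains \<mu> \<psi> where "\<mu> ^ n = - 1" "local_orth_auto \<psi>" "\<And>P. P \<in> rank_one \<Longrightarrow> \<phi> (reflection s P) = reflection \<mu> (\<psi> P)"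
proof -
  have rG: "reflection s P \<in> G" if "P \<in> rank_one" for P using reflection_G_iff[OF that] s by simp
  have ex: "\<exists>\<mu> g. \<mu> ^ n = - 1 \<and> orth_auto g \<and> \<phi> (reflection s P) = reflection \<mu> (g P) \<and>
      \<phi> (reflection s Q) = reflection \<mu> (g Q)" if "P \<in> rank_one" "Q \<in> rank_one" for P Q
  proof -
    have "\<exists>f. sl_aut f \<and> \<phi> (reflection s P) = f (reflection s P) \<and> \<phi> (reflection s Q) = f (reflection s Q)"
      using \<phi> rG[OF that(1)] rG[OF that(2)] unfolding local_aut_def by simp
    then obtain f where f: "sl_aut f" "\<phi> (reflection s P) = f (reflection s P)" "\<phi> (reflection s Q) = f (reflection s Q)"
      by metis
    obtain \<mu> g where
      "\<mu> ^ n = - 1" "orth_auto g" "\<And>P. P \<in> rank_one \<Longrightarrow> f (reflection s P) = reflection \<mu> (g P)"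
      using sl_aut_reflection[OF f(1) s] by metis
    then show ?thesis using f that by (intro exI[of _ \<mu>] exI[of _ g]) simp
  qed
  have E0: "E 0 \<in> rank_one" using E_rank_one n3 by simp
  obtain \<mu> P0 where P0: "\<mu> ^ n = - 1" "P0 \<in> rank_one" "\<phi> (reflection s (E 0)) = reflection \<mu> P0"
    using ex[OF E0 E0] orth_auto_closed E0 by blast
  have "\<exists>Q. Q \<in> rank_one \<and> \<phi> (reflection s P) = reflection \<mu> Q" if P: "P \<in> rank_one" for P
  proof -
    obtain \<mu>' g where *: "\<mu>' ^ n = - 1" "orth_auto g" "\<phi> (reflection s (E 0)) = reflection \<mu>' (g (E 0))"
      "\<phi> (reflection s P) = reflection \<mu>' (g P)" using ex[OF E0 P] by blast
    have "\<mu> = \<mu>'"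
      using reflection_eq_iff[OF P0(2) orth_auto_closed[OF *(2) E0] P0(1)] *(3) P0(3) by simp
    then show ?thesis using * orth_auto_closed P by blast
  qed
  then obtain \<psi> where \<psi>: "\<And>P. P \<in> rank_one \<Longrightarrow> \<psi> P \<in> rank_one"
    "\<And>P. P \<in> rank_one \<Longrightarrow> \<phi> (reflection s P) = reflection \<mu> (\<psi> P)" by metis
  have "local_orth_auto \<psi>"
    unfolding local_orth_auto_def
  proof (intro ballI)
    fix P Q assume PQ: "P \<in> rank_one" "Q \<in> rank_one"
    obtain \<mu>' g where *: "\<mu>' ^ n = - 1" "orth_auto g" "\<phi> (reflection s P) = reflection \<mu>' (g P)"
      "\<phi> (reflection s Q) = reflection \<mu>' (g Q)" using ex[OF PQ] by blast
    have "\<psi> R = g R" if "R \<in> rank_one" "\<phi> (reflection s R) = reflection \<mu>' (g R)" for R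
      using reflection_eq_iff[OF \<psi>(1)[OF that(1)] orth_auto_closed[OF *(2) that(1)] P0(1), of \<mu>'] \<psi>(2)[OF that(1)] that(2)
      by metis
    then show "\<exists>g. orth_auto g \<and> \<psi> P = g P \<and> \<psi> Q = g Q" using * PQ by blast
  qed
  then show ?thesis by (rule that[OF P0(1) _ \<psi>(2)])
qed

lemma sl_aut_local: "sl_aut f \<Longrightarrow> local_aut f"
  unfolding local_aut_def by blast

lemma local_aut_comp:
  assumes "sl_aut h" "local_aut \<phi>" shows "local_aut (\<lambda>A. h (\<phi> A))"
  unfolding local_aut_def
proof (intro ballI)
  fix A B assume "A \<in> G" "B \<in> G"
  then obtain f where "sl_aut f" "\<phi> A = f A" "\<phi> B = f B" using assms(2) unfolding local_aut_def by blast
  then show "\<exists>f. sl_aut f \<and> h (\<phi> A) = f A \<and> h (\<phi> B) = f B"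
    using sl_aut_comp[OF assms(1)] by (intro exI[of _ "h \<circ> f"]) auto
qed

section \<open>Entrywise endomorphisms and the determination of automorphisms from
  reflections\<close>

lemma map_mat_outer: "map_mat \<sigma> (outer x f) = outer (\<lambda>i. \<sigma> (x i)) (\<lambda>i. \<sigma> (f i))"
  if "nonzero_field_endomorphism \<sigma>" for \<sigma>
  using that by (auto intro!: eq_matI simp: nonzero_field_endomorphism_def)

lemma dot_endomorphism:
  assumes "nonzero_field_endomorphism \<sigma>" shows "dot (\<lambda>i. \<sigma> (f i)) (\<lambda>i. \<sigma> (x i)) = \<sigma> (dot f x)"
proof -
  interpret field_hom \<sigma> by (rule field_hom_endomorphism[OF assms])
  show ?thesis by (simp add: dot_def hom_distribs)
qed

lemma map_mat_rank_one:
  assumes \<sigma>: "nonzero_field_endomorphism \<sigma>" and "P \<in> rank_one" shows "map_mat \<sigma> P \<in> rank_one"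
proof -
  interpret field_hom \<sigma> by (rule field_hom_endomorphism[OF \<sigma>])
  show ?thesis using assms(2)
    by (auto elim!: rank_oneE simp: map_mat_outer[OF \<sigma>] dot_endomorphism[OF \<sigma>] intro!: rank_oneI)
qed

lemma map_mat_comb:
  assumes \<sigma>: "nonzero_field_endomorphism \<sigma>" and "P \<in> carrier_mat n n"
  shows "map_mat \<sigma> (comb a b P) = comb (\<sigma> a) (\<sigma> b) (map_mat \<sigma> P)"
proof -
  interpret field_hom \<sigma> by (rule field_hom_endomorphism[OF \<sigma>])
  show ?thesis using assms(2) by (auto intro!: eq_matI simp: comb_def hom_distribs)
qed

lemma map_mat_reflection:
  assumes \<sigma>: "nonzero_field_endomorphism \<sigma>" and "P \<in> carrier_mat n n"
  shows "map_mat \<sigma> (reflection s P) = reflection (\<sigma> s) (map_mat \<sigma> P)"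
proof -
  interpret field_hom \<sigma> by (rule field_hom_endomorphism[OF \<sigma>])
  show ?thesis unfolding reflection_def map_mat_comb[OF assms] by (simp add: hom_distribs)
qed

lemma endomorphism_root:
  assumes \<sigma>: "nonzero_field_endomorphism \<sigma>" and "s ^ n = - 1" shows "\<sigma> s ^ n = (- 1 :: complex)"
proof -
  interpret field_hom \<sigma> by (rule field_hom_endomorphism[OF \<sigma>])
  show ?thesis using arg_cong[OF assms(2), of \<sigma>] by (simp add: hom_distribs)
qed

lemma map_mat_unit:
  assumes \<sigma>: "nonzero_field_endomorphism \<sigma>" shows "map_mat \<sigma> (outer (unit i) (unit j)) = outer (unit i) (unit j)"
    "map_mat \<sigma> (row_elem i j 1) = row_elem i j 1"
proof -
  interpret field_hom \<sigma> by (rule field_hom_endomorphism[OF \<sigma>])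
  show "map_mat \<sigma> (outer (unit i) (unit j)) = outer (unit i) (unit j)" "map_mat \<sigma> (row_elem i j 1) = row_elem i j 1"
    unfolding row_elem_def map_mat_outer[OF \<sigma>] by (auto intro!: outer_cong simp: unit_def hom_distribs)
qed

lemma one_smult: "1 \<cdot>\<^sub>m (A :: complex mat) = A"
  by (auto intro!: eq_matI)

definition diag :: "(nat \<Rightarrow> complex) \<Rightarrow> complex mat" where
  "diag d = mat n n (\<lambda>(i, j). if i = j then d i else 0)"

lemma diag_carrier [simp]: "diag d \<in> carrier_mat n n" by (simp add: diag_def)

lemma diag_mult_mat:
  assumes "A \<in> carrier_mat n n" "i < n" "j < n" shows "(diag d * A) $$ (i, j) = d i * A $$ (i, j)"
  using assms by (simp add: mult_mat_index diag_def if_distrib[of "\<lambda>c. c * _"] cong: if_cong del: index_mult_mat(1))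

lemma diag_mult: "diag d * diag e = diag (\<lambda>i. d i * e i)"
proof (rule eq_matI)
  fix i j assume "i < dim_row (diag (\<lambda>i. d i * e i))" "j < dim_col (diag (\<lambda>i. d i * e i))"
  then have ij: "i < n" "j < n" by (auto simp: diag_def)
  show "(diag d * diag e) $$ (i, j) = diag (\<lambda>i. d i * e i) $$ (i, j)"
    unfolding diag_mult_mat[OF diag_carrier ij] using ij by (simp add: diag_def)
qed (auto simp: diag_def)

lemma det_diag: "det (diag d) = (\<Prod>i<n. d i)"
  by (subst det_upper_triangular[of _ n]) (auto simp: upper_triangular_def diag_def prod_list_diag_prod atLeast0LessThan)

lemma diag_pow: "diag d ^\<^sub>m k = diag (\<lambda>i. d i ^ k)"
proof (induction k)
  case 0
  show ?case by (auto simp: diag_def intro!: eq_matI)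
next
  case (Suc k)
  then show ?case by (simp add: diag_mult mult.commute)
qed

text \<open>Up to a scalar, \<open>f\<close> is entrywise application of \<open>\<sigma>\<close>; the scalar is a character of the special linear
  group with values in the roots of unity of order \<open>n\<close>. It kills powers with exponent \<open>n\<close>, in particular
  transvections and diagonal matrices, and these generate.\<close>

lemma sl_aut_normal:
  assumes f: "sl_aut f" and \<sigma>: "nonzero_field_endomorphism \<sigma>" and s: "s ^ n = - 1" and \<mu>: "\<mu> ^ n = - 1"
    and refl: "\<And>P. P \<in> rank_one \<Longrightarrow> f (reflection s P) = reflection \<mu> (map_mat \<sigma> P)"
    and A: "A \<in> G"
  shows "f A = map_mat \<sigma> A"
proof -
  note D = sl_autD[OF f]
  interpret \<sigma>: field_hom \<sigma> by (rule field_hom_endomorphism[OF \<sigma>])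
  have scalar: "\<exists>c. f A = c \<cdot>\<^sub>m map_mat \<sigma> A" if A: "A \<in> G" for A
  proof -
    define B where "B = map_mat \<sigma> A"
    define B' where "B' = map_mat \<sigma> (mi A)"
    have AA: "inverse_pair A (mi A)" by (rule G_inverse_pair[OF A])
    have BB: "inverse_pair B B'" unfolding B_def B'_def by (rule map_mat_inverse_pair[OF \<sigma> AA])
    have FF: "inverse_pair (f A) (mi (f A))" by (rule G_inverse_pair[OF D(1)[OF A]])
    define Y where "Y = B' * f A"
    have carr: "B \<in> carrier_mat n n" "B' \<in> carrier_mat n n" "f A \<in> carrier_mat n n" "mi (f A) \<in> carrier_mat n n"
      using BB FF by (auto simp: inverse_pair_def)
    \<comment> \<open>Computing the image of a conjugated reflection in two ways shows that
      \<open>f A\<close> and \<open>B\<close> conjugate \<open>map_mat \<sigma> P\<close> to the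
      same matrix, so \<open>Y\<close> centralizes it.\<close>
    have YP: "Y * map_mat \<sigma> P = map_mat \<sigma> P * Y" if P: "P \<in> rank_one" for P
    proof -
      have Pc: "P \<in> carrier_mat n n" and P': "map_mat \<sigma> P \<in> rank_one" "map_mat \<sigma> P \<in> carrier_mat n n"
        using rank_one_carrier[OF P] map_mat_rank_one[OF \<sigma> P] rank_one_carrier by auto
      have rG: "reflection s P \<in> G" using reflection_G_iff[OF P] s by simp
      have "reflection \<mu> (f A * map_mat \<sigma> P * mi (f A)) = f A * f (reflection s P) * f (mi A)"
        using conj_reflection[OF FF P'(2)] refl[OF P] D(6)[OF A] by simp
      also have "\<dots> = f (A * reflection s P * mi A)"
        using D(2)[OF A rG] D(2)[OF mult_G[OF A rG] mi_G[OF A]] by simp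
      also have "\<dots> = f (reflection s (A * P * mi A))" using conj_reflection[OF AA Pc] by simp
      also have "\<dots> = reflection \<mu> (map_mat \<sigma> (A * P * mi A))" using refl[OF conj_rank_one[OF AA P]] .
      also have "map_mat \<sigma> (A * P * mi A) = B * map_mat \<sigma> P * B'"
        unfolding B_def B'_def using A mi_G[OF A] Pc by (simp add: map_mat_mult[OF \<sigma>] G_carrier mult_carrier_mat[of _ n n _ n])
      finally have "f A * map_mat \<sigma> P * mi (f A) = B * map_mat \<sigma> P * B'"
        using reflection_eq_iff[OF conj_rank_one[OF FF P'(1)] conj_rank_one[OF BB P'(1)] \<mu>] by simp
      then have "B' * (f A * map_mat \<sigma> P * mi (f A)) * f A = B' * (B * map_mat \<sigma> P * B') * f A" by simp
      moreover have "B' * (f A * map_mat \<sigma> P * mi (f A)) * f A = Y * map_mat \<sigma> P"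
        using carr P'(2) FF by (simp add: mat_assoc Y_def inverse_pair_def)
      moreover have "B' * (B * map_mat \<sigma> P * B') * f A = map_mat \<sigma> P * Y"
        using carr P'(2) by (simp add: mat_assoc Y_def inverse_pair_cancel[OF BB])
      ultimately show ?thesis by simp
    qed
    have Yc: "Y \<in> carrier_mat n n" using carr by (simp add: Y_def)
    obtain c where c: "Y = c \<cdot>\<^sub>m 1\<^sub>m n"
    \<comment> \<open>A matrix unit is a difference of two rank one idempotents with entries 0 and
      1, which \<sigma> leaves unchanged.\<close>
    proof (rule commute_elementary_scalar[OF Yc])
      fix i j assume ij: "i < n" "j < n" "i \<noteq> j"
      have R: "E i \<in> rank_one" "row_elem i j 1 \<in> rank_one"
        using E_rank_one ij row_rank_one[OF ij(1) row_elem] by auto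
      have N: "outer (unit i) (unit j) = row_elem i j 1 - E i"
        by (auto simp: row_elem_def algebra_simps intro!: eq_matI)
      have c2: "row_elem i j 1 \<in> carrier_mat n n" "E i \<in> carrier_mat n n" by (simp_all add: row_elem_def)
      have "Y * outer (unit i) (unit j) = Y * row_elem i j 1 - Y * E i"
        unfolding N using Yc c2 by (intro mult_minus_distrib_mat[of _ n n _ n]) auto
      moreover have "outer (unit i) (unit j) * Y = row_elem i j 1 * Y - E i * Y"
        unfolding N using Yc c2 by (intro minus_mult_distrib_mat[of _ n n _ _ n]) auto
      ultimately show "Y * outer (unit i) (unit j) = outer (unit i) (unit j) * Y"
        using YP[OF R(1)] YP[OF R(2)] by (simp add: map_mat_unit[OF \<sigma>])
    qed
    have "f A = B * Y" using inverse_pair_cancel(1)[OF BB carr(3)] by (simp add: Y_def)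
    also have "\<dots> = c \<cdot>\<^sub>m B" unfolding c using carr by (simp add: mult_smult_distrib[of _ n n _ n])
    finally show ?thesis by (auto simp: B_def)
  qed
  have mult: "f (X * Y) = map_mat \<sigma> (X * Y)" if "X \<in> G" "Y \<in> G" "f X = map_mat \<sigma> X" "f Y = map_mat \<sigma> Y" for X Y
    using that D(2) by (simp add: map_mat_mult[OF \<sigma>] G_carrier)
  \<comment> \<open>The scalar belonging to \<open>Z\<close> satisfies \<open>c ^ n = 1\<close> by
    determinants, and the scalar belonging to the power is \<open>c ^ n\<close>.\<close>
  have pow: "f (Z ^\<^sub>m n) = map_mat \<sigma> (Z ^\<^sub>m n)" if Z: "Z \<in> G" for Z
  proof -
    obtain c where c: "f Z = c \<cdot>\<^sub>m map_mat \<sigma> Z" using scalar[OF Z] by blast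
    have Zc: "Z \<in> carrier_mat n n" using G_carrier[OF Z] .
    have "det (f Z) = c ^ n * det (map_mat \<sigma> Z)" unfolding c using Zc by simp
    then have cn: "c ^ n = 1" using D(1)[OF Z] map_mat_G[OF \<sigma> Z] by (simp add: G_iff)
    have "Z ^\<^sub>m k \<in> G \<and> f (Z ^\<^sub>m k) = c ^ k \<cdot>\<^sub>m map_mat \<sigma> (Z ^\<^sub>m k)" for k
    proof (induction k)
      case 0
      show ?case using Zc D(5) one_G by (auto simp: \<sigma>.mat_hom_one intro!: eq_matI)
    next
      case (Suc k)
      then have Zk: "Z ^\<^sub>m k \<in> G" "f (Z ^\<^sub>m k) = c ^ k \<cdot>\<^sub>m map_mat \<sigma> (Z ^\<^sub>m k)" by auto
      have "f (Z ^\<^sub>m Suc k) = (c ^ k \<cdot>\<^sub>m map_mat \<sigma> (Z ^\<^sub>m k)) * (c \<cdot>\<^sub>m map_mat \<sigma> Z)"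
        using D(2)[OF Zk(1) Z] Zk(2) c by simp
      also have "\<dots> = c \<cdot>\<^sub>m (c ^ k \<cdot>\<^sub>m (map_mat \<sigma> (Z ^\<^sub>m k) * map_mat \<sigma> Z))"
        using G_carrier[OF Zk(1)] Zc by (simp add: mult_smult_distrib[of _ n n _ n] mult_smult_assoc_mat[of _ n n _ n])
      also have "map_mat \<sigma> (Z ^\<^sub>m k) * map_mat \<sigma> Z = map_mat \<sigma> (Z ^\<^sub>m Suc k)"
        using map_mat_mult[OF \<sigma> G_carrier[OF Zk(1)] Zc] by simp
      also have "c \<cdot>\<^sub>m (c ^ k \<cdot>\<^sub>m map_mat \<sigma> (Z ^\<^sub>m Suc k)) = c ^ Suc k \<cdot>\<^sub>m map_mat \<sigma> (Z ^\<^sub>m Suc k)"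
        by (auto intro!: eq_matI simp del: pow_mat.simps)
      finally show ?case using mult_G[OF Zk(1) Z] by simp
    qed
    then show ?thesis using cn by (simp add: one_smult)
  qed
  \<comment> \<open>The scalars of \<open>T\<close> and its inverse cancel, so the claim is
    invariant under conjugation.\<close>
  have conj: "f (S * X * S') = map_mat \<sigma> (S * X * S')"
    if S: "inverse_pair S S'" and X: "X \<in> G" "f X = map_mat \<sigma> X" for S S' X
  proof -
    obtain T where T: "T \<in> G" "T * X * mi T = S * X * S'" using conj_by_G[OF S] G_carrier[OF X(1)] by metis
    have T': "mi T \<in> G" using mi_G[OF T(1)] .
    obtain c where c: "f T = c \<cdot>\<^sub>m map_mat \<sigma> T" using scalar[OF T(1)] by blast
    obtain d where d: "f (mi T) = d \<cdot>\<^sub>m map_mat \<sigma> (mi T)" using scalar[OF T'] by blast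
    have cc: "map_mat \<sigma> T \<in> carrier_mat n n" "map_mat \<sigma> (mi T) \<in> carrier_mat n n" "map_mat \<sigma> X \<in> carrier_mat n n"
      using T(1) T' X(1) G_carrier by auto
    have Ti: "T * mi T = 1\<^sub>m n" using G_inverse_pair[OF T(1)] by (simp add: inverse_pair_def)
    have TT: "map_mat \<sigma> T * map_mat \<sigma> (mi T) = 1\<^sub>m n"
      using map_mat_mult[OF \<sigma> G_carrier[OF T(1)] G_carrier[OF T']] Ti by (simp add: \<sigma>.mat_hom_one)
    have "1\<^sub>m n = f T * f (mi T)" using D(2)[OF T(1) T'] D(5) Ti by simp
    also have "\<dots> = d \<cdot>\<^sub>m (c \<cdot>\<^sub>m 1\<^sub>m n)"
      unfolding c d using cc TT by (simp add: mult_smult_distrib[of _ n n _ n] mult_smult_assoc_mat[of _ n n _ n])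
    finally have "(1\<^sub>m n :: complex mat) $$ (0, 0) = (d \<cdot>\<^sub>m (c \<cdot>\<^sub>m 1\<^sub>m n)) $$ (0, 0)" by simp
    then have "c * d = 1" using n3 by (simp add: mult.commute)
    have "f (T * X * mi T) = f T * f X * f (mi T)" using D(2) mult_G T(1) T' X(1) by simp
    also have "\<dots> = d \<cdot>\<^sub>m (c \<cdot>\<^sub>m (map_mat \<sigma> T * map_mat \<sigma> X * map_mat \<sigma> (mi T)))"
      unfolding c d X(2) using cc by (simp add: mult_smult_distrib[of _ n n _ n] mult_smult_assoc_mat[of _ n n _ n])
    also have "\<dots> = (c * d) \<cdot>\<^sub>m (map_mat \<sigma> T * map_mat \<sigma> X * map_mat \<sigma> (mi T))"
      using cc by (auto intro!: eq_matI simp del: index_mult_mat(1))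
    also have "\<dots> = map_mat \<sigma> (T * X * mi T)"
      using \<open>c * d = 1\<close> map_mat_mult[OF \<sigma>] T(1) T' X(1) G_carrier mult_carrier_mat[of T n n X n]
      by (simp add: one_smult)
    finally show ?thesis using T(2) by simp
  qed
  have transvection: "f (comb 1 1 (outer x g)) = map_mat \<sigma> (comb 1 1 (outer x g))" if xg: "dot g x = 0" for x g
  proof -
    \<comment> \<open>A transvection has the transvection with parameter divided by \<open>n\<close>
      as a root of order \<open>n\<close>, because \<open>N\<close> has square zero.\<close>
    define N where "N = outer (\<lambda>i. 1 / of_nat n * x i) g"
    have dN: "dot g (\<lambda>i. c * x i) = 0" for c using xg by (simp add: dot_simps)
    have Z: "comb 1 1 N \<in> G" unfolding N_def using dN by (intro transvection_G)
    have "comb 1 1 N ^\<^sub>m k = comb 1 1 (outer (\<lambda>i. of_nat k / of_nat n * x i) g)" for k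
    proof (induction k)
      case 0
      show ?case by (auto simp: comb_def N_def intro!: eq_matI)
    next
      case (Suc k)
      then have "comb 1 1 N ^\<^sub>m Suc k = comb 1 1 (outer (\<lambda>i. of_nat k / of_nat n * x i) g) * comb 1 1 N" by simp
      also have "\<dots> = comb 1 1 (outer (\<lambda>i. of_nat (Suc k) / of_nat n * x i) g)"
        unfolding N_def comb_mult[OF outer_carrier(1) outer_carrier(1)] outer_mult dN
        by (auto simp: comb_def algebra_simps add_divide_distrib intro!: eq_matI)
      finally show ?case .
    qed
    from this[of n] have "comb 1 1 N ^\<^sub>m n = comb 1 1 (outer x g)" using n3 by simp
    then show ?thesis using pow[OF Z] by simp
  qed
  have diagonal: "f (diag d) = map_mat \<sigma> (diag d)" if d: "(\<Prod>i<n. d i) = 1" for d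
  proof -
    have "\<forall>i. \<exists>e. e ^ n = d i" using complex_root_exists[of n] n3 by (metis less_le_trans zero_less_numeral)
    then obtain e where e: "\<And>i. e i ^ n = d i" by metis
    define w where "w = (\<Prod>i<n. e i)"
    have "w ^ n = 1" unfolding w_def prod_power_distrib e d ..
    \<comment> \<open>Roots of the diagonal entries have a product \<open>w\<close> that need not be
      1. It is a root of unity of order \<open>n\<close>, so dividing one entry by it restores
      determinant one and keeps the powers.\<close>
    define e' where "e' = (\<lambda>i. if i = 0 then e 0 / w else e i)"
    have w0: "w \<noteq> 0" using \<open>w ^ n = 1\<close> n3 by (auto simp: power_0_left)
    have e': "e' i ^ n = d i" for i using e \<open>w ^ n = 1\<close> by (simp add: e'_def power_divide)
    have split: "{..<n} = insert 0 {1..<n}" using n3 by auto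
    have "(\<Prod>i<n. e' i) = e 0 / w * (\<Prod>i\<in>{1..<n}. e i)"
      unfolding split by (subst prod.insert) (auto simp: e'_def intro!: prod.cong)
    moreover have "w = e 0 * (\<Prod>i\<in>{1..<n}. e i)" unfolding w_def split by (subst prod.insert) auto
    ultimately have "(\<Prod>i<n. e' i) = 1" using w0 by simp
    then have "diag e' \<in> G" by (simp add: G_iff det_diag)
    from pow[OF this] show ?thesis by (simp add: diag_pow e')
  qed
  have triangular: "f B = map_mat \<sigma> B" if B: "B \<in> G" "upper_triangular B" for B
  proof -
    have Bc: "B \<in> carrier_mat n n" using G_carrier[OF B(1)] .
    define d where "d i = B $$ (i, i)" for i
    have "det B = (\<Prod>i<n. d i)"
      using det_upper_triangular[OF B(2) Bc] Bc by (simp add: prod_list_diag_prod d_def atLeast0LessThan)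
    then have d: "(\<Prod>i<n. d i) = 1" using B(1) by (simp add: G_iff)
    then have d0: "d i \<noteq> 0" if "i < n" for i using that by (metis finite_lessThan lessThan_iff prod_zero zero_neq_one)
    \<comment> \<open>The unitriangular factor of \<open>B\<close> after its diagonal is pulled out,
      filled only in the columns below \<open>k\<close>. Column \<open>k\<close> is added by the
      transvection \<open>?t\<close> from the left, which works because row \<open>k\<close> of
      \<open>V k\<close> is still a unit vector.\<close>
    define V where "V k = mat n n (\<lambda>(i, j). if i = j then 1 else if i < j \<and> j < k then B $$ (i, j) / d i else 0)" for k
    have Vc: "V k \<in> carrier_mat n n" for k by (simp add: V_def)
    have V: "k \<le> n \<Longrightarrow> V k \<in> G \<and> f (V k) = map_mat \<sigma> (V k)" for k
    proof (induction k)
      case 0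
      have "V 0 = 1\<^sub>m n" by (auto simp: V_def intro!: eq_matI)
      then show ?case using one_G D(5) by (simp add: \<sigma>.mat_hom_one)
    next
      case (Suc k)
      define v where "v i = (if i < k then B $$ (i, k) / d i else 0)" for i
      have k: "k < n" using Suc.prems by simp
      have dv: "dot (unit k) v = 0" using k by (simp add: dot_unit v_def)
      let ?t = "comb 1 1 (outer v (unit k))"
      have "?t * V k = 1\<^sub>m n * V k + outer v (unit k) * V k"
      proof -
        have "?t = 1\<^sub>m n + outer v (unit k)" by (auto simp: comb_def intro!: eq_matI)
        then show ?thesis using add_mult_distrib_mat[of "1\<^sub>m n" n n "outer v (unit k)" "V k" n] Vc by simp
      qed
      also have "outer v (unit k) * V k = outer v (unit k)"
        unfolding outer_mult_mat[OF Vc]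
      proof (rule outer_cong)
        fix j assume j: "j < n"
        have "apply_mat (transpose_mat (V k)) (unit k) j = V k $$ (k, j)"
          using k j Vc by (simp add: apply_mat_def unit_def of_bool_def if_distrib[of "\<lambda>c. _ * c"] cong: if_cong)
            (simp add: V_def)
        then show "apply_mat (transpose_mat (V k)) (unit k) j = unit k j"
          using k j by (auto simp: V_def unit_def)
      qed simp
      also have "1\<^sub>m n * V k + outer v (unit k) = V (Suc k)"
        using Vc k by (auto simp: V_def v_def unit_def less_Suc_eq intro!: eq_matI)
      finally have eq: "V (Suc k) = ?t * V k" ..
      have "?t \<in> G" by (rule transvection_G[OF dv])
      then show ?case unfolding eq using Suc k mult[OF _ _ transvection[OF dv]] mult_G by simp
    qed
    have "B = diag d * V n"
    proof (rule eq_matI)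
      fix i j assume "i < dim_row (diag d * V n)" "j < dim_col (diag d * V n)"
      then have ij: "i < n" "j < n" by (auto simp: diag_def V_def)
      show "B $$ (i, j) = (diag d * V n) $$ (i, j)"
        unfolding diag_mult_mat[OF Vc ij] using ij d0 B(2) Bc by (auto simp: V_def d_def upper_triangular_def)
    qed (use Bc Vc in \<open>auto simp: diag_def V_def\<close>)
    moreover have "diag d \<in> G" using d by (simp add: G_iff det_diag)
    ultimately show ?thesis using mult[OF _ _ diagonal[OF d]] V[of n] by simp
  qed
  have Ac: "A \<in> carrier_mat n n" using G_carrier[OF A] .
  obtain as where "char_poly A = (\<Prod>a\<leftarrow>as. [:- a, 1:])" using char_poly_factorized[OF Ac] by blast
  then obtain B where B: "B \<in> carrier_mat n n" "upper_triangular B" "similar_mat A B"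
    using schur_decomposition_exists[OF Ac] by blast
  then obtain S S' where "similar_mat_wit A B S S'" by (auto simp: similar_mat_def)
  then have S: "inverse_pair S S'" "A = S * B * S'"
    using Ac by (auto simp: similar_mat_wit_def Let_def inverse_pair_def)
  have "B = S' * A * S" using conj_conj[OF S(1) B(1)] S(2) by simp
  then have BG: "B \<in> G" using conj_G[OF inverse_pair_sym[OF S(1)] A] by simp
  show ?thesis using conj[OF S(1) BG triangular[OF BG B(2)]] S(2) by simp
qed

section \<open>Local automorphisms\<close>

lemma mi_reflection:
  assumes P: "P \<in> rank_one" and s: "s \<noteq> 0" shows "inverse_pair (reflection s P) (reflection (1 / s) P)"
proof -
  have c: "P \<in> carrier_mat n n" "P * P = P" using rank_one_carrier[OF P] rank_one_idem[OF P] .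
  have "reflection a P * reflection b P = (a * b) \<cdot>\<^sub>m 1\<^sub>m n" for a b
    unfolding reflection_def comb_mult_idem[OF c] using c(1) by (auto simp: comb_def intro!: eq_matI)
  then show ?thesis using s c by (simp add: inverse_pair_def reflection_carrier one_smult)
qed

lemma comb_inverse_pair:
  assumes P: "P \<in> rank_one" and ab: "a \<noteq> 0" "a + b \<noteq> 0"
  shows "inverse_pair (comb a b P) (comb (1 / a) (1 / (a + b) - 1 / a) P)"
proof -
  have c: "P \<in> carrier_mat n n" "P * P = P" using rank_one_carrier[OF P] rank_one_idem[OF P] .
  have 0: "a * (1 / (a + b) - 1 / a) + b * (1 / a) + b * (1 / (a + b) - 1 / a) = 0"
  proof -
    define u v where "u = 1 / (a + b)" and "v = 1 / a"
    have "(a + b) * u = 1" "a * v = 1" using ab by (simp_all add: u_def v_def)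
    moreover have "a * (u - v) + b * v + b * (u - v) = (a + b) * u - a * v" by (simp add: algebra_simps)
    ultimately show ?thesis by (simp add: u_def v_def)
  qed
  have one: "comb 1 0 P = 1\<^sub>m n" using c(1) by (auto simp: comb_def intro!: eq_matI)
  have "comb a b P * comb (1 / a) (1 / (a + b) - 1 / a) P = 1\<^sub>m n"
    unfolding comb_mult_idem[OF c] 0 using ab one by simp
  moreover have "1 / a * b + (1 / (a + b) - 1 / a) * a + (1 / (a + b) - 1 / a) * b = 0"
    using 0 by (simp add: algebra_simps)
  then have "comb (1 / a) (1 / (a + b) - 1 / a) P * comb a b P = 1\<^sub>m n"
    unfolding comb_mult_idem[OF c] using ab one by simp
  ultimately show ?thesis using c by (simp add: inverse_pair_def)
qed

lemma transpose_comb: "P \<in> carrier_mat n n \<Longrightarrow> transpose_mat (comb a b P) = comb a b (transpose_mat P)"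
  by (auto simp: comb_def intro!: eq_matI)

lemma transpose_rank_one: "P \<in> rank_one \<Longrightarrow> transpose_mat P \<in> rank_one"
  using orth_auto_closed[OF orth_auto_transpose] .

lemma ct_comb:
  assumes P: "P \<in> rank_one" and ab: "a \<noteq> 0" "a + b \<noteq> 0"
  shows "ct (comb a b P) = comb (1 / a) (1 / (a + b) - 1 / a) (transpose_mat P)"
  using mi[OF comb_inverse_pair[OF assms]] transpose_comb[OF rank_one_carrier[OF P]] by (simp add: ct_def)

lemma ct_reflection:
  assumes P: "P \<in> rank_one" and s: "s \<noteq> 0"
  shows "ct (reflection s P) = reflection (1 / s) (transpose_mat P)"
  using mi[OF mi_reflection[OF assms]] transpose_comb[OF rank_one_carrier[OF P]]
  by (simp add: ct_def reflection_def)

lemma root_nonzero: "s ^ n = - 1 \<Longrightarrow> s \<noteq> (0 :: complex)"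
  using n3 by (auto simp: power_0_left)

lemma root_inverse: "s ^ n = - 1 \<Longrightarrow> (1 / s :: complex) ^ n = - 1"
  by (simp add: power_divide)

definition standard :: "(complex mat \<Rightarrow> complex mat) \<Rightarrow> bool" where
  "standard \<phi> \<longleftrightarrow> (\<exists>S S' \<sigma>. inverse_pair S S' \<and> nonzero_field_endomorphism \<sigma> \<and>
    ((\<forall>A\<in>G. \<phi> A = S * map_mat \<sigma> A * S') \<or> (\<forall>A\<in>G. \<phi> A = S * ct (map_mat \<sigma> A) * S')))"

text \<open>The reduction to maps that act entrywise on reflections is the same for automorphisms
  and for local automorphisms; the class \<open>C\<close> allows it to be used for both. Only
  \<open>normal\<close> differs, and for local automorphisms it relies on the outcome for
  automorphisms. In the transposed case the contragredient is applied first, which replaces \<mu> by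
  its inverse.\<close>

lemma standard_form:
  assumes s: "s ^ n = - 1" and \<phi>: "C \<phi>"
    and comp: "\<And>h \<phi>. sl_aut h \<Longrightarrow> C \<phi> \<Longrightarrow> C (\<lambda>A. h (\<phi> A))"
    and loc: "\<And>\<phi>. C \<phi> \<Longrightarrow> local_aut \<phi>"
    and normal: "\<And>\<phi> \<sigma> \<mu> A. C \<phi> \<Longrightarrow> nonzero_field_endomorphism \<sigma> \<Longrightarrow> \<mu> ^ n = - 1 \<Longrightarrow>
      (\<And>P. P \<in> rank_one \<Longrightarrow> \<phi> (reflection s P) = reflection \<mu> (map_mat \<sigma> P)) \<Longrightarrow> A \<in> G \<Longrightarrow> \<phi> A = map_mat \<sigma> A"
  shows "standard \<phi>"
proof -
  have \<phi>G: "\<phi> A \<in> G" if A: "A \<in> G" for A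
  proof -
    obtain f where "sl_aut f" "\<phi> A = f A" using loc[OF \<phi>] A unfolding local_aut_def by blast
    then show ?thesis using sl_autD(1)[of f A] A by simp
  qed
  obtain \<mu> \<psi> where \<mu>: "\<mu> ^ n = - 1" "local_orth_auto \<psi>"
    and \<psi>: "\<And>P. P \<in> rank_one \<Longrightarrow> \<phi> (reflection s P) = reflection \<mu> (\<psi> P)"
    using local_aut_reflection[OF loc[OF \<phi>] s] by metis
  obtain S S' \<sigma> where S: "inverse_pair S S'" and \<sigma>: "nonzero_field_endomorphism \<sigma>" and
    either: "(\<forall>P\<in>rank_one. \<psi> P = S * map_mat \<sigma> P * S') \<or> (\<forall>P\<in>rank_one. transpose_mat (\<psi> P) = S * map_mat \<sigma> P * S')"
    using local_orth_auto_semilinear[OF \<mu>(2)] by metis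
  have conj: "S' * reflection \<nu> (S * map_mat \<sigma> P * S') * S = reflection \<nu> (map_mat \<sigma> P)" if "P \<in> rank_one" for P \<nu>
  proof -
    have "map_mat \<sigma> P \<in> carrier_mat n n" using rank_one_carrier[OF that] by simp
    then show ?thesis
      using conj_reflection[OF inverse_pair_sym[OF S] conj_carrier[OF S], of "map_mat \<sigma> P" \<nu>] conj_conj[OF S] by simp
  qed
  have unconj: "A = S * B * S'" if "S' * A * S = B" "A \<in> carrier_mat n n" for A B
    using conj_conj[OF inverse_pair_sym[OF S] that(2)] that(1) by simp
  from either show ?thesis
  proof
    assume 1: "\<forall>P\<in>rank_one. \<psi> P = S * map_mat \<sigma> P * S'"
    have "S' * \<phi> A * S = map_mat \<sigma> A" if "A \<in> G" for A
      using \<psi> 1 conj that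
      by (intro normal[OF comp[OF sl_aut_conj[OF inverse_pair_sym[OF S]] \<phi>] \<sigma> \<mu>(1)]) simp_all
    then have "\<forall>A\<in>G. \<phi> A = S * map_mat \<sigma> A * S'" using unconj \<phi>G G_carrier by blast
    then show ?thesis unfolding standard_def using S \<sigma> by blast
  next
    assume 2: "\<forall>P\<in>rank_one. transpose_mat (\<psi> P) = S * map_mat \<sigma> P * S'"
    have "S' * ct (\<phi> A) * S = map_mat \<sigma> A" if A: "A \<in> G" for A
    proof (rule normal[OF comp[OF sl_aut_conj[OF inverse_pair_sym[OF S]] comp[OF sl_aut_ct \<phi>]] \<sigma> root_inverse[OF \<mu>(1)] _ A])
      fix P assume P: "P \<in> rank_one"
      show "S' * ct (\<phi> (reflection s P)) * S = reflection (1 / \<mu>) (map_mat \<sigma> P)"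
        unfolding \<psi>[OF P] ct_reflection[OF local_orth_autoD(1)[OF \<mu>(2) P P] root_nonzero[OF \<mu>(1)]]
        using 2 P conj[OF P] by simp
    qed
    then have ct: "ct (\<phi> A) = S * map_mat \<sigma> A * S'" if "A \<in> G" for A
      using unconj[OF _ G_carrier[OF ct_G[OF \<phi>G[OF that]]]] that by simp
    have ctS: "ct S = transpose_mat S'" "ct S' = transpose_mat S"
      using ct_inverse_pair(1)[OF S] ct_inverse_pair(1)[OF inverse_pair_sym[OF S]] .
    have "\<phi> A = transpose_mat S' * ct (map_mat \<sigma> A) * transpose_mat S" if A: "A \<in> G" for A
    proof -
      have B: "inverse_pair (map_mat \<sigma> A) (mi (map_mat \<sigma> A))" by (rule G_inverse_pair[OF map_mat_G[OF \<sigma> A]])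
      have "\<phi> A = ct (ct (\<phi> A))" using ct_inverse_pair(3)[OF G_inverse_pair[OF \<phi>G[OF A]]] by simp
      also have "\<dots> = ct (S * map_mat \<sigma> A) * ct S'"
        unfolding ct[OF A] by (rule ct_mult[OF inverse_pair_mult[OF S B] inverse_pair_sym[OF S]])
      also have "ct (S * map_mat \<sigma> A) = ct S * ct (map_mat \<sigma> A)" by (rule ct_mult[OF S B])
      finally show ?thesis by (simp add: ctS)
    qed
    then show ?thesis unfolding standard_def using \<sigma> inverse_pair_transpose[OF S] by blast
  qed
qed

lemma exists_root: obtains s :: complex where "s ^ n = - 1"
  using complex_root_exists[of n] n3 by auto

lemma sl_aut_standard: "sl_aut f \<Longrightarrow> standard f"
proof -
  assume f: "sl_aut f"
  obtain s :: complex where s: "s ^ n = - 1" by (rule exists_root)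
  show ?thesis
  proof (rule standard_form[where C = sl_aut, OF s f])
    show "sl_aut (\<lambda>A. h (\<phi> A))" if "sl_aut h" "sl_aut \<phi>" for h \<phi>
      using sl_aut_comp[OF that] by (simp add: comp_def)
  qed (auto intro: sl_aut_local sl_aut_normal[OF _ _ s])
qed

lemma biorth_zero:
  assumes "biorth n X F" "\<And>k. k < n \<Longrightarrow> dot (F k) z = 0" "i < n" shows "z i = 0"
proof -
  obtain S S' where S: "inverse_pair S S'" "\<And>i j. i < n \<Longrightarrow> j < n \<Longrightarrow> S' $$ (i, j) = F i j"
    using biorth_matrices[OF assms(1)] by metis
  have c: "S \<in> carrier_mat n n" "S' \<in> carrier_mat n n" "S * S' = 1\<^sub>m n" using S(1) by (auto simp: inverse_pair_def)
  have "apply_mat S' z k = 0" if "k < n" for k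
    using assms(2)[OF that] S(2) that by (simp add: apply_mat_def dot_def)
  then have "apply_mat S (apply_mat S' z) i = 0" by (simp add: apply_mat_def)
  then show ?thesis using apply_mat_mult[OF c(1,2) assms(3)] apply_mat_one[OF assms(3)] c(3) by simp
qed

lemma apply_mat_unit:
  assumes "i < n" "j < n" shows "apply_mat A (unit j) i = A $$ (i, j)"
  using assms by (simp add: apply_mat_def unit_def of_bool_def if_distrib[of "\<lambda>c. _ * c"] cong: if_cong)

text \<open>A nonscalar matrix is determined by the rank one compressions \<open>P A P\<close> that happen to be \<open>0\<close> or \<open>P\<close>:
  if \<open>x\<close> is not an eigenvector, then \<open>x\<close> and \<open>A x\<close> start a basis.\<close>

lemma compression_determines:
  assumes \<sigma>: "nonzero_field_endomorphism \<sigma>" and A: "A \<in> carrier_mat n n" and B: "B \<in> carrier_mat n n"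
    and ns: "\<And>c. A \<noteq> c \<cdot>\<^sub>m 1\<^sub>m n"
    and H: "\<And>P t. P \<in> rank_one \<Longrightarrow> t \<in> {0, 1} \<Longrightarrow> P * A * P = t \<cdot>\<^sub>m P \<Longrightarrow>
      map_mat \<sigma> P * B * map_mat \<sigma> P = t \<cdot>\<^sub>m map_mat \<sigma> P"
  shows "B = map_mat \<sigma> A"
proof -
  interpret field_hom \<sigma> by (rule field_hom_endomorphism[OF \<sigma>])
  define \<Sigma> where "\<Sigma> = (\<lambda>(x :: nat \<Rightarrow> complex) i. \<sigma> (x i))"
  have dot\<Sigma>: "dot (\<Sigma> f) (\<Sigma> x) = \<sigma> (dot f x)" for f x
    unfolding \<Sigma>_def by (rule dot_endomorphism[OF \<sigma>])
  have compress: "outer x f * M * outer x f = dot f (apply_mat M x) \<cdot>\<^sub>m outer x f" if "M \<in> carrier_mat n n" for x f M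
  proof -
    have "outer x f * M * outer x f = outer x f * (M * outer x f)"
      using that by (intro assoc_mult_mat[of _ n n _ n _ n]) auto
    then show ?thesis by (simp add: mult_outer[OF that] outer_mult)
  qed
  have H': "dot (\<Sigma> f) (apply_mat B (\<Sigma> x)) = t"
    if fx: "dot f x = 1" and t: "dot f (apply_mat A x) = t" "t \<in> {0, 1}" for f x t
  proof -
    have "outer (\<Sigma> x) (\<Sigma> f) * B * outer (\<Sigma> x) (\<Sigma> f) = t \<cdot>\<^sub>m outer (\<Sigma> x) (\<Sigma> f)"
      using H[OF rank_oneI[OF fx] t(2)] compress[OF A, of x f] t(1)
      by (simp add: map_mat_outer[OF \<sigma>] \<Sigma>_def)
    then have eq: "dot (\<Sigma> f) (apply_mat B (\<Sigma> x)) \<cdot>\<^sub>m outer (\<Sigma> x) (\<Sigma> f) = t \<cdot>\<^sub>m outer (\<Sigma> x) (\<Sigma> f)"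
      by (simp add: compress[OF B])
    have "dot (\<Sigma> f) (\<Sigma> x) \<noteq> 0" using fx by (simp add: dot\<Sigma>)
    then obtain i j where ij: "i < n" "j < n" "\<Sigma> x i \<noteq> 0" "\<Sigma> f j \<noteq> 0" using dot_nonzero by blast
    have "dot (\<Sigma> f) (apply_mat B (\<Sigma> x)) * (\<Sigma> x i * \<Sigma> f j) = t * (\<Sigma> x i * \<Sigma> f j)"
      using arg_cong[OF eq, of "\<lambda>M. M $$ (i, j)"] ij by simp
    then show ?thesis using ij by simp
  qed
  \<comment> \<open>The vectors at which \<open>B\<close> takes the value that the entrywise image
    of \<open>A\<close> would give.\<close>
  define good where "good x \<longleftrightarrow> (\<forall>i<n. apply_mat B (\<Sigma> x) i = \<sigma> (apply_mat A x i))" for x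
  have noneig: "good x" if x: "\<not> parallel (apply_mat A x) x" for x
  proof -
    define y where "y = apply_mat A x"
    have x0: "\<exists>i<n. x i \<noteq> 0"
    proof (rule ccontr)
      assume "\<not> ?thesis"
      then have "\<forall>i<n. apply_mat A x i = 0 * x i" by (simp add: apply_mat_def)
      then show False using x unfolding parallel_def by blast
    qed
    have y0: "\<exists>i<n. y i \<noteq> 0"
    proof (rule ccontr)
      assume "\<not> ?thesis"
      then have "\<forall>i<n. y i = 0 * x i" by simp
      then show False using x unfolding parallel_def y_def by blast
    qed
    have xy: "\<not> parallel x y"
    proof
      assume "parallel x y"
      then obtain c where c: "\<forall>i<n. x i = c * y i" unfolding parallel_def by blast
      then have "c \<noteq> 0" using x0 by auto
      then have "\<forall>i<n. y i = 1 / c * x i" using c by simp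
      then show False using x unfolding parallel_def y_def by blast
    qed
    obtain h1 where h1: "dot h1 x = 0" "dot h1 y \<noteq> 0"
      using functional_separating[OF x0 x[folded y_def]] by blast
    obtain h0 where h0: "dot h0 y = 0" "dot h0 x \<noteq> 0" using functional_separating[OF y0 xy] by blast
    define X where "X = (\<lambda>i::nat. if i = 0 then x else y)"
    define F where "F = (\<lambda>i::nat. if i = 0 then (\<lambda>k. h0 k / dot h0 x) else (\<lambda>k. h1 k / dot h1 y))"
    have "biorth 2 X F"
      using h0 h1 by (auto simp: biorth_def X_def F_def less_2_cases_iff dot_simps)
    then obtain X' F' where b: "biorth n X' F'" "\<And>i. i < 2 \<Longrightarrow> X' i = X i" "\<And>i. i < 2 \<Longrightarrow> F' i = F i"
      using biorth_extend[of 2 X F] n3 by auto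
    have X01: "X' 0 = x" "X' 1 = y" using b(2) by (auto simp: X_def)
    have d: "dot (F' k) x = of_bool (k = 0)" "dot (F' k) y = of_bool (k = 1)" if "k < n" for k
    proof -
      have "dot (F' k) (X' 0) = of_bool (k = 0)" "dot (F' k) (X' 1) = of_bool (k = 1)"
        using b(1) that n3 unfolding biorth_def by auto
      then show "dot (F' k) x = of_bool (k = 0)" "dot (F' k) y = of_bool (k = 1)" unfolding X01 .
    qed
    define w where "w = apply_mat B (\<Sigma> x)"
    have "dot (\<Sigma> (F' 0)) w = 0"
      unfolding w_def using d[of 0] n3 by (intro H') (auto simp: y_def[symmetric])
    \<comment> \<open>A functional is admissible only if it has value 1 at \<open>x\<close>, so the
      members of the dual basis other than the zeroth are tested after adding \<open>F' 0\<close>.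
      All values at \<open>y\<close> are then 0 or 1.\<close>
    moreover have "dot (\<Sigma> (F' 0)) w + dot (\<Sigma> (F' k)) w = of_bool (k = 1)" if k: "k < n" "k \<noteq> 0" for k
    proof -
      have "dot (\<Sigma> (\<lambda>l. F' 0 l + F' k l)) w = of_bool (k = 1)"
        unfolding w_def using d[of 0] d[OF k(1)] k n3
        by (intro H') (auto simp: y_def[symmetric] dot_simps)
      moreover have "\<Sigma> (\<lambda>l. F' 0 l + F' k l) = (\<lambda>l. \<Sigma> (F' 0) l + \<Sigma> (F' k) l)" by (simp add: \<Sigma>_def hom_distribs)
      ultimately show ?thesis by (simp add: dot_simps)
    qed
    ultimately have w: "dot (\<Sigma> (F' k)) w = of_bool (k = 1)" if "k < n" for k using that by (cases "k = 0") auto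
    have "biorth n (\<lambda>i. \<Sigma> (X' i)) (\<lambda>i. \<Sigma> (F' i))" using b(1) by (auto simp: biorth_def dot\<Sigma>)
    moreover have "dot (\<Sigma> (F' k)) (\<lambda>i. w i - \<Sigma> y i) = 0" if "k < n" for k
      unfolding dot_simps using w[OF that] d(2)[OF that] by (simp add: dot\<Sigma>)
    ultimately have "w i - \<Sigma> y i = 0" if "i < n" for i using biorth_zero that by blast
    then show ?thesis by (simp add: good_def w_def \<Sigma>_def y_def)
  qed
  have good_diff: "good x" if "good (\<lambda>i. x i + t * v i)" "good v" "\<sigma> t = t" for x v t
  proof -
    have "\<Sigma> (\<lambda>i. x i + t * v i) = (\<lambda>i. \<Sigma> x i + t * \<Sigma> v i)" using that(3) by (simp add: \<Sigma>_def hom_distribs)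
    then show ?thesis using that unfolding good_def by (simp add: apply_mat_simps hom_distribs)
  qed
  have "\<exists>v. \<not> parallel (apply_mat A v) v"
  proof (rule ccontr)
    assume "\<not> ?thesis"
    then have par: "parallel (apply_mat A v) v" for v by blast
    have off: "A $$ (i, j) = 0" if "i < n" "j < n" "i \<noteq> j" for i j
      using par[of "unit j"] that unfolding parallel_def by (auto simp: apply_mat_unit)
    have eq: "A $$ (i, i) = A $$ (0, 0)" if i: "i < n" for i
    proof (cases "i = 0")
      case False
      obtain c where c: "\<forall>k<n. apply_mat A (\<lambda>k. unit i k + unit 0 k) k = c * (unit i k + unit 0 k)"
        using par unfolding parallel_def by blast
      have ap: "apply_mat A (\<lambda>k. unit i k + unit 0 k) k = A $$ (k, i) + A $$ (k, 0)" if "k < n" for k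
        using that i n3 by (simp add: apply_mat_simps apply_mat_unit)
      show ?thesis using c[rule_format, of i] c[rule_format, of 0] ap[of i] ap[of 0] off[of i 0] off[of 0 i] i False n3
        by simp
    qed simp
    have "A = A $$ (0, 0) \<cdot>\<^sub>m 1\<^sub>m n"
    proof (rule eq_matI)
      fix i j assume "i < dim_row (A $$ (0, 0) \<cdot>\<^sub>m 1\<^sub>m n)" "j < dim_col (A $$ (0, 0) \<cdot>\<^sub>m 1\<^sub>m n)"
      then have "i < n" "j < n" by auto
      then show "A $$ (i, j) = (A $$ (0, 0) \<cdot>\<^sub>m 1\<^sub>m n) $$ (i, j)"
        using off[of i j] eq[of i] by (cases "i = j") simp_all
    qed (use A in auto)
    then show False using ns by blast
  qed
  then obtain v where v: "\<not> parallel (apply_mat A v) v" by blast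
  have "good x" for x
  proof (rule ccontr)
    assume ng: "\<not> good x"
    \<comment> \<open>If \<open>x\<close> were not good, every \<open>x + t v\<close> with
      \<open>t\<close> fixed by \<sigma> would be an eigenvector. The values 0, 1 and 2 are fixed by
      every field endomorphism, and three eigenvectors on this line make \<open>v\<close> an
      eigenvector too.\<close>
    have "parallel (apply_mat A (\<lambda>i. x i + t * v i)) (\<lambda>i. x i + t * v i)" if "\<sigma> t = t" for t
      using noneig good_diff[OF _ noneig[OF v] that] ng by blast
    note par = this[unfolded parallel_def]
    obtain \<alpha> where 0: "\<forall>i<n. apply_mat A (\<lambda>i. x i + 0 * v i) i = \<alpha> * (x i + 0 * v i)"
      using par[OF hom_zero] by blast
    obtain \<beta> where 1: "\<forall>i<n. apply_mat A (\<lambda>i. x i + 1 * v i) i = \<beta> * (x i + 1 * v i)"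
      using par[OF hom_one] by blast
    obtain \<gamma> where 2: "\<forall>i<n. apply_mat A (\<lambda>i. x i + 2 * v i) i = \<gamma> * (x i + 2 * v i)"
      using par[OF hom_numeral] by blast
    from 0 1 2 have e: "apply_mat A x i = \<alpha> * x i" "apply_mat A x i + apply_mat A v i = \<beta> * (x i + v i)"
      "apply_mat A x i + 2 * apply_mat A v i = \<gamma> * (x i + 2 * v i)" if "i < n" for i
      using that by (auto simp: apply_mat_simps)
    have Av: "apply_mat A v i = \<beta> * v i + (\<beta> - \<alpha>) * x i" if "i < n" for i
      using e[OF that] by (simp add: algebra_simps)
    have key: "(2 * \<beta> - \<alpha> - \<gamma>) * x i = 2 * (\<gamma> - \<beta>) * v i" if "i < n" for i
    proof -
      have "\<alpha> * x i + 2 * (\<beta> * v i + (\<beta> - \<alpha>) * x i) = \<gamma> * (x i + 2 * v i)" using e[OF that] Av[OF that] by simp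
      then show ?thesis by (simp add: algebra_simps)
    qed
    show False
    proof (cases "\<gamma> = \<beta>")
      case False
      define r where "r = (2 * \<beta> - \<alpha> - \<gamma>) / (2 * (\<gamma> - \<beta>))"
      have vr: "v i = r * x i" if "i < n" for i using key[OF that] False by (simp add: r_def field_simps)
      have "apply_mat A v i = \<alpha> * v i" if "i < n" for i
      proof -
        have "apply_mat A v i = apply_mat A (\<lambda>i. r * x i) i" unfolding apply_mat_def using vr by (intro sum.cong) auto
        then show ?thesis using e(1)[OF that] vr[OF that] by (simp add: apply_mat_simps)
      qed
      then show ?thesis using v unfolding parallel_def by blast
    next
      case True
      then have "(\<beta> - \<alpha>) * x i = 0" if "i < n" for i using key[OF that] by (simp add: algebra_simps)
      then have "\<forall>i<n. apply_mat A v i = \<beta> * v i" using Av by simp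
      then show ?thesis using v unfolding parallel_def by blast
    qed
  qed
  then have good: "good (unit j)" for j by blast
  have \<Sigma>u: "\<Sigma> (unit j) = unit j" for j by (auto simp: \<Sigma>_def unit_def fun_eq_iff)
  show ?thesis
  proof (rule eq_matI)
    fix i j assume "i < dim_row (map_mat \<sigma> A)" "j < dim_col (map_mat \<sigma> A)"
    then have ij: "i < n" "j < n" using A by auto
    show "B $$ (i, j) = map_mat \<sigma> A $$ (i, j)"
      using good[of j] ij A unfolding good_def \<Sigma>u by (simp add: apply_mat_unit)
  qed (use A B in auto)
qed

section \<open>Test elements with rational eigenvalues\<close>

definition q :: complex where "q = 1 / 2 ^ (n - 1)"

text \<open>The eigenvalue 2 has multiplicity \<open>n - 1\<close>, and \<open>q\<close> is the
  remaining eigenvalue forced by determinant one. The inverse has the eigenvalues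
  \<open>1 / 2\<close> and \<open>1 / q\<close>, as in \<open>asym_inv\<close>.\<close>

definition asym :: "complex mat \<Rightarrow> complex mat" where "asym P = comb 2 (q - 2) P"
definition asym_inv :: "complex mat \<Rightarrow> complex mat" where "asym_inv P = comb (1 / 2) (1 / q - 1 / 2) P"

lemma q_ne: "q \<noteq> 0" "q \<noteq> 2" "q \<noteq> - 2" "1 / q \<noteq> 1 / 2"
proof -
  have n: "n - 1 \<noteq> 0" using n3 by simp
  have p: "(2::complex) ^ (n - 1) = of_nat (2 ^ (n - 1))" by simp
  have "cmod q < 1" unfolding q_def using n by (simp add: norm_divide norm_power one_less_power)
  then show "q \<noteq> 2" "q \<noteq> - 2" by auto
  show "q \<noteq> 0" by (simp add: q_def)
  then show "1 / q \<noteq> 1 / 2" using \<open>q \<noteq> 2\<close> by (simp add: field_simps)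
qed

lemma asym_G: "P \<in> rank_one \<Longrightarrow> asym P \<in> G"
  using rank_one_carrier[of P] by (simp add: asym_def G_iff det_comb q_def)

lemma ct_asym: "P \<in> rank_one \<Longrightarrow> ct (asym P) = asym_inv (transpose_mat P)"
  using ct_comb[of P 2 "q - 2"] q_ne by (simp add: asym_def asym_inv_def)

text \<open>Both eigenvalues are rational, so every field endomorphism fixes them and acts on
  \<open>P\<close> only; the parameter of a reflection, being a root of -1, may be moved.\<close>

lemma map_mat_asym:
  assumes \<sigma>: "nonzero_field_endomorphism \<sigma>" and P: "P \<in> carrier_mat n n"
  shows "map_mat \<sigma> (asym P) = asym (map_mat \<sigma> P)"
proof -
  interpret field_hom \<sigma> by (rule field_hom_endomorphism[OF \<sigma>])
  have two: "\<sigma> 2 = 2" by (rule hom_numeral)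
  have "\<sigma> q = q" by (simp add: q_def hom_distribs two)
  then show ?thesis using map_mat_comb[OF \<sigma> P] by (simp add: asym_def hom_distribs two)
qed

lemma asym_ne:
  assumes "P \<in> rank_one" "Q \<in> rank_one" shows "asym P \<noteq> asym_inv Q"
  using comb_eq_iff(1)[OF assms, of "q - 2" 2 "1 / 2" "1 / q - 1 / 2"] q_ne by (auto simp: asym_def asym_inv_def)

lemma asym_inj: "P \<in> rank_one \<Longrightarrow> Q \<in> rank_one \<Longrightarrow> asym P = asym Q \<Longrightarrow> P = Q"
  using comb_eq_iff(3)[of P Q "q - 2" 2] q_ne by (auto simp: asym_def)

lemma asym_inv_inj: "P \<in> rank_one \<Longrightarrow> Q \<in> rank_one \<Longrightarrow> asym_inv P = asym_inv Q \<Longrightarrow> P = Q"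
  using comb_eq_iff(3)[of P Q "1 / q - 1 / 2" "1 / 2"] q_ne by (auto simp: asym_inv_def)

lemma conj_asym: "inverse_pair S S' \<Longrightarrow> P \<in> carrier_mat n n \<Longrightarrow> S * asym P * S' = asym (S * P * S')"
  "inverse_pair S S' \<Longrightarrow> P \<in> carrier_mat n n \<Longrightarrow> S * asym_inv P * S' = asym_inv (S * P * S')"
  by (simp_all add: asym_def asym_inv_def conj_comb)

lemma standard_reflection:
  assumes S: "inverse_pair S S'" and \<tau>: "nonzero_field_endomorphism \<tau>" and P: "P \<in> rank_one"
  shows "S * map_mat \<tau> (asym P) * S' = asym (S * map_mat \<tau> P * S')"
    "S * ct (map_mat \<tau> (asym P)) * S' = asym_inv (S * transpose_mat (map_mat \<tau> P) * S')"
    "S * map_mat \<tau> (reflection s P) * S' = reflection (\<tau> s) (S * map_mat \<tau> P * S')"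
    "s ^ n = - 1 \<Longrightarrow> S * ct (map_mat \<tau> (reflection s P)) * S' = reflection (1 / \<tau> s) (S * transpose_mat (map_mat \<tau> P) * S')"
proof -
  note P\<tau> = map_mat_rank_one[OF \<tau> P]
  note c = rank_one_carrier[OF P] rank_one_carrier[OF P\<tau>] rank_one_carrier[OF transpose_rank_one[OF P\<tau>]]
  show "S * map_mat \<tau> (asym P) * S' = asym (S * map_mat \<tau> P * S')"
    "S * ct (map_mat \<tau> (asym P)) * S' = asym_inv (S * transpose_mat (map_mat \<tau> P) * S')"
    "S * map_mat \<tau> (reflection s P) * S' = reflection (\<tau> s) (S * map_mat \<tau> P * S')"
    using conj_asym[OF S] conj_reflection[OF S] c by (simp_all add: map_mat_asym[OF \<tau>] map_mat_reflection[OF \<tau>] ct_asym[OF P\<tau>])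
  show "S * ct (map_mat \<tau> (reflection s P)) * S' = reflection (1 / \<tau> s) (S * transpose_mat (map_mat \<tau> P) * S')"
    if "s ^ n = - 1"
    unfolding map_mat_reflection[OF \<tau> c(1)] ct_reflection[OF P\<tau> root_nonzero[OF endomorphism_root[OF \<tau> that]]]
    by (rule conj_reflection[OF S c(3)])
qed

lemma local_pair:
  assumes \<phi>: "local_aut \<phi>" and AB: "A \<in> G" "B \<in> G"
  obtains (entrywise) S S' \<tau> where "inverse_pair S S'" "nonzero_field_endomorphism \<tau>"
      "\<phi> A = S * map_mat \<tau> A * S'" "\<phi> B = S * map_mat \<tau> B * S'"
  | (contragredient) S S' \<tau> where "inverse_pair S S'" "nonzero_field_endomorphism \<tau>"
      "\<phi> A = S * ct (map_mat \<tau> A) * S'" "\<phi> B = S * ct (map_mat \<tau> B) * S'"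
proof -
  obtain f where f: "sl_aut f" "\<phi> A = f A" "\<phi> B = f B" using \<phi> AB unfolding local_aut_def by blast
  obtain S S' \<tau> where S: "inverse_pair S S'" "nonzero_field_endomorphism \<tau>" and
    "(\<forall>A\<in>G. f A = S * map_mat \<tau> A * S') \<or> (\<forall>A\<in>G. f A = S * ct (map_mat \<tau> A) * S')"
    using sl_aut_standard[OF f(1)] unfolding standard_def by blast
  then show ?thesis
    using entrywise[OF S] contragredient[OF S] f AB by metis
qed

lemma map_mat_smult:
  assumes "nonzero_field_endomorphism \<tau>" shows "map_mat \<tau> (c \<cdot>\<^sub>m A) = \<tau> c \<cdot>\<^sub>m map_mat \<tau> A"
  using assms by (auto simp: nonzero_field_endomorphism_def intro!: eq_matI)

text \<open>The elements \<open>asym P\<close> are not conjugate to inverses of each other, so they reveal whether an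
  automorphism is of the first or of the second kind.\<close>

lemma local_aut_normal:
  assumes \<phi>: "local_aut \<phi>" and \<sigma>: "nonzero_field_endomorphism \<sigma>" and s: "s ^ n = - 1" and \<mu>: "\<mu> ^ n = - 1"
    and refl: "\<And>P. P \<in> rank_one \<Longrightarrow> \<phi> (reflection s P) = reflection \<mu> (map_mat \<sigma> P)"
    and A: "A \<in> G"
  shows "\<phi> A = map_mat \<sigma> A"
proof -
  interpret \<sigma>: field_hom \<sigma> by (rule field_hom_endomorphism[OF \<sigma>])
  have rG: "reflection s P \<in> G" if "P \<in> rank_one" for P using reflection_G_iff[OF that] s by simp
  have \<sigma>R: "map_mat \<sigma> P \<in> rank_one" if "P \<in> rank_one" for P using map_mat_rank_one[OF \<sigma> that] .
  have E0: "E 0 \<in> rank_one" using E_rank_one n3 by simp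
  have conjR: "S * map_mat \<tau> P * S' \<in> rank_one" "S * transpose_mat (map_mat \<tau> P) * S' \<in> rank_one"
    if "inverse_pair S S'" "nonzero_field_endomorphism \<tau>" "P \<in> rank_one" for S S' \<tau> P
    using conj_rank_one[OF that(1)] map_mat_rank_one[OF that(2,3)] transpose_rank_one by auto
  \<comment> \<open>The partner \<open>reflection s P\<close> reveals the idempotent: in either kind
    it forces the conjugated, possibly transposed, \<open>map_mat \<tau> P\<close> to be
    \<open>map_mat \<sigma> P\<close>.\<close>
  have kind: "\<phi> (asym P) = asym (map_mat \<sigma> P) \<or> \<phi> (asym P) = asym_inv (map_mat \<sigma> P)" if P: "P \<in> rank_one" for P
  proof (cases rule: local_pair[OF \<phi> asym_G[OF P] rG[OF P]])
    case (1 S S' \<tau>)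
    then have "reflection \<mu> (map_mat \<sigma> P) = reflection (\<tau> s) (S * map_mat \<tau> P * S')"
      using refl[OF P] standard_reflection(3)[OF 1(1,2) P] by simp
    then have "S * map_mat \<tau> P * S' = map_mat \<sigma> P"
      using reflection_eq_iff[OF \<sigma>R[OF P] conjR(1)[OF 1(1,2) P] \<mu>] by simp
    then show ?thesis using 1(3) standard_reflection(1)[OF 1(1,2) P] by simp
  next
    case (2 S S' \<tau>)
    then have "reflection \<mu> (map_mat \<sigma> P) = reflection (1 / \<tau> s) (S * transpose_mat (map_mat \<tau> P) * S')"
      using refl[OF P] standard_reflection(4)[OF 2(1,2) P s] by simp
    then have "S * transpose_mat (map_mat \<tau> P) * S' = map_mat \<sigma> P"
      using reflection_eq_iff[OF \<sigma>R[OF P] conjR(2)[OF 2(1,2) P] \<mu>] by simp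
    then show ?thesis using 2(3) standard_reflection(2)[OF 2(1,2) P] by simp
  qed
  \<comment> \<open>A pair of two test elements has one automorphism, so the kind cannot vary with
    \<open>P\<close>.\<close>
  have uniform: "\<phi> (asym Q) = asym (map_mat \<sigma> Q)" if P: "P \<in> rank_one" and Q: "Q \<in> rank_one"
    and "\<phi> (asym P) = asym (map_mat \<sigma> P)" for P Q
  proof (cases rule: local_pair[OF \<phi> asym_G[OF P] asym_G[OF Q]])
    case (1 S S' \<tau>)
    then have "\<phi> (asym Q) \<noteq> asym_inv (map_mat \<sigma> Q)"
      using asym_ne[OF conjR(1)[OF 1(1,2) Q] \<sigma>R[OF Q]] standard_reflection(1)[OF 1(1,2) Q] by simp
    then show ?thesis using kind[OF Q] by simp
  next
    case (2 S S' \<tau>)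
    then show ?thesis
      using that(3) asym_ne[OF \<sigma>R[OF P] conjR(2)[OF 2(1,2) P]] standard_reflection(2)[OF 2(1,2) P] by simp
  qed
  have ct_\<tau>: "P * mi A * P = t \<cdot>\<^sub>m P \<Longrightarrow>
      transpose_mat (map_mat \<tau> P) * ct (map_mat \<tau> A) * transpose_mat (map_mat \<tau> P) = \<tau> t \<cdot>\<^sub>m transpose_mat (map_mat \<tau> P)"
    if \<tau>: "nonzero_field_endomorphism \<tau>" and P: "P \<in> rank_one" and A: "A \<in> G" for \<tau> P A t
  proof -
    assume eq: "P * mi A * P = t \<cdot>\<^sub>m P"
    have c: "P \<in> carrier_mat n n" "mi A \<in> carrier_mat n n" using rank_one_carrier[OF P] G_carrier[OF mi_G[OF A]] .
    have m: "map_mat \<tau> P * map_mat \<tau> (mi A) * map_mat \<tau> P = map_mat \<tau> (P * mi A * P)"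
      using c by (simp add: map_mat_mult[OF \<tau>] mult_carrier_mat[of _ n n _ n])
    have c': "map_mat \<tau> P \<in> carrier_mat n n" "map_mat \<tau> (mi A) \<in> carrier_mat n n" using c by auto
    have "ct (map_mat \<tau> A) = transpose_mat (map_mat \<tau> (mi A))"
      by (rule ct_inverse_pair(1)[OF map_mat_inverse_pair[OF \<tau> G_inverse_pair[OF A]]])
    then have "transpose_mat (map_mat \<tau> P) * ct (map_mat \<tau> A) * transpose_mat (map_mat \<tau> P) =
        transpose_mat (map_mat \<tau> P * (map_mat \<tau> (mi A) * map_mat \<tau> P))"
      using c' transpose_mult[of "map_mat \<tau> P" n n "map_mat \<tau> (mi A) * map_mat \<tau> P" n]
        transpose_mult[of "map_mat \<tau> (mi A)" n n "map_mat \<tau> P" n] by simp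
    also have "map_mat \<tau> P * (map_mat \<tau> (mi A) * map_mat \<tau> P) = map_mat \<tau> (P * mi A * P)"
      unfolding m[symmetric] using c' by (simp add: assoc_mult_mat[of _ n n _ n _ n])
    finally show ?thesis unfolding eq map_mat_smult[OF \<tau>] by (auto intro!: eq_matI)
  qed
  have t01: "\<tau> t = t" if "t \<in> {0, 1}" "nonzero_field_endomorphism \<tau>" for t :: complex and \<tau> :: "complex \<Rightarrow> complex"
  proof -
    interpret field_hom \<tau> by (rule field_hom_endomorphism[OF that(2)])
    show ?thesis using that(1) by auto
  qed
  have smult_conj: "S * (t \<cdot>\<^sub>m P) * S' = t \<cdot>\<^sub>m (S * P * S')"
    if "inverse_pair S S'" "P \<in> carrier_mat n n" for S S' t P
    using that mult_carrier_mat[of S n n P n]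
    by (simp add: inverse_pair_def mult_smult_distrib[of S n n P n] mult_smult_assoc_mat[of "S * P" n n S' n])
  have conj3: "(S * P * S') * (S * B * S') * (S * P * S') = S * (P * B * P) * S'"
    if "inverse_pair S S'" "P \<in> carrier_mat n n" "B \<in> carrier_mat n n" for S S' P B
    using conj_mult[OF that(1)] that by (simp add: mult_carrier_mat[of _ n n _ n])
  \<comment> \<open>The partner \<open>asym P\<close> identifies \<open>P\<close> under the unknown
    \<tau>, and a compression equal to 0 or \<open>P\<close> is carried over since \<tau> fixes 0
    and 1. The same argument with inverses gives \<open>minus\<close>.\<close>
  have plus: "\<phi> A = map_mat \<sigma> A"
    if A: "A \<in> G" and ns: "\<And>c. A \<noteq> c \<cdot>\<^sub>m 1\<^sub>m n" and pos: "\<And>P. P \<in> rank_one \<Longrightarrow> \<phi> (asym P) = asym (map_mat \<sigma> P)" for A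
  proof (rule compression_determines[OF \<sigma> G_carrier[OF A] _ ns])
    show "\<phi> A \<in> carrier_mat n n"
      using \<phi> A sl_autD(1) G_carrier unfolding local_aut_def by metis
    fix P :: "complex mat" and t :: complex
    assume P: "P \<in> rank_one" and t: "t \<in> {0, 1}" and eq: "P * A * P = t \<cdot>\<^sub>m P"
    show "map_mat \<sigma> P * \<phi> A * map_mat \<sigma> P = t \<cdot>\<^sub>m map_mat \<sigma> P"
    proof (cases rule: local_pair[OF \<phi> A asym_G[OF P]])
      case (1 S S' \<tau>)
      have c: "map_mat \<tau> P \<in> carrier_mat n n" "map_mat \<tau> A \<in> carrier_mat n n"
        using rank_one_carrier[OF P] G_carrier[OF A] by auto
      have "S * map_mat \<tau> P * S' = map_mat \<sigma> P"
        using asym_inj[OF conjR(1)[OF 1(1,2) P] \<sigma>R[OF P]] 1(4) pos[OF P] standard_reflection(1)[OF 1(1,2) P] by simp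
      moreover have "map_mat \<tau> P * map_mat \<tau> A * map_mat \<tau> P = map_mat \<tau> (P * A * P)"
        using rank_one_carrier[OF P] G_carrier[OF A] by (simp add: map_mat_mult[OF 1(2)] mult_carrier_mat[of _ n n _ n])
      ultimately show ?thesis
        using conj3[OF 1(1) c] smult_conj[OF 1(1) c(1)] unfolding eq 1(3) map_mat_smult[OF 1(2)] t01[OF t 1(2)] by simp
    next
      case (2 S S' \<tau>)
      then show ?thesis
        using pos[OF P] asym_ne[OF \<sigma>R[OF P] conjR(2)[OF 2(1,2) P]] standard_reflection(2)[OF 2(1,2) P] by simp
    qed
  qed
  have minus: "\<phi> A = map_mat \<sigma> (mi A)"
    if A: "A \<in> G" and ns: "\<And>c. mi A \<noteq> c \<cdot>\<^sub>m 1\<^sub>m n" and neg: "\<And>P. P \<in> rank_one \<Longrightarrow> \<phi> (asym P) = asym_inv (map_mat \<sigma> P)" for A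
  proof (rule compression_determines[OF \<sigma> G_carrier[OF mi_G[OF A]] _ ns])
    show "\<phi> A \<in> carrier_mat n n"
      using \<phi> A sl_autD(1) G_carrier unfolding local_aut_def by metis
    fix P :: "complex mat" and t :: complex
    assume P: "P \<in> rank_one" and t: "t \<in> {0, 1}" and eq: "P * mi A * P = t \<cdot>\<^sub>m P"
    show "map_mat \<sigma> P * \<phi> A * map_mat \<sigma> P = t \<cdot>\<^sub>m map_mat \<sigma> P"
    proof (cases rule: local_pair[OF \<phi> A asym_G[OF P]])
      case (1 S S' \<tau>)
      then show ?thesis
        using neg[OF P] asym_ne[OF conjR(1)[OF 1(1,2) P] \<sigma>R[OF P]] standard_reflection(1)[OF 1(1,2) P] by simp
    next
      case (2 S S' \<tau>)
      have c: "transpose_mat (map_mat \<tau> P) \<in> carrier_mat n n" "ct (map_mat \<tau> A) \<in> carrier_mat n n"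
        using rank_one_carrier[OF P] G_carrier[OF ct_G[OF map_mat_G[OF 2(2) A]]] by auto
      have "S * transpose_mat (map_mat \<tau> P) * S' = map_mat \<sigma> P"
        using asym_inv_inj[OF conjR(2)[OF 2(1,2) P] \<sigma>R[OF P]] 2(4) neg[OF P] standard_reflection(2)[OF 2(1,2) P] by simp
      then show ?thesis
        using conj3[OF 2(1) c] smult_conj[OF 2(1) c(1), of t] ct_\<tau>[OF 2(2) P A eq] t01[OF t 2(2)] unfolding 2(3) by simp
    qed
  qed
  let ?N = "outer (unit 0) (unit 1)"
  have n01: "0 < n" "1 < n" using n3 by auto
  \<comment> \<open>The second kind would make \<phi> act as inversion followed by \<sigma>. A
    transvection paired with \<open>asym (E 0)\<close> refutes this: the representing automorphism
    would fix \<open>E 0\<close> by conjugation and carry the matrix unit at \<open>(1, 0)\<close>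
    to the one at \<open>(0, 1)\<close>, but \<open>E 0\<close> annihilates only the former from the
    left.\<close>
  have pos: "\<phi> (asym P) = asym (map_mat \<sigma> P)" if P: "P \<in> rank_one" for P
  proof (rule ccontr)
    assume no: "\<not> ?thesis"
    have neg: "\<phi> (asym Q) = asym_inv (map_mat \<sigma> Q)" if "Q \<in> rank_one" for Q
      using kind[OF that] uniform[OF that P] no by blast
    have dN: "dot (unit 1) (unit 0) = 0" using n01 by (simp add: dot_unit)
    define t where "t = comb 1 1 ?N"
    define t' where "t' = comb 1 (- 1) ?N"
    have tG: "t \<in> G" unfolding t_def by (rule transvection_G[OF dN])
    have tt': "inverse_pair t t'"
      unfolding inverse_pair_def t_def t'_def comb_mult[OF outer_carrier(1) outer_carrier(1)] outer_mult dN
      by (auto simp: comb_def intro!: eq_matI)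
    have "mi t \<noteq> c \<cdot>\<^sub>m 1\<^sub>m n" for c
    proof
      assume "mi t = c \<cdot>\<^sub>m 1\<^sub>m n"
      then have "t' $$ (0, 1) = (c \<cdot>\<^sub>m 1\<^sub>m n) $$ (0, 1)" by (simp add: mi[OF tt'])
      then show False using n01 by (simp add: t'_def comb_index)
    qed
    then have "\<phi> t = map_mat \<sigma> (mi t)" using minus[OF tG _ neg] by blast
    then have \<phi>t: "\<phi> t = t'"
      using map_mat_comb[OF \<sigma>, of ?N 1 "- 1"] by (simp add: mi[OF tt'] t'_def map_mat_unit[OF \<sigma>] \<sigma>.hom_uminus)
    have \<phi>a: "\<phi> (asym (E 0)) = asym_inv (E 0)" using neg[OF E0] by (simp add: map_mat_unit[OF \<sigma>])
    show False
    proof (cases rule: local_pair[OF \<phi> tG asym_G[OF E0]])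
      case (1 S S' \<tau>)
      then show ?thesis
        using \<phi>a asym_ne[OF conjR(1)[OF 1(1,2) E0] E0] standard_reflection(1)[OF 1(1,2) E0] by simp
    next
      case (2 S S' \<tau>)
      interpret \<tau>: field_hom \<tau> by (rule field_hom_endomorphism[OF 2(2)])
      note cS = 2(1)[unfolded inverse_pair_def]
      have ET: "transpose_mat (E 0) = E 0" by (rule transpose_outer)
      have SE: "S * E 0 * S' = E 0"
        using asym_inv_inj[OF conjR(2)[OF 2(1,2) E0] E0] 2(4) \<phi>a standard_reflection(2)[OF 2(1,2) E0]
        by (simp add: map_mat_unit[OF 2(2)] ET)
      have "map_mat \<tau> t = t" using map_mat_comb[OF 2(2), of ?N 1 1] by (simp add: t_def map_mat_unit[OF 2(2)])
      then have "ct (map_mat \<tau> t) = comb 1 (- 1) (outer (unit 1) (unit 0))"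
        using ct_inverse_pair(1)[OF tt'] transpose_comb[of ?N 1 "- 1"] by (simp add: t'_def transpose_outer)
      then have "t' = comb 1 (- 1) (S * outer (unit 1) (unit 0) * S')"
        using 2(3) \<phi>t conj_comb[OF 2(1), of "outer (unit 1) (unit 0)" 1 "- 1"] by simp
      then have eq: "comb 1 (- 1) ?N = comb 1 (- 1) (S * outer (unit 1) (unit 0) * S')" unfolding t'_def .
      have SN: "S * outer (unit 1) (unit 0) * S' \<in> carrier_mat n n" using conj_carrier[OF 2(1)] by simp
      have "?N = S * outer (unit 1) (unit 0) * S'"
      proof (rule eq_matI)
        fix i j assume "i < dim_row (S * outer (unit 1) (unit 0) * S')" "j < dim_col (S * outer (unit 1) (unit 0) * S')"
        then have ij: "i < n" "j < n" using SN by auto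
        show "?N $$ (i, j) = (S * outer (unit 1) (unit 0) * S') $$ (i, j)"
          using arg_cong[OF eq, of "\<lambda>M. M $$ (i, j)"] comb_index[OF outer_carrier(1) ij, of 1 "- 1" "unit 0" "unit 1"]
            comb_index[OF SN ij, of 1 "- 1"] by simp
      qed (use SN in auto)
      then have "E 0 * ?N = (S * E 0 * S') * (S * outer (unit 1) (unit 0) * S')" using SE by simp
      also have "\<dots> = S * (E 0 * outer (unit 1) (unit 0)) * S'" by (rule conj_mult[OF 2(1)]) auto
      also have "E 0 * outer (unit 1) (unit 0) = 0\<^sub>m n n" unfolding outer_mult using n01
        by (auto simp: dot_unit intro!: eq_matI)
      also have "S * 0\<^sub>m n n * S' = 0\<^sub>m n n" by (rule conj_zero[OF 2(1)])
      finally have "(E 0 * ?N) $$ (0, 1) = 0" using n01 by simp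
      then show False unfolding outer_mult using n01 by (simp add: dot_unit)
    qed
  qed
  show ?thesis
  proof (cases "\<exists>c. A = c \<cdot>\<^sub>m 1\<^sub>m n")
    case False
    then show ?thesis using plus[OF A _ pos] by blast
  next
    case True
    then obtain \<zeta> where \<zeta>: "A = \<zeta> \<cdot>\<^sub>m 1\<^sub>m n" by blast
    have "\<zeta> ^ n = 1" using A unfolding \<zeta> by (simp add: G_iff)
    then have \<zeta>0: "\<zeta> \<noteq> 0" using n3 by (auto simp: power_0_left)
    \<comment> \<open>Compressions carry no information about a scalar matrix, so it is multiplied
      by \<open>asym (E 0)\<close>. The product \<open>B\<close> is not scalar, its image is known,
      and the pair of \<open>A\<close> and \<open>B\<close> leads back to \<zeta>.\<close>
    define B where "B = comb (2 * \<zeta>) (\<zeta> * (q - 2)) (E 0)"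
    have BA: "B = A * asym (E 0)"
      unfolding \<zeta> by (auto simp: B_def asym_def comb_def mult_smult_assoc_mat[of _ n n _ n] algebra_simps intro!: eq_matI)
    then have BG: "B \<in> G" using mult_G[OF A asym_G[OF E0]] by simp
    have b0: "\<zeta> * (q - 2) \<noteq> 0" using \<zeta>0 q_ne by simp
    have "B \<noteq> c \<cdot>\<^sub>m 1\<^sub>m n" for c unfolding B_def by (rule comb_not_scalar[OF E0 b0])
    then have "\<phi> B = map_mat \<sigma> B" using plus[OF BG _ pos] by blast
    then have \<phi>B: "\<phi> B = comb (\<sigma> (2 * \<zeta>)) (\<sigma> (\<zeta> * (q - 2))) (E 0)"
      using map_mat_comb[OF \<sigma>, of "E 0"] by (simp add: B_def map_mat_unit[OF \<sigma>])
    have fixed: "\<tau> 2 = 2" "\<tau> q = q" if \<tau>: "nonzero_field_endomorphism \<tau>" for \<tau> :: "complex \<Rightarrow> complex"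
    proof -
      interpret field_hom \<tau> by (rule field_hom_endomorphism[OF \<tau>])
      show two: "\<tau> 2 = 2" by (rule hom_numeral)
      show "\<tau> q = q" by (simp add: q_def hom_distribs two)
    qed
    show ?thesis
    proof (cases rule: local_pair[OF \<phi> A BG])
      case (1 S S' \<tau>)
      interpret \<tau>: field_hom \<tau> by (rule field_hom_endomorphism[OF 1(2)])
      have "\<phi> B = comb (\<tau> (2 * \<zeta>)) (\<tau> (\<zeta> * (q - 2))) (S * E 0 * S')"
        using 1(4) map_mat_comb[OF 1(2), of "E 0"] conj_comb[OF 1(1), of "E 0"] by (simp add: B_def map_mat_unit[OF 1(2)])
      moreover have "\<tau> (\<zeta> * (q - 2)) \<noteq> 0" using b0 by (simp only: \<tau>.hom_0_iff not_False_eq_True)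
      ultimately have "\<tau> (2 * \<zeta>) = \<sigma> (2 * \<zeta>)"
        using comb_eq_iff(1)[OF conj_rank_one[OF 1(1) E0] E0, of "\<tau> (\<zeta> * (q - 2))" "\<tau> (2 * \<zeta>)"] \<phi>B by metis
      then have "\<tau> \<zeta> = \<sigma> \<zeta>" using fixed[OF \<sigma>] fixed[OF 1(2)] by (simp add: \<sigma>.hom_mult \<tau>.hom_mult)
      moreover have "\<phi> A = \<tau> \<zeta> \<cdot>\<^sub>m 1\<^sub>m n"
        using 1(3) smult_conj[OF 1(1), of "1\<^sub>m n" "\<tau> \<zeta>"] 1(1) right_mult_one_mat[of S n n]
        unfolding \<zeta> map_mat_smult[OF 1(2)]
        by (simp add: \<tau>.mat_hom_one inverse_pair_def)
      ultimately show ?thesis unfolding \<zeta> map_mat_smult[OF \<sigma>] by (simp add: \<sigma>.mat_hom_one)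
    next
      case (2 S S' \<tau>)
      interpret \<tau>: field_hom \<tau> by (rule field_hom_endomorphism[OF 2(2)])
      define z where "z = \<tau> \<zeta>"
      define w where "w = \<sigma> \<zeta>"
      have z0: "z \<noteq> 0" using \<zeta>0 by (simp add: z_def)
      have "map_mat \<tau> B = comb (2 * z) (z * (q - 2)) (E 0)"
        using map_mat_comb[OF 2(2), of "E 0"] fixed[OF 2(2)]
        by (simp add: B_def map_mat_unit[OF 2(2)] \<tau>.hom_mult \<tau>.hom_minus z_def)
      moreover have "2 * z + z * (q - 2) = z * q" by (simp add: algebra_simps)
      ultimately have "ct (map_mat \<tau> B) = comb (1 / (2 * z)) (1 / (z * q) - 1 / (2 * z)) (E 0)"
        using ct_comb[OF E0, of "2 * z" "z * (q - 2)"] z0 q_ne by (simp add: transpose_outer)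
      then have "\<phi> B = comb (1 / (2 * z)) (1 / (z * q) - 1 / (2 * z)) (S * E 0 * S')"
        using 2(4) conj_comb[OF 2(1), of "E 0"] by simp
      moreover have "\<phi> B = comb (2 * w) (w * (q - 2)) (E 0)"
        using \<phi>B fixed[OF \<sigma>] by (simp add: \<sigma>.hom_mult \<sigma>.hom_minus w_def)
      moreover have "w * (q - 2) \<noteq> 0" using \<zeta>0 q_ne by (simp add: w_def)
      ultimately have "2 * w = 1 / (2 * z)" "w * (q - 2) = 1 / (z * q) - 1 / (2 * z)"
        using comb_eq_iff(1,2)[OF E0 conj_rank_one[OF 2(1) E0], of "w * (q - 2)" "2 * w"] by auto
      then have wz: "4 * (w * z) = 1" "2 * q * (w * z) * (q - 2) = 2 - q"
        using z0 q_ne by (auto simp: field_simps)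
      have "q * (q - 2) = (4 * (w * z)) * (q * (q - 2))" unfolding wz(1) by simp
      also have "\<dots> = 2 * (2 * q * (w * z) * (q - 2))" by (simp add: algebra_simps)
      finally have "q * (q - 2) = 2 * (2 - q)" unfolding wz(2) .
      \<comment> \<open>For the second kind, comparing both eigenvalues of the image of
        \<open>B\<close> gives \<open>w * z = 1 / 4\<close> and then \<open>q = 2\<close> or
        \<open>q = - 2\<close>, which the size of \<open>q\<close> excludes.\<close>
      then have "(q - 2) * (q + 2) = 0" by (simp add: algebra_simps)
      then show ?thesis using q_ne by (auto simp: eq_neg_iff_add_eq_0)
    qed
  qed
qed

section \<open>Local automorphisms and standard maps coincide\<close>

lemma local_aut_standard: "local_aut \<phi> \<Longrightarrow> standard \<phi>"
proof -
  assume \<phi>: "local_aut \<phi>"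
  obtain s :: complex where s: "s ^ n = - 1" by (rule exists_root)
  show ?thesis
  proof (rule standard_form[where C = local_aut, OF s \<phi>])
    show "local_aut (\<lambda>A. h (\<phi> A))" if "sl_aut h" "local_aut \<phi>" for h \<phi>
      by (rule local_aut_comp[OF that])
  qed (auto intro: local_aut_normal[OF _ _ s])
qed

text \<open>Two matrices have finitely many entries, so for each pair \<sigma> can be replaced by a
  field automorphism agreeing with it on these entries.\<close>

lemma standard_local_aut:
  assumes "standard \<phi>"
  shows "local_aut \<phi>"
  unfolding local_aut_def
proof (intro ballI)
  fix A B assume A: "A \<in> G" and B: "B \<in> G"
  obtain S S' \<sigma> where S: "inverse_pair S S'" and \<sigma>: "nonzero_field_endomorphism \<sigma>"
    and either: "(\<forall>A\<in>G. \<phi> A = S * map_mat \<sigma> A * S') \<or> (\<forall>A\<in>G. \<phi> A = S * ct (map_mat \<sigma> A) * S')"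
    using assms unfolding standard_def by blast
  have c: "A \<in> carrier_mat n n" "B \<in> carrier_mat n n" using A B G_carrier by auto
  define X where "X = (\<lambda>(i, j). A $$ (i, j)) ` ({..<n} \<times> {..<n}) \<union> (\<lambda>(i, j). B $$ (i, j)) ` ({..<n} \<times> {..<n})"
  have "finite X" by (simp add: X_def)
  then obtain \<tau> where \<tau>: "field_automorphism \<tau>" "\<And>a. a \<in> X \<Longrightarrow> \<tau> a = \<sigma> a"
    using endomorphism_agrees_with_automorphism[OF \<sigma>] by metis
  have "A $$ (i, j) \<in> X" "B $$ (i, j) \<in> X" if "i < n" "j < n" for i j
    using that by (auto simp: X_def)
  then have eq: "map_mat \<sigma> A = map_mat \<tau> A" "map_mat \<sigma> B = map_mat \<tau> B"
    using \<tau>(2) c by (auto intro!: eq_matI)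
  from either show "\<exists>f. sl_aut f \<and> \<phi> A = f A \<and> \<phi> B = f B"
  proof
    assume "\<forall>A\<in>G. \<phi> A = S * map_mat \<sigma> A * S'"
    then show ?thesis using A B eq sl_aut_comp[OF sl_aut_conj[OF S] sl_aut_map_mat[OF \<tau>(1)]]
      by (intro exI[of _ "(\<lambda>A. S * A * S') \<circ> map_mat \<tau>"]) simp
  next
    assume "\<forall>A\<in>G. \<phi> A = S * ct (map_mat \<sigma> A) * S'"
    then show ?thesis
      using A B eq sl_aut_comp[OF sl_aut_conj[OF S] sl_aut_comp[OF sl_aut_ct sl_aut_map_mat[OF \<tau>(1)]]]
      by (intro exI[of _ "(\<lambda>A. S * A * S') \<circ> (ct \<circ> map_mat \<tau>)"]) simp
  qed
qed

end

theorem theorem3p2: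
  fixes n :: nat and \<phi> :: "complex mat \<Rightarrow> complex mat"
  assumes "n \<ge> 3"
    and "\<phi> \<in> carrier (SL n) \<rightarrow> carrier (SL n)"
  shows "local_automorphism (SL n) \<phi> \<longleftrightarrow>
    (\<exists>T \<in> carrier (GL n). \<exists>\<sigma> :: complex \<Rightarrow> complex.
      nonzero_field_endomorphism \<sigma> \<and>
      ((\<forall>A \<in> carrier (SL n). \<phi> A = T * map_mat \<sigma> A * inv\<^bsub>GL n\<^esub> T) \<or>
       (\<forall>A \<in> carrier (SL n).
          \<phi> A = T * transpose_mat (inv\<^bsub>GL n\<^esub> (map_mat \<sigma> A)) * inv\<^bsub>GL n\<^esub> T)))"
proof -
  interpret dim3 n by unfold_locales (rule assms(1))
  have "local_automorphism (SL n) \<phi> \<longleftrightarrow> local_aut \<phi>"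
    using assms(2) unfolding local_automorphism_def local_aut_def sl_aut_iff Bex_def by simp
  also have "\<dots> \<longleftrightarrow> standard \<phi>"
    using local_aut_standard standard_local_aut by blast
  also have "\<dots> \<longleftrightarrow> (\<exists>T \<in> carrier (GL n). \<exists>\<sigma>. nonzero_field_endomorphism \<sigma> \<and>
      ((\<forall>A\<in>G. \<phi> A = T * map_mat \<sigma> A * mi T) \<or> (\<forall>A\<in>G. \<phi> A = T * ct (map_mat \<sigma> A) * mi T)))"
    unfolding standard_def Bex_def carrier_GL_iff using mi by metis
  finally show ?thesis by (simp add: mi_def ct_def)
qed

end
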